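(* Let $K\subset\mathbb{R}^2$ be the Sierpi\'nski gasket and let $1\leq p\leq 2$. Then $K$ is non-removable for $W^{1,p}$; that is, there exists a continuous function $f\colon\mathbb{R}^2\to\mathbb{R}$ with $f\in W^{1,p}(\mathbb{R}^2\setminus K)$ but $f\notin W^{1,p}(\mathbb{R}^2)$.
   Context: The Sierpi\'nski gasket $K$ is constructed as follows: take a closed equilateral triangle in the plane of sidelength $1$, subdivide it into four equilateral triangles of sidelength $1/2$, and remove the (open) middle triangle; then proceed inductively, subdividing each of the remaining three triangles into four equilateral triangles of sidelength $1/2^2$, removing the open middle ones, and so on. The remaining compact set is $K$. For an open set $U\subset\mathbb{R}^2$, $f\in W^{1,p}(U)$ means that $f\in L^p(U)$ and $f$ has weak first partial derivatives in $U$ that lie in $L^p(U)$. A compact set $K\subset\mathbb{R}^2$ is $W^{1,p}$-removable if every real-valued function that is continuous in $\mathbb{R}^2$ and lies in $W^{1,p}(\mathbb{R}^2\setminus K)$ also lies in $W^{1,p}(\mathbb{R}^2)$; otherwise it is non-removable for $W^{1,p}$. *)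

theory Defs
  imports "HOL-Analysis.Analysis"
begin

text \<open>The Sobolev spaces are defined over an arbitrary Euclidean space; the plane is
  \<^typ>\<open>real \<times> real\<close>, whose norm is the Euclidean one. Integrals are with respect to
  Lebesgue measure.\<close>

definition partial_deriv :: "'a::euclidean_space \<Rightarrow> ('a \<Rightarrow> real) \<Rightarrow> 'a \<Rightarrow> real" where
  "partial_deriv b \<phi> = (\<lambda>x. frechet_derivative \<phi> (at x) b)"

primrec C_k :: "nat \<Rightarrow> ('a::euclidean_space \<Rightarrow> real) \<Rightarrow> bool" where
  "C_k 0 \<phi> \<longleftrightarrow> continuous_on UNIV \<phi>"
| "C_k (Suc k) \<phi> \<longleftrightarrow>
     (\<forall>x. \<phi> differentiable (at x)) \<and> (\<forall>b\<in>Basis. C_k k (partial_deriv b \<phi>))"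

definition test_functions :: "'a::euclidean_space set \<Rightarrow> ('a \<Rightarrow> real) set" where
  "test_functions U =
     {\<phi>. (\<forall>k. C_k k \<phi>) \<and> compact (closure {x. \<phi> x \<noteq> 0}) \<and> closure {x. \<phi> x \<noteq> 0} \<subseteq> U}"

definition Lp :: "real \<Rightarrow> 'a::euclidean_space set \<Rightarrow> ('a \<Rightarrow> real) set" where
  "Lp p U = {f \<in> borel_measurable (lebesgue_on U).
               integrable (lebesgue_on U) (\<lambda>x. \<bar>f x\<bar> powr p)}"

definition locally_integrable :: "'a::euclidean_space set \<Rightarrow> ('a \<Rightarrow> real) \<Rightarrow> bool" where
  "locally_integrable U f \<longleftrightarrow>
     (\<forall>C. compact C \<and> C \<subseteq> U \<longrightarrow> integrable (lebesgue_on C) f)"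

text \<open>Local integrability makes both integrands below integrable, so that no integral
  takes the default value 0 of the Bochner integral.\<close>

definition weak_partial_deriv ::
    "'a::euclidean_space set \<Rightarrow> 'a \<Rightarrow> ('a \<Rightarrow> real) \<Rightarrow> ('a \<Rightarrow> real) \<Rightarrow> bool" where
  "weak_partial_deriv U b f g \<longleftrightarrow>
     locally_integrable U f \<and> locally_integrable U g \<and>
     (\<forall>\<phi>\<in>test_functions U.
        (LINT x|lebesgue_on U. f x * partial_deriv b \<phi> x) =
        - (LINT x|lebesgue_on U. g x * \<phi> x))"

definition W1p :: "real \<Rightarrow> 'a::euclidean_space set \<Rightarrow> ('a \<Rightarrow> real) set" where
  "W1p p U = {f \<in> Lp p U. \<forall>b\<in>Basis. \<exists>g\<in>Lp p U. weak_partial_deriv U b f g}"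

text \<open>Intended for compact \<open>K\<close>.\<close>

definition W1p_removable :: "real \<Rightarrow> (real \<times> real) set \<Rightarrow> bool" where
  "W1p_removable p K \<longleftrightarrow>
     (\<forall>f :: real \<times> real \<Rightarrow> real.
        continuous_on UNIV f \<and> f \<in> W1p p (UNIV - K) \<longrightarrow> f \<in> W1p p UNIV)"

type_synonym triangle = "(real \<times> real) \<times> (real \<times> real) \<times> (real \<times> real)"

text \<open>Triangles are represented by their vertices. The initial triangle, which is unique
  only up to isometry, is placed with one side on the first coordinate axis.\<close>

primrec gasket_triangles :: "nat \<Rightarrow> triangle set" where
  "gasket_triangles 0 = {((0, 0), (1, 0), (1/2, sqrt 3 / 2))}"
| "gasket_triangles (Suc n) = (\<Union>(a, b, c)\<in>gasket_triangles n.
     {(a, midpoint a b, midpoint a c),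
      (midpoint a b, b, midpoint b c),
      (midpoint a c, midpoint b c, c)})"

primrec gasket_stage :: "nat \<Rightarrow> (real \<times> real) set" where
  "gasket_stage 0 = (\<Union>(a, b, c)\<in>gasket_triangles 0. convex hull {a, b, c})"
| "gasket_stage (Suc n) = gasket_stage n -
     (\<Union>(a, b, c)\<in>gasket_triangles n.
        interior (convex hull {midpoint a b, midpoint b c, midpoint a c}))"

definition sierpinski_gasket :: "(real \<times> real) set" where
  "sierpinski_gasket = (\<Inter>n. gasket_stage n)"

lemma compact_sierpinski_gasket: "compact sierpinski_gasket"
proof -
  have stage: "compact (gasket_stage n)" for n
  proof (induction n)
    case 0
    show ?case by (simp add: finite_imp_compact_convex_hull)
  next
    case (Suc n)
    have "open (\<Union>(a, b, c)\<in>gasket_triangles n.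
        interior (convex hull {midpoint a b, midpoint b c, midpoint a c}))"
      by (intro open_UN) auto
    with Suc show ?case by (simp only: gasket_stage.simps compact_diff)
  qed
  have "closed (\<Inter>n. gasket_stage n)"
    by (intro closed_INT ballI compact_imp_closed stage)
  with stage[of 0] have "compact (gasket_stage 0 \<inter> (\<Inter>n. gasket_stage n))"
    by (rule compact_Int_closed)
  moreover have "gasket_stage 0 \<inter> (\<Inter>n. gasket_stage n) = sierpinski_gasket"
    unfolding sierpinski_gasket_def by blast
  ultimately show ?thesis by simp
qed

end

theory Submission
  imports Defs
begin

text \<open>Let \<open>F\<close> be a smooth function of compact support. Off the large triangle put \<open>f = F\<close>, and
  fill the removed triangles level by level: on a triangle removed at level \<open>n\<close>, whose vertices \<open>P i\<close>
  are midpoints of edges on which \<open>f\<close> is already known, take the inverse distance (Shepard)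
  interpolation of the three values \<open>f (P i)\<close> with weights proportional to \<open>\<bar>x - P i\<bar>\<close> to the power
  \<open>-2 \<beta> n\<close>. Since points have zero capacity in \<open>W\<^sup>1\<^sup>,\<^sup>2\<close>, the Dirichlet energy of this interpolation is \<open>O(\<beta> n)\<close>,
  whatever the values are, and it becomes summable over all triangles for \<open>\<beta> n = \<kappa> / 4 ^ n\<close>.

  The oscillation of \<open>f\<close> on the remaining cells tends to zero, so that \<open>f\<close> extends continuously to
  the gasket: it contracts by a factor whenever a nested sequence of cells changes
  direction, and it tends to zero along a sequence shrinking to a fixed corner. The interpolation is almost constant at each scale,
  which keeps the contraction effective.

  The gasket is a null set. If \<open>f\<close> were in \<open>W\<^sup>1\<^sup>,\<^sup>p\<close> of the plane, its gradient off the gasket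
  would therefore integrate to zero, like that of \<open>F\<close>; but for small \<open>\<kappa>\<close> the gradient of \<open>f\<close> inside the
  large triangle is too small to replace that of \<open>F\<close>.\<close>

section \<open>Test functions and weak derivatives\<close>

text \<open>A removed triangle meets the set where values are already known exactly in its three
  nodes, so only three numbers have to be matched. In dimension two the Dirichlet energy is
  invariant under scaling, so the cost of matching them does not depend on the size of the triangle,
  only on the exponent. With up to \<open>3 ^ n\<close> triangles on level \<open>n\<close>, the
  factor \<open>4 ^ n\<close> leaves a geometric series of ratio 3/4.

  The obstacle is continuity: small exponents concentrate the variation near the nodes, so no
  modulus of continuity is uniform over the levels. What survives is that interpolated values are
  convex combinations, and that a node which is nearest up to a factor 4 has weight at least 1/4.
  Two such combinations in a row, available after a change of direction, give the weight 1/16 and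
  hence the contraction factor 15/16; edges that are not fresh are controlled because the
  interpolation varies slowly where the distances to the nodes are comparable.

  The gradient is controlled in \<open>L^2\<close> on a bounded set, which yields all
  \<open>p \<le> 2\<close>. Non-membership needs a single partial derivative, the vertical one, and
  only the vanishing of its total integral.\<close>

definition flat :: "nat \<Rightarrow> real \<Rightarrow> real" where
  "flat j t = (if t > 0 then exp (- 1 / t) / t ^ j else 0)"

text \<open>The powers of \<open>t\<close> in the denominator make the family closed under
  differentiation, so that smoothness of every order is one induction. At 0 the right difference
  quotient becomes \<open>x ^ (j + 1) / exp x\<close> with \<open>x = inverse h\<close> tending to
  infinity.\<close>

lemma flat_DERIV: "(flat j has_real_derivative (flat (j + 2) t - real j * flat (j + 1) t)) (at t)"
proof -
  consider "t > 0" | "t < 0" | "t = 0" by linarith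
  then show ?thesis
  proof cases
    case 1
    have "((\<lambda>t. exp (- 1 / t) / t ^ j) has_real_derivative
        (flat (j + 2) t - real j * flat (j + 1) t)) (at t)"
      using 1
      apply (auto intro!: derivative_eq_intros simp: flat_def)
      apply (cases j)
       apply (auto simp: field_simps power2_eq_square)
      done
    moreover have "eventually (\<lambda>x. x \<in> {0<..}) (nhds t)"
      using 1 by (intro eventually_nhds_in_open) auto
    ultimately show ?thesis
      by (subst DERIV_cong_ev[OF refl _ refl]) (auto elim!: eventually_mono simp: flat_def)
  next
    case 2
    have "((\<lambda>t. 0) has_real_derivative (flat (j + 2) t - real j * flat (j + 1) t)) (at t)"
      using 2 by (auto intro!: derivative_eq_intros simp: flat_def)
    moreover have "eventually (\<lambda>x. x \<in> {..<0}) (nhds t)"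
      using 2 by (intro eventually_nhds_in_open) auto
    ultimately show ?thesis
      by (subst DERIV_cong_ev[OF refl _ refl]) (auto elim!: eventually_mono simp: flat_def)
  next
    case 3
    have "((\<lambda>x::real. x ^ (j + 1) / exp x) \<longlongrightarrow> 0) at_top"
      by (rule tendsto_power_div_exp_0)
    then have "((\<lambda>h::real. inverse h ^ (j + 1) / exp (inverse h)) \<longlongrightarrow> 0) (at_right 0)"
      by (rule filterlim_compose[OF _ filterlim_inverse_at_top_right])
    then have R: "((\<lambda>h. (flat j (0 + h) - flat j 0) / h) \<longlongrightarrow> 0) (at_right 0)"
      by (rule Lim_transform_eventually)
         (auto simp: flat_def eventually_at_filter exp_minus field_simps)
    have L: "((\<lambda>h. (flat j (0 + h) - flat j 0) / h) \<longlongrightarrow> 0) (at_left 0)"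
      by (rule tendsto_eventually) (auto simp: flat_def eventually_at_filter)
    have "((\<lambda>h. (flat j (0 + h) - flat j 0) / h) \<longlongrightarrow> 0) (at 0)"
      using L R by (simp add: filterlim_split_at)
    with 3 show ?thesis
      by (simp add: DERIV_def flat_def)
  qed
qed

lemma flat_bounds: "0 \<le> flat 0 t" "flat 0 t \<le> 1" "t > 0 \<Longrightarrow> flat 0 t > 0" "t \<le> 0 \<Longrightarrow> flat j t = 0"
  by (auto simp: flat_def)

lemma partial_deriv_eqI:
  assumes "(\<phi> has_derivative D) (at x)"
  shows "partial_deriv b \<phi> x = D b"
  using frechet_derivative_at[OF assms] by (simp add: partial_deriv_def)

lemma C_k_Suc_imp: "C_k (Suc k) \<phi> \<Longrightarrow> C_k k \<phi>"
proof (induction k arbitrary: \<phi>)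
  case 0
  then show ?case
    by (auto intro!: differentiable_imp_continuous_on simp: differentiable_on_def)
next
  case (Suc k)
  then show ?case by (simp only: C_k.simps) blast
qed

lemma C_k_const: "C_k k (\<lambda>x::'a::euclidean_space. c)"
proof (induction k arbitrary: c)
  case (Suc k)
  have "partial_deriv b (\<lambda>x::'a. c) = (\<lambda>x. 0)" for b
    by (auto intro!: partial_deriv_eqI[where D = "\<lambda>x. 0"] )
  then show ?case using Suc by (auto)
qed auto

lemma C_k_add: "C_k k \<phi> \<Longrightarrow> C_k k \<psi> \<Longrightarrow> C_k k (\<lambda>x. \<phi> x + \<psi> x)"
proof (induction k arbitrary: \<phi> \<psi>)
  case 0
  then show ?case by (auto intro: continuous_intros)
next
  case (Suc k)
  have "partial_deriv b (\<lambda>x. \<phi> x + \<psi> x) = (\<lambda>x. partial_deriv b \<phi> x + partial_deriv b \<psi> x)" for b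
    using Suc.prems
    by (intro ext partial_deriv_eqI[THEN trans, OF has_derivative_add])
      (auto simp: frechet_derivative_works partial_deriv_def)
  then show ?case using Suc by (auto)
qed

lemma C_k_mult: "C_k k \<phi> \<Longrightarrow> C_k k \<psi> \<Longrightarrow> C_k k (\<lambda>x. \<phi> x * \<psi> x)"
proof (induction k arbitrary: \<phi> \<psi>)
  case 0
  then show ?case by (auto intro: continuous_intros)
next
  case (Suc k)
  have "((\<lambda>x. \<phi> x * \<psi> x) has_derivative
      (\<lambda>h. \<phi> x * frechet_derivative \<psi> (at x) h + frechet_derivative \<phi> (at x) h * \<psi> x)) (at x)" for x
    using Suc.prems by (intro has_derivative_mult) (auto simp: frechet_derivative_works)
  then have eq: "partial_deriv b (\<lambda>x. \<phi> x * \<psi> x) =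
      (\<lambda>x. \<phi> x * partial_deriv b \<psi> x + partial_deriv b \<phi> x * \<psi> x)" for b
    by (intro ext) (subst partial_deriv_eqI, assumption, simp add: partial_deriv_def)
  have "C_k k \<phi>" "C_k k \<psi>"
    using Suc.prems C_k_Suc_imp by blast+
  then have "C_k k (\<lambda>x. \<phi> x * partial_deriv b \<psi> x + partial_deriv b \<phi> x * \<psi> x)" if "b \<in> Basis" for b
    using Suc.prems that by (intro C_k_add Suc.IH) auto
  then show ?case using Suc.prems by (auto simp: eq)
qed

lemma C_k_prod: "(\<And>i. i \<in> I \<Longrightarrow> C_k k (\<phi> i)) \<Longrightarrow> C_k k (\<lambda>x. \<Prod>i\<in>I. \<phi> i x)"
  by (induction I rule: infinite_finite_induct) (auto intro: C_k_const C_k_mult)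

lemma has_derivative_flat_affine:
  "((\<lambda>x. flat j (x \<bullet> v + c)) has_derivative
     (\<lambda>h. (flat (j + 2) (x \<bullet> v + c) - real j * flat (j + 1) (x \<bullet> v + c)) * (h \<bullet> v))) (at x)"
proof -
  have "((\<lambda>x. x \<bullet> v + c) has_derivative (\<lambda>h. h \<bullet> v)) (at x)"
    by (auto intro!: derivative_eq_intros)
  from has_derivative_compose[OF this flat_DERIV[unfolded has_field_derivative_def]]
  show ?thesis by simp
qed

lemma C_k_flat_affine: "C_k k (\<lambda>x. flat j (x \<bullet> v + c))"
proof (induction k arbitrary: j)
  case 0
  show ?case
    by (auto simp: continuous_on_eq_continuous_at
        intro: has_derivative_continuous[OF has_derivative_flat_affine])
next
  case (Suc k)
  have eq: "partial_deriv b (\<lambda>x. flat j (x \<bullet> v + c)) =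
    (\<lambda>x. (b \<bullet> v) * flat (j + 2) (x \<bullet> v + c) + (- real j * (b \<bullet> v)) * flat (j + 1) (x \<bullet> v + c))" for b
    by (rule ext, subst partial_deriv_eqI[OF has_derivative_flat_affine]) (simp add: algebra_simps)
  have "C_k k (partial_deriv b (\<lambda>x. flat j (x \<bullet> v + c)))" for b
    unfolding eq by (intro C_k_add C_k_mult C_k_const Suc.IH)
  moreover have "(\<lambda>x. flat j (x \<bullet> v + c)) differentiable at x" for x
    unfolding differentiable_def by (rule exI has_derivative_flat_affine)+
  ultimately show ?case by simp
qed

text \<open>The factor \<open>k\<close> controls sharpness: at a fixed point of the open box the
  value tends to 1 as \<open>k\<close> grows. It also absorbs dilations, since stretching the box
  about the origin by \<open>r\<close> and replacing \<open>k\<close> by \<open>k / r\<close>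
  amounts to composing with division by \<open>r\<close>.\<close>

definition bump :: "real \<Rightarrow> 'a::euclidean_space \<Rightarrow> 'a \<Rightarrow> 'a \<Rightarrow> real" where
  "bump k a b x = (\<Prod>i\<in>Basis. flat 0 (k * (x \<bullet> i - a \<bullet> i)) * flat 0 (k * (b \<bullet> i - x \<bullet> i)))"

lemma C_k_bump: "C_k n (bump k a b)"
proof -
  have "bump k a b = (\<lambda>x. \<Prod>i\<in>Basis. flat 0 (x \<bullet> (k *\<^sub>R i) + - k * (a \<bullet> i)) *
      flat 0 (x \<bullet> ((- k) *\<^sub>R i) + k * (b \<bullet> i)))"
    unfolding bump_def by (intro ext prod.cong refl) (simp add: algebra_simps)
  then show ?thesis by (simp only:) (intro C_k_prod C_k_mult C_k_flat_affine)
qed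

lemma bump_bounds: "0 \<le> bump k a b x" "bump k a b x \<le> 1"
  unfolding bump_def by (auto intro!: prod_nonneg prod_le_1 mult_nonneg_nonneg mult_le_one flat_bounds)

lemma bump_pos: "k > 0 \<Longrightarrow> x \<in> box a b \<Longrightarrow> bump k a b x > 0"
  unfolding bump_def by (auto intro!: prod_pos mult_pos_pos flat_bounds simp: mem_box)

lemma bump_zero: "k > 0 \<Longrightarrow> x \<notin> box a b \<Longrightarrow> bump k a b x = 0"
proof -
  assume k: "k > 0" and "x \<notin> box a b"
  then obtain i where i: "i \<in> Basis" "x \<bullet> i \<le> a \<bullet> i \<or> b \<bullet> i \<le> x \<bullet> i"
    by (auto simp: mem_box not_less)
  then have "flat 0 (k * (x \<bullet> i - a \<bullet> i)) * flat 0 (k * (b \<bullet> i - x \<bullet> i)) = 0"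
    using k by (auto simp: flat_bounds mult_nonneg_nonpos)
  with i(1) show ?thesis unfolding bump_def by (intro prod_zero) auto
qed

lemma bump_support: "k > 0 \<Longrightarrow> closure {x. bump k a b x \<noteq> 0} \<subseteq> cbox a b"
  using bump_zero[of k _ a b] box_subset_cbox[of a b]
  by (intro closure_minimal) auto

lemma bump_test: "k > 0 \<Longrightarrow> cbox a b \<subseteq> U \<Longrightarrow> bump k a b \<in> test_functions U"
  using bump_support[of k a b] compact_closure[of "{x. bump k a b x \<noteq> 0}"]
    bounded_subset[OF bounded_cbox[of a b] order_trans[OF closure_subset bump_support[of k a b]]]
  by (auto simp: test_functions_def C_k_bump)

lemma bump_limit:
  assumes "x \<in> box a b"
  shows "(\<lambda>n. bump (real (Suc n)) a b x) \<longlonglongrightarrow> 1"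
proof -
  have *: "(\<lambda>n. flat 0 (real (Suc n) * t)) \<longlonglongrightarrow> 1" if "t > 0" for t
  proof -
    have "(\<lambda>n. exp ((- 1 / t) * inverse (real (Suc n)))) \<longlonglongrightarrow> exp ((- 1 / t) * 0)"
      by (intro tendsto_intros LIMSEQ_inverse_real_of_nat)
    moreover have "exp ((- 1 / t) * inverse (real (Suc n))) = flat 0 (real (Suc n) * t)" for n
      using that by (simp add: flat_def field_simps add_pos_nonneg)
    ultimately show ?thesis by simp
  qed
  have "(\<lambda>n. bump (real (Suc n)) a b x) \<longlonglongrightarrow> (\<Prod>i\<in>(Basis::'a set). 1 * 1)"
    unfolding bump_def using assms by (intro tendsto_prod tendsto_mult *) (auto simp: mem_box)
  then show ?thesis by simp
qed

lemma test_functions_mono: "U \<subseteq> V \<Longrightarrow> test_functions U \<subseteq> test_functions V"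
  by (auto simp: test_functions_def)

lemma test_functions_mult:
  assumes "\<phi> \<in> test_functions U" "\<And>k. C_k k \<psi>"
  shows "(\<lambda>x. \<psi> x * \<phi> x) \<in> test_functions U"
proof -
  have "closure {x. \<psi> x * \<phi> x \<noteq> 0} \<subseteq> closure {x. \<phi> x \<noteq> 0}"
    by (intro closure_mono) auto
  with assms show ?thesis
    using bounded_subset by (auto simp: test_functions_def C_k_mult compact_eq_bounded_closed)
qed

lemma test_functions_add:
  assumes "\<phi> \<in> test_functions U" "\<psi> \<in> test_functions U"
  shows "(\<lambda>x. \<phi> x + \<psi> x) \<in> test_functions U"
proof -
  have "closure {x. \<phi> x + \<psi> x \<noteq> 0} \<subseteq> closure ({x. \<phi> x \<noteq> 0} \<union> {x. \<psi> x \<noteq> 0})"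
    by (intro closure_mono) auto
  then have *: "closure {x. \<phi> x + \<psi> x \<noteq> 0} \<subseteq> closure {x. \<phi> x \<noteq> 0} \<union> closure {x. \<psi> x \<noteq> 0}"
    by simp
  have "compact (closure {x. \<phi> x + \<psi> x \<noteq> 0})"
    using assms bounded_subset[OF _ *]
    by (auto simp: test_functions_def compact_eq_bounded_closed)
  with * assms show ?thesis
    by (auto simp: test_functions_def C_k_add)
qed

text \<open>Exhausting \<open>U\<close> by boxes \<open>B i\<close>, the sequence \<open>1 - (\<Prod>i<n. 1 - bump n (B i))\<close>
  increases to the indicator of \<open>U\<close>.\<close>

lemma test_functions_exhaust:
  fixes U :: "'a::euclidean_space set"
  assumes "open U"
  obtains \<phi> where "\<And>n. \<phi> n \<in> test_functions U" "\<And>n x. 0 \<le> \<phi> n x" "\<And>n x. \<phi> n x \<le> 1"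
    "\<And>x. x \<in> U \<Longrightarrow> (\<lambda>n. \<phi> n x) \<longlonglongrightarrow> 1"
proof -
  define \<F> where "\<F> = {box a b |a b. cbox a b \<subseteq> U}"
  obtain \<F>' where F': "\<F>' \<subseteq> \<F>" "countable \<F>'" "\<Union>\<F>' = \<Union>\<F>"
    by (rule Lindelof[of \<F>]) (auto simp: \<F>_def)
  have "U \<subseteq> \<Union>\<F>"
  proof
    fix x assume "x \<in> U"
    then obtain a b where "x \<in> box a b" "cbox a b \<subseteq> U"
      using open_contains_cbox[OF assms] by blast
    then show "x \<in> \<Union>\<F>" unfolding \<F>_def by blast
  qed
  with F' have U: "U \<subseteq> \<Union>\<F>'" by simp
  \<comment> \<open>\<open>from_nat_into\<close> enumerates a countable set only if it is nonempty,
    hence the added empty set, which is itself represented as the degenerate box from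
    \<open>One\<close> to \<open>0\<close>.\<close>
  define E where "E = from_nat_into (insert {} \<F>')"
  have range_E: "range E = insert {} \<F>'"
    unfolding E_def using F'(2) by (intro range_from_nat_into) auto
  have "\<exists>a b. E i = box a b \<and> cbox a b \<subseteq> U" for i
  proof -
    obtain j :: 'a where "j \<in> Basis" using nonempty_Basis by blast
    then have empty: "box One (0::'a) = {}" "cbox One (0::'a) = {}"
      by (auto simp: box_eq_empty)
    have "E i = {} \<or> E i \<in> \<F>" using range_E F'(1) by blast
    then show ?thesis
    proof
      assume "E i = {}"
      with empty show ?thesis by (metis empty_subsetI)
    qed (simp add: \<F>_def)
  qed
  then obtain a b where E: "\<And>i. E i = box (a i) (b i)" "\<And>i. cbox (a i) (b i) \<subseteq> U" by metis
  define B where "B n i x = bump (real (Suc n)) (a i) (b i) x" for n i x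
  define \<phi> where "\<phi> n x = 1 - (\<Prod>i<n. 1 - B n i x)" for n x
  have B01: "0 \<le> B n i x" "B n i x \<le> 1" for n i x
    by (simp_all add: B_def bump_bounds)
  have Bt: "B n i \<in> test_functions U" for n i
    unfolding B_def by (rule bump_test) (use E in auto)
  \<comment> \<open>The number \<open>m\<close> of factors is separated from the sharpness
    \<open>n\<close>, because the induction has to vary the former with the latter fixed.\<close>
  have test: "(\<lambda>x. 1 - (\<Prod>i<m. 1 - B n i x)) \<in> test_functions U" for m n
  proof (induction m)
    case 0
    show ?case by (simp add: test_functions_def C_k_const)
  next
    case (Suc m)
    \<comment> \<open>One more factor adds exactly the product of the first \<open>m\<close> factors
      times \<open>B n m\<close>, which inherits compact support in \<open>U\<close> from
      \<open>B n m\<close>. Subtraction is written with \<open>(-1)\<close> so that the rules for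
      sums and products apply.\<close>
    have "C_k k (\<lambda>x. \<Prod>i<m. 1 + (-1) * B n i x)" for k
      unfolding B_def by (intro C_k_prod C_k_add C_k_const C_k_mult C_k_bump)
    then have "(\<lambda>x. (\<Prod>i<m. 1 + (-1) * B n i x) * B n m x) \<in> test_functions U"
      using Bt by (intro test_functions_mult)
    from test_functions_add[OF Suc this] show ?case
      by (simp add: algebra_simps)
  qed
  show ?thesis
  proof
    show "\<phi> n \<in> test_functions U" for n
      unfolding \<phi>_def by (rule test)
    show "0 \<le> \<phi> n x" for n x
      using B01 by (simp add: \<phi>_def prod_le_1)
    show "\<phi> n x \<le> 1" for n x
      using B01 by (simp add: \<phi>_def prod_nonneg)
    fix x assume "x \<in> U"
    with U range_E obtain i where i: "x \<in> E i" by blast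
    have lim: "(\<lambda>n. B n i x) \<longlonglongrightarrow> 1"
      unfolding B_def using i E by (intro bump_limit) auto
    have le: "B n i x \<le> \<phi> n x" if "n > i" for n
    proof -
      have "(\<Prod>j<n. 1 - B n j x) = (1 - B n i x) * (\<Prod>j\<in>{..<n} - {i}. 1 - B n j x)"
        using that by (intro prod.remove) auto
      also have "\<dots> \<le> 1 - B n i x"
        using B01 by (intro mult_left_le prod_le_1) auto
      finally show ?thesis by (simp add: \<phi>_def)
    qed
    show "(\<lambda>n. \<phi> n x) \<longlonglongrightarrow> 1"
    proof (rule tendsto_sandwich[OF _ _ lim tendsto_const])
      show "\<forall>\<^sub>F n in sequentially. B n i x \<le> \<phi> n x"
        using eventually_gt_at_top[of i] by eventually_elim (rule le)
      show "\<forall>\<^sub>F n in sequentially. \<phi> n x \<le> 1"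
        using B01 by (simp add: \<phi>_def prod_nonneg)
    qed
  qed
qed

section \<open>Integration by parts for compactly supported functions\<close>

lemma integrable_compact_support:
  fixes u :: "'a::euclidean_space \<Rightarrow> real"
  assumes "continuous_on UNIV u" "\<And>x. x \<notin> C \<Longrightarrow> u x = 0" "compact C"
  shows "integrable lborel u"
proof -
  have "integrable lborel (\<lambda>x. indicator C x *\<^sub>R u x)"
    using assms by (intro borel_integrable_compact continuous_on_subset[OF assms(1)]) auto
  moreover have "(\<lambda>x. indicator C x *\<^sub>R u x) = u"
    using assms(2) by (intro ext) (metis indicator_simps scaleR_one scaleR_zero_left)
  ultimately show ?thesis by simp
qed

lemma bounded_compact_support:
  fixes u :: "'a::euclidean_space \<Rightarrow> real"
  assumes "continuous_on UNIV u" "\<And>x. x \<notin> C \<Longrightarrow> u x = 0" "compact C"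
  obtains M where "\<And>x. \<bar>u x\<bar> \<le> M"
proof -
  have "compact (u ` C)"
    by (intro compact_continuous_image continuous_on_subset[OF assms(1)] assms(3)) auto
  then obtain M where "M > 0" "\<And>x. x \<in> C \<Longrightarrow> \<bar>u x\<bar> \<le> M"
    using compact_imp_bounded bounded_pos by (metis imageI real_norm_def)
  with assms(2) have "\<bar>u x\<bar> \<le> M" for x by (cases "x \<in> C") auto
  then show thesis by (rule that)
qed

lemma has_derivative_off_support:
  fixes u :: "'a::real_normed_vector \<Rightarrow> 'b::real_normed_vector"
  assumes "\<And>x. x \<notin> C \<Longrightarrow> u x = 0" "closed C" "x \<notin> C"
  shows "(u has_derivative (\<lambda>h. 0)) (at x)"
  by (rule has_derivative_transform_within_open[where s = "- C" and f = "\<lambda>x. 0"])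
     (use assms in \<open>auto simp: open_Compl\<close>)

text \<open>The difference quotients \<open>(u (x + b / n) - u x) * n\<close> have vanishing integral
  by translation invariance and are dominated by a multiple of an indicator.\<close>

lemma integral_partial_deriv_eq_0:
  fixes u :: "'a::euclidean_space \<Rightarrow> real"
  assumes der: "\<And>x. (u has_derivative u' x) (at x)"
    and cont: "continuous_on UNIV (\<lambda>x. u' x b)"
    and supp: "\<And>x. x \<notin> C \<Longrightarrow> u x = 0" and C: "compact C"
  shows "(LINT x|lborel. u' x b) = 0"
proof -
  have uc: "continuous_on UNIV u"
    using has_derivative_continuous[OF der] by (simp add: continuous_on_eq_continuous_at)
  have u_int: "integrable lborel u"
    by (rule integrable_compact_support[OF uc supp C])
  obtain r where r: "r > 0" "C \<subseteq> cball 0 r"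
  proof -
    obtain r where "r > 0" "\<forall>x\<in>C. norm x \<le> r"
      using compact_imp_bounded[OF C] bounded_pos[of C] by blast
    then show ?thesis by (intro that[of r]) auto
  qed
  \<comment> \<open>The translates move by at most \<open>norm b\<close>, so all difference
    quotients vanish off this enlarged ball.\<close>
  define C' where "C' = cball (0::'a) (r + norm b)"
  have outside: "u' x b = 0" if "x \<notin> C" for x
    using has_derivative_unique[OF der has_derivative_off_support[OF supp compact_imp_closed[OF C] that]] by simp
  obtain M where M: "\<And>x. \<bar>u' x b\<bar> \<le> M"
    using bounded_compact_support[OF cont outside C] by blast
  have line: "((\<lambda>t. u (x + t *\<^sub>R b)) has_real_derivative u' (x + t *\<^sub>R b) b) (at t)" for x t
  proof -
    have "((\<lambda>t. x + t *\<^sub>R b) has_derivative (\<lambda>h. h *\<^sub>R b)) (at t)"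
      by (auto intro!: derivative_eq_intros)
    from has_derivative_compose[OF this der]
    have "((\<lambda>t. u (x + t *\<^sub>R b)) has_derivative (\<lambda>h. u' (x + t *\<^sub>R b) (h *\<^sub>R b))) (at t)" .
    moreover have "u' (x + t *\<^sub>R b) (h *\<^sub>R b) = u' (x + t *\<^sub>R b) b * h" for h
      using has_derivative_linear[OF der] by (simp add: linear_cmul)
    ultimately show ?thesis by (simp add: has_field_derivative_def mult_commute_abs)
  qed
  define s where "s n x = (u (x + inverse (real (Suc n)) *\<^sub>R b) - u x) * real (Suc n)" for n x
  have s_int: "(LINT x|lborel. s n x) = 0" for n
  proof -
    let ?v = "inverse (real (Suc n)) *\<^sub>R b"
    have um: "u \<in> borel_measurable borel"
      using uc by (rule borel_measurable_continuous_onI)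
    have "integrable (distr lborel borel ((+) ?v)) u"
      unfolding lborel_distr_plus by (rule u_int)
    then have "integrable lborel (\<lambda>x. u (?v + x))"
      using um by (subst (asm) integrable_distr_eq) auto
    moreover have "(LINT x|distr lborel borel ((+) ?v). u x) = (LINT x|lborel. u (?v + x))"
      using um by (intro integral_distr) auto
    then have "(LINT x|lborel. u (?v + x)) = (LINT x|lborel. u x)"
      unfolding lborel_distr_plus by simp
    ultimately show ?thesis
      using u_int by (simp add: s_def add.commute)
  qed
  have "(\<lambda>n. LINT x|lborel. s n x) \<longlonglongrightarrow> (LINT x|lborel. u' x b)"
  proof (rule integral_dominated_convergence[where w = "\<lambda>x. M * indicator C' x"])
    show "(\<lambda>x. u' x b) \<in> borel_measurable lborel"
      using cont by (simp add: borel_measurable_continuous_onI)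
    show "s n \<in> borel_measurable lborel" for n
    proof -
      have [measurable]: "u \<in> borel_measurable borel"
        using uc by (rule borel_measurable_continuous_onI)
      show ?thesis unfolding s_def by measurable
    qed
    show "integrable lborel (\<lambda>x. M * indicator C' x)"
      unfolding C'_def by (intro integrable_mult_right integrable_real_indicator)
        (auto simp: top.not_eq_extremum[symmetric] dest: arg_cong[of _ _ "\<lambda>x. x < \<infinity>"] intro!: emeasure_bounded_finite)
    show "AE x in lborel. (\<lambda>n. s n x) \<longlonglongrightarrow> u' x b"
    proof (rule AE_I2)
      fix x
      have "((\<lambda>h. (u (x + h *\<^sub>R b) - u x) / h) \<longlongrightarrow> u' x b) (at 0)"
        using line[of x 0] by (simp add: DERIV_def)
      moreover have "filterlim (\<lambda>n. inverse (real (Suc n))) (at 0) sequentially"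
        unfolding filterlim_at using LIMSEQ_inverse_real_of_nat by (simp add: eventually_sequentially del: of_nat_Suc)
      ultimately have "(\<lambda>n. (u (x + inverse (real (Suc n)) *\<^sub>R b) - u x) / inverse (real (Suc n)))
          \<longlonglongrightarrow> u' x b"
        by (rule filterlim_compose)
      then show "(\<lambda>n. s n x) \<longlonglongrightarrow> u' x b"
        by (simp only: s_def divide_inverse inverse_inverse_eq)
    qed
    show "AE x in lborel. norm (s n x) \<le> M * indicator C' x" for n
    proof (rule AE_I2)
      fix x
      define t where "t = inverse (real (Suc n))"
      have t: "0 < t" "t \<le> 1" by (auto simp: t_def field_simps)
      have s: "s n x = (u (x + t *\<^sub>R b) - u x) / t"
        by (simp only: s_def t_def divide_inverse inverse_inverse_eq)
      \<comment> \<open>The mean value theorem along the direction \<open>b\<close> turns the bound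
        \<open>M\<close> of the derivative into a bound of the difference quotient that does not
        depend on \<open>n\<close>.\<close>
      obtain z where z: "u (x + t *\<^sub>R b) - u (x + 0 *\<^sub>R b) = (t - 0) * u' (x + z *\<^sub>R b) b"
        using MVT2[OF t(1), of "\<lambda>t. u (x + t *\<^sub>R b)" "\<lambda>t. u' (x + t *\<^sub>R b) b"] line by blast
      have le: "\<bar>s n x\<bar> \<le> M"
        using z M[of "x + z *\<^sub>R b"] t by (simp add: s)
      show "norm (s n x) \<le> M * indicator C' x"
      proof (cases "x \<in> C'")
        case True
        with le show ?thesis by simp
      next
        case False
        then have x: "norm x > r + norm b" by (simp add: C'_def)
        have "norm (t *\<^sub>R b) \<le> norm b"
          using t mult_right_mono[of t 1 "norm b"] by simp
        then have "norm x \<le> norm (x + t *\<^sub>R b) + norm b"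
          using norm_triangle_sub[of x "x + t *\<^sub>R b"] by simp
        with x have "norm x > r" "norm (x + t *\<^sub>R b) > r"
          using norm_ge_zero[of b] by linarith+
        with r(2) have "x \<notin> C" "x + t *\<^sub>R b \<notin> C"
          by (meson mem_cball_0 not_less subsetD)+
        with supp have "s n x = 0" by (simp add: s)
        with False show ?thesis by simp
      qed
    qed
  qed
  then show ?thesis
    by (simp only: s_int LIMSEQ_const_iff)
qed

text \<open>The product of \<open>f\<close> and \<open>\<phi>\<close> is differentiable on the whole
  space, even where \<open>f\<close> is not, because \<open>\<phi>\<close> vanishes off a compact
  subset of \<open>U\<close>. Its derivative therefore integrates to zero, and the product rule
  splits that integral.\<close>

lemma integral_by_parts_test:
  fixes f :: "'a::euclidean_space \<Rightarrow> real"
  assumes U: "open U" and fc: "continuous_on UNIV f"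
    and der: "\<And>x. x \<in> U \<Longrightarrow> (f has_derivative f' x) (at x)"
    and cont: "continuous_on U (\<lambda>x. f' x b)" and b: "b \<in> Basis"
    and \<phi>: "\<phi> \<in> test_functions U"
  shows "integrable lborel (\<lambda>x. f x * partial_deriv b \<phi> x)"
    "integrable lborel (\<lambda>x. (if x \<in> U then f' x b else 0) * \<phi> x)"
    "(LINT x|lborel. f x * partial_deriv b \<phi> x) = - (LINT x|lborel. (if x \<in> U then f' x b else 0) * \<phi> x)"
proof -
  obtain C where C: "compact C" "C \<subseteq> U" and \<phi>0: "\<And>x. x \<notin> C \<Longrightarrow> \<phi> x = 0"
  proof
    show "compact (closure {x. \<phi> x \<noteq> 0})" "closure {x. \<phi> x \<noteq> 0} \<subseteq> U"
      using \<phi> by (auto simp: test_functions_def)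
    show "\<phi> x = 0" if "x \<notin> closure {x. \<phi> x \<noteq> 0}" for x
      using that closure_subset[of "{x. \<phi> x \<noteq> 0}"] by (metis (mono_tags, lifting) mem_Collect_eq subsetD)
  qed
  note closedC = compact_imp_closed[OF C(1)]
  have ck: "C_k k \<phi>" for k
    using \<phi> by (auto simp: test_functions_def)
  have \<phi>d: "(\<phi> has_derivative frechet_derivative \<phi> (at x)) (at x)" for x
    using ck[of "Suc 0"] by (auto simp: frechet_derivative_works)
  have \<phi>c: "continuous_on UNIV \<phi>" "continuous_on UNIV (partial_deriv b \<phi>)"
    using ck[of 0] ck[of "Suc 0"] b by auto
  have zero_nhd: "(\<phi> has_derivative (\<lambda>h. 0)) (at x)" if "x \<notin> C" for x
    by (rule has_derivative_off_support[OF \<phi>0 closedC that])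
  have p0: "partial_deriv b \<phi> x = 0" if "x \<notin> C" for x
    using partial_deriv_eqI[OF zero_nhd[OF that]] .
  let ?g = "\<lambda>x. (if x \<in> U then f' x b else 0) * \<phi> x"
  have gc: "continuous_on UNIV ?g"
  proof -
    have "continuous_on (U \<union> - C) ?g"
    proof (rule continuous_on_open_Un)
      show "continuous_on U ?g"
        using continuous_on_mult[OF cont continuous_on_subset[OF \<phi>c(1)]]
        by (rule continuous_on_eq) auto
      show "continuous_on (- C) ?g"
        by (rule continuous_on_eq[OF continuous_on_const[of _ 0]]) (use \<phi>0 in auto)
    qed (use U closedC in auto)
    moreover have "U \<union> - C = UNIV" using C by auto
    ultimately show ?thesis by simp
  qed
  have hc: "continuous_on UNIV (\<lambda>x. f x * partial_deriv b \<phi> x)"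
    by (intro continuous_intros fc \<phi>c)
  show i1: "integrable lborel (\<lambda>x. f x * partial_deriv b \<phi> x)"
    by (rule integrable_compact_support[OF hc _ C(1)]) (simp add: p0)
  show i2: "integrable lborel ?g"
    by (rule integrable_compact_support[OF gc _ C(1)]) (simp add: \<phi>0)
  define u' where "u' x h = f x * frechet_derivative \<phi> (at x) h + (if x \<in> U then f' x h else 0) * \<phi> x" for x h
  have "((\<lambda>x. f x * \<phi> x) has_derivative u' x) (at x)" for x
  proof (cases "x \<in> U")
    case True
    then show ?thesis
      unfolding u'_def by (auto intro!: has_derivative_mult[OF der \<phi>d])
  next
    case False
    with C have x: "x \<notin> C" by auto
    have "((\<lambda>x. f x * \<phi> x) has_derivative (\<lambda>h. 0)) (at x)"
      by (rule has_derivative_off_support[OF _ closedC x]) (simp add: \<phi>0)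
    moreover have "u' x = (\<lambda>h. 0)"
      using False has_derivative_unique[OF \<phi>d zero_nhd[OF x]] by (auto simp: u'_def)
    ultimately show ?thesis by simp
  qed
  moreover have u'b: "(\<lambda>x. u' x b) = (\<lambda>x. f x * partial_deriv b \<phi> x + ?g x)"
    by (simp add: u'_def partial_deriv_def)
  have "continuous_on UNIV (\<lambda>x. u' x b)"
    unfolding u'b by (intro continuous_on_add hc gc)
  moreover have "f x * \<phi> x = 0" if "x \<notin> C" for x
    using \<phi>0[OF that] by simp
  ultimately have "(LINT x|lborel. u' x b) = 0"
    using C(1) by (rule integral_partial_deriv_eq_0)
  moreover have "(LINT x|lborel. u' x b) = (LINT x|lborel. f x * partial_deriv b \<phi> x) + (LINT x|lborel. ?g x)"
    unfolding u'b using i1 i2 by (rule Bochner_Integration.integral_add)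
  ultimately show "(LINT x|lborel. f x * partial_deriv b \<phi> x) = - (LINT x|lborel. ?g x)" by simp
qed

section \<open>Weak derivatives across a null set\<close>

lemma integrable_lborel_restrict:
  fixes h :: "'a::euclidean_space \<Rightarrow> real"
  assumes "integrable lborel h" "V \<in> sets borel"
  shows "integrable (lebesgue_on V) h"
proof -
  have "integrable lebesgue h"
    using assms(1) by (intro integrable_completion[THEN iffD2]) auto
  then have "integrable lebesgue (\<lambda>x. indicator V x *\<^sub>R h x)"
    using assms(2) by (intro integrable_mult_indicator) auto
  then show ?thesis
    using assms(2) by (subst integrable_restrict_space) auto
qed

text \<open>Passage from \<open>lebesgue_on\<close>, used in the definitions, to
  \<open>lborel\<close>, used in the computations: a Borel integrand has the same integral over the
  completion, and removing a null set changes nothing.\<close>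

lemma integral_lebesgue_on_co_null:
  fixes h :: "'a::euclidean_space \<Rightarrow> real"
  assumes "N \<in> null_sets lborel" "h \<in> borel_measurable borel"
  shows "(LINT x|lebesgue_on (UNIV - N). h x) = (LINT x|lborel. h x)"
proof -
  have N: "N \<in> sets borel" using assms(1) by auto
  have "(LINT x|lebesgue_on (UNIV - N). h x) = (LINT x|lebesgue. indicator (UNIV - N) x *\<^sub>R h x)"
    using N by (subst integral_restrict_space) auto
  also have "\<dots> = (LINT x|lborel. indicator (UNIV - N) x *\<^sub>R h x)"
    using N assms(2) by (intro integral_completion) auto
  also have "\<dots> = (LINT x|lborel. h x)"
  proof (rule integral_cong_AE)
    show "AE x in lborel. indicator (UNIV - N) x *\<^sub>R h x = h x"
      using AE_not_in[OF assms(1)] by eventually_elim simp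
  qed (use N assms(2) in auto)
  finally show ?thesis .
qed

text \<open>Test functions supported off \<open>N\<close> determine the weak derivative almost everywhere, and
  products of an arbitrary test function with an exhausting sequence recover its integral.\<close>

lemma weak_partial_deriv_co_null:
  fixes f :: "'a::euclidean_space \<Rightarrow> real"
  assumes w: "weak_partial_deriv UNIV b f h" and b: "b \<in> Basis"
    and N: "N \<in> null_sets lborel" "open (UNIV - N)"
    and fc: "continuous_on UNIV f"
    and der: "\<And>x. x \<in> UNIV - N \<Longrightarrow> (f has_derivative f' x) (at x)"
    and cont: "continuous_on (UNIV - N) (\<lambda>x. f' x b)"
    and g_int: "integrable lborel (\<lambda>x. if x \<in> UNIV - N then f' x b else 0)"
    and \<psi>: "\<psi> \<in> test_functions UNIV"
  shows "(LINT x|lborel. f x * partial_deriv b \<psi> x) =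
    - (LINT x|lborel. (if x \<in> UNIV - N then f' x b else 0) * \<psi> x)"
proof -
  let ?g = "\<lambda>x. if x \<in> UNIV - N then f' x b else 0"
  obtain \<phi> where \<phi>: "\<And>n. \<phi> n \<in> test_functions (UNIV - N)" "\<And>n x. 0 \<le> \<phi> n x" "\<And>n x. \<phi> n x \<le> 1"
    "\<And>x. x \<in> UNIV - N \<Longrightarrow> (\<lambda>n. \<phi> n x) \<longlonglongrightarrow> 1"
    using test_functions_exhaust[OF N(2)] by blast
  have ck: "C_k k \<psi>" for k using \<psi> by (simp add: test_functions_def)
  have ck\<phi>: "C_k k (\<phi> n)" for k n using \<phi>(1) by (simp add: test_functions_def)
  have c\<psi>: "continuous_on UNIV \<psi>" and c\<phi>: "continuous_on UNIV (\<phi> n)"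
    and c\<psi>': "continuous_on UNIV (partial_deriv b \<psi>)" for n
    using ck[of 0] ck\<phi>[of 0] ck[of 1] b by auto
  have meas [measurable]: "\<psi> \<in> borel_measurable borel" "\<phi> n \<in> borel_measurable borel"
    "f \<in> borel_measurable borel" "partial_deriv b \<psi> \<in> borel_measurable borel" "?g \<in> borel_measurable borel" for n
    using c\<psi> c\<phi> c\<psi>' fc borel_measurable_integrable[OF g_int] by (auto intro: borel_measurable_continuous_onI)
  define C where "C = closure {x. \<psi> x \<noteq> 0}"
  have C: "compact C" using \<psi> by (simp add: test_functions_def C_def)
  have \<psi>0: "\<psi> x = 0" if "x \<notin> C" for x
    using that closure_subset[of "{x. \<psi> x \<noteq> 0}"] unfolding C_def by (metis (mono_tags, lifting) mem_Collect_eq subsetD)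
  obtain B where B: "\<And>x. \<bar>\<psi> x\<bar> \<le> B"
    using bounded_compact_support[OF c\<psi> \<psi>0 C] by blast
  have Cs: "C \<in> sets lebesgue" using fmeasurableD[OF lmeasurable_compact[OF C]] .
  have "integrable (lebesgue_on C) h"
    using w C by (simp add: weak_partial_deriv_def locally_integrable_def)
  then have hC: "integrable lebesgue (\<lambda>x. indicator C x *\<^sub>R h x)"
    using Cs by (subst (asm) integrable_restrict_space) auto
  \<comment> \<open>The competitor \<open>h\<close> is only locally integrable; the compact support
    \<open>C\<close> of \<open>\<psi>\<close> makes the product integrable and provides the
    dominating function.\<close>
  have h\<psi>: "integrable lebesgue (\<lambda>x. h x * \<psi> x)"
  proof (rule Bochner_Integration.integrable_bound[OF integrable_mult_right[OF hC, of B]])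
    have "(\<lambda>x. h x * \<psi> x) = (\<lambda>x. (indicator C x *\<^sub>R h x) * \<psi> x)"
      using \<psi>0 by (auto simp: indicator_def fun_eq_iff)
    also have "\<dots> \<in> borel_measurable lebesgue"
      using borel_measurable_integrable[OF hC] meas(1) by (intro borel_measurable_times) (auto intro: measurable_completion)
    finally show "(\<lambda>x. h x * \<psi> x) \<in> borel_measurable lebesgue" .
    show "AE x in lebesgue. norm (h x * \<psi> x) \<le> norm (B * (indicator C x *\<^sub>R h x))"
    proof (rule AE_I2)
      fix x
      show "norm (h x * \<psi> x) \<le> norm (B * (indicator C x *\<^sub>R h x))"
        using B[of x] \<psi>0[of x] by (cases "x \<in> C") (auto simp: abs_mult mult.commute intro: mult_right_mono)
    qed
  qed
  have g\<psi>: "integrable lborel (\<lambda>x. ?g x * \<psi> x)"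
  proof (rule Bochner_Integration.integrable_bound[OF integrable_mult_right[OF g_int, of B]])
    show "AE x in lborel. norm (?g x * \<psi> x) \<le> norm (B * ?g x)"
    proof (rule AE_I2)
      fix x
      have "\<bar>\<psi> x\<bar> * \<bar>?g x\<bar> \<le> \<bar>B\<bar> * \<bar>?g x\<bar>"
        using B[of x] by (intro mult_right_mono) auto
      then show "norm (?g x * \<psi> x) \<le> norm (B * ?g x)"
        by (simp only: real_norm_def abs_mult mult.commute)
    qed
  qed measurable
  have aeN: "AE x in lborel. x \<notin> N" by (rule AE_not_in[OF N(1)])
  then have aeN': "AE x in lebesgue. x \<notin> N" by (rule AE_completion)
  \<comment> \<open>The product \<open>\<psi> x * \<phi> n x\<close> is a test function both for the
    whole space and for the complement of \<open>N\<close>. The first gives the left side through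
    \<open>h\<close>, the second gives the right side through the classical derivative.\<close>
  have eq: "(LINT x|lebesgue. h x * (\<psi> x * \<phi> n x)) = (LINT x|lborel. ?g x * (\<psi> x * \<phi> n x))" for n
  proof -
    have t: "(\<lambda>x. \<psi> x * \<phi> n x) \<in> test_functions (UNIV - N)"
      using test_functions_mult[OF \<phi>(1) ck] .
    then have t': "(\<lambda>x. \<psi> x * \<phi> n x) \<in> test_functions UNIV" using test_functions_mono by blast
    have "C_k 0 (partial_deriv b (\<lambda>x. \<psi> x * \<phi> n x))"
      using t b unfolding test_functions_def by (metis (mono_tags, lifting) C_k.simps(2) mem_Collect_eq)
    then have m: "partial_deriv b (\<lambda>x. \<psi> x * \<phi> n x) \<in> borel_measurable borel"
      by (auto intro: borel_measurable_continuous_onI)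
    have "- (LINT x|lebesgue. h x * (\<psi> x * \<phi> n x)) = (LINT x|lebesgue. f x * partial_deriv b (\<lambda>x. \<psi> x * \<phi> n x) x)"
      using w t' by (simp add: weak_partial_deriv_def lebesgue_on_UNIV_eq)
    also have "\<dots> = (LINT x|lborel. f x * partial_deriv b (\<lambda>x. \<psi> x * \<phi> n x) x)"
      using m by (intro integral_completion) auto
    also have "\<dots> = - (LINT x|lborel. ?g x * (\<psi> x * \<phi> n x))"
      by (rule integral_by_parts_test(3)[OF N(2) fc der cont b t])
    finally show ?thesis by simp
  qed
  have L1: "(\<lambda>n. LINT x|lebesgue. h x * (\<psi> x * \<phi> n x)) \<longlonglongrightarrow> (LINT x|lebesgue. h x * \<psi> x)"
  proof (rule integral_dominated_convergence[where w = "\<lambda>x. \<bar>h x * \<psi> x\<bar>"])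
    show "(\<lambda>x. h x * (\<psi> x * \<phi> n x)) \<in> borel_measurable lebesgue" for n
      using borel_measurable_times[OF borel_measurable_integrable[OF h\<psi>] measurable_completion[of "\<phi> n" lborel borel]] meas(2)
      by (simp add: mult.assoc)
    show "AE x in lebesgue. (\<lambda>n. h x * (\<psi> x * \<phi> n x)) \<longlonglongrightarrow> h x * \<psi> x"
      using aeN'
    proof eventually_elim
      case (elim x)
      then have "(\<lambda>n. h x * (\<psi> x * \<phi> n x)) \<longlonglongrightarrow> h x * (\<psi> x * 1)" by (intro tendsto_intros \<phi>(4)) auto
      then show ?case by simp
    qed
    show "AE x in lebesgue. norm (h x * (\<psi> x * \<phi> n x)) \<le> \<bar>h x * \<psi> x\<bar>" for n
      using \<phi>(2,3) by (intro AE_I2) (auto simp: abs_mult mult.assoc[symmetric] intro!: mult_left_le)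
  qed (use h\<psi> in auto)
  have L2: "(\<lambda>n. LINT x|lborel. ?g x * (\<psi> x * \<phi> n x)) \<longlonglongrightarrow> (LINT x|lborel. ?g x * \<psi> x)"
  proof (rule integral_dominated_convergence[where w = "\<lambda>x. \<bar>?g x * \<psi> x\<bar>"])
    show "AE x in lborel. (\<lambda>n. ?g x * (\<psi> x * \<phi> n x)) \<longlonglongrightarrow> ?g x * \<psi> x"
      using aeN
    proof eventually_elim
      case (elim x)
      then have "(\<lambda>n. ?g x * (\<psi> x * \<phi> n x)) \<longlonglongrightarrow> ?g x * (\<psi> x * 1)" by (intro tendsto_intros \<phi>(4)) auto
      then show ?case by simp
    qed
    show "AE x in lborel. norm (?g x * (\<psi> x * \<phi> n x)) \<le> \<bar>?g x * \<psi> x\<bar>" for n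
      using \<phi>(2,3) by (intro AE_I2) (auto simp: abs_mult mult.assoc[symmetric] intro!: mult_left_le)
    show "(\<lambda>x. ?g x * (\<psi> x * \<phi> n x)) \<in> borel_measurable lborel" for n by measurable
    show "(\<lambda>x. ?g x * \<psi> x) \<in> borel_measurable lborel" by measurable
  qed (use g\<psi> in auto)
  have "(LINT x|lborel. f x * partial_deriv b \<psi> x) = (LINT x|lebesgue. f x * partial_deriv b \<psi> x)"
    by (rule integral_completion[symmetric]) measurable
  also have "\<dots> = - (LINT x|lebesgue. h x * \<psi> x)"
    using w \<psi> by (simp add: weak_partial_deriv_def lebesgue_on_UNIV_eq)
  also have "(LINT x|lebesgue. h x * \<psi> x) = (LINT x|lborel. ?g x * \<psi> x)"
    using L1 L2 unfolding eq by (rule LIMSEQ_unique)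
  finally show ?thesis .
qed

text \<open>Testing against the dilations \<open>x \<mapsto> B (x / n)\<close> of a bump function.\<close>

lemma integral_weak_deriv_eq_0:
  fixes f g :: "'a::euclidean_space \<Rightarrow> real"
  assumes b: "b \<in> Basis" and f: "integrable lborel f" and g: "integrable lborel g"
    and eq: "\<And>\<psi>. \<psi> \<in> test_functions UNIV \<Longrightarrow>
      (LINT x|lborel. f x * partial_deriv b \<psi> x) = - (LINT x|lborel. g x * \<psi> x)"
  shows "(LINT x|lborel. g x) = 0"
proof -
  define B :: "'a \<Rightarrow> real" where "B = bump 1 (- One) One"
  have Bt: "B \<in> test_functions UNIV" unfolding B_def by (rule bump_test) auto
  have ck: "C_k k B" for k using Bt by (simp add: test_functions_def)
  have cB: "continuous_on UNIV B" "continuous_on UNIV (partial_deriv b B)"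
    using ck[of 0] ck[of 1] b by auto
  have B0: "B 0 > 0" unfolding B_def by (rule bump_pos) (auto simp: mem_box)
  have dB: "(B has_derivative frechet_derivative B (at x)) (at x)" for x
    using ck[of 1] by (auto simp: frechet_derivative_works)
  define C where "C = cbox (- One) (One :: 'a)"
  have C: "compact C" by (simp add: C_def)
  have BC: "B x = 0" if "x \<notin> C" for x
    using that bump_zero[of 1 x "- One" One] box_subset_cbox[of "- One" "One :: 'a"] by (auto simp: C_def B_def)
  have p0: "partial_deriv b B x = 0" if "x \<notin> C" for x
    using partial_deriv_eqI[OF has_derivative_off_support[OF BC compact_imp_closed[OF C] that]] .
  obtain L where L: "\<And>x. \<bar>partial_deriv b B x\<bar> \<le> L"
    using bounded_compact_support[OF cB(2) p0 C] by blast
  define \<psi> where "\<psi> n x = B (inverse (real (Suc n)) *\<^sub>R x)" for n x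
  have \<psi>: "\<psi> n \<in> test_functions UNIV" for n
  proof -
    have "\<psi> n = bump (inverse (real (Suc n))) (- real (Suc n) *\<^sub>R One) (real (Suc n) *\<^sub>R One)"
      by (auto simp: \<psi>_def B_def bump_def fun_eq_iff right_diff_distrib distrib_left simp del: of_nat_Suc intro!: prod.cong)
    then show ?thesis by (simp add: bump_test del: of_nat_Suc)
  qed
  have d\<psi>: "partial_deriv b (\<psi> n) x = inverse (real (Suc n)) * partial_deriv b B (inverse (real (Suc n)) *\<^sub>R x)" for n x
  proof -
    have "((\<lambda>x. inverse (real (Suc n)) *\<^sub>R x) has_derivative (\<lambda>h. inverse (real (Suc n)) *\<^sub>R h)) (at x)"
      by (auto intro!: derivative_eq_intros simp del: of_nat_Suc)
    from has_derivative_compose[OF this dB]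
    have "(\<psi> n has_derivative (\<lambda>h. frechet_derivative B (at (inverse (real (Suc n)) *\<^sub>R x)) (inverse (real (Suc n)) *\<^sub>R h))) (at x)"
      by (simp add: \<psi>_def[abs_def])
    then show ?thesis
      using linear_cmul[OF has_derivative_linear[OF dB]]
      by (simp add: partial_deriv_eqI partial_deriv_def[of b B] del: of_nat_Suc)
  qed
  have inv: "(\<lambda>n. inverse (real (Suc n))) \<longlonglongrightarrow> 0" by (rule LIMSEQ_inverse_real_of_nat)
  have inv1: "inverse (real (Suc n)) \<le> 1" "0 \<le> inverse (real (Suc n))" for n by (auto simp: field_simps)
  have [measurable]: "B \<in> borel_measurable borel" "partial_deriv b B \<in> borel_measurable borel"
    "f \<in> borel_measurable borel" "g \<in> borel_measurable borel"
    using cB borel_measurable_integrable[OF f] borel_measurable_integrable[OF g]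
    by (auto intro: borel_measurable_continuous_onI)
  \<comment> \<open>Each dilation contributes a factor \<open>1 / (n + 1)\<close> to the derivative,
    so integrability of \<open>f\<close> makes this side vanish in the limit.\<close>
  have "(\<lambda>n. LINT x|lborel. f x * partial_deriv b (\<psi> n) x) \<longlonglongrightarrow> (LINT x|lborel. (0 :: real) * f x)"
  proof (rule integral_dominated_convergence[where w = "\<lambda>x. L * \<bar>f x\<bar>"])
    show "AE x in lborel. (\<lambda>n. f x * partial_deriv b (\<psi> n) x) \<longlonglongrightarrow> 0 * f x"
    proof (rule AE_I2)
      fix x
      have A: "(\<lambda>n. inverse (real (Suc n)) * (\<bar>f x\<bar> * L)) \<longlonglongrightarrow> 0"
        by (rule tendsto_mult_left_zero[OF inv])
      have bound: "norm (f x * partial_deriv b (\<psi> n) x) \<le> inverse (real (Suc n)) * (\<bar>f x\<bar> * L)" for n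
      proof -
        define t where "t = inverse (real (Suc n))"
        have t: "0 \<le> t" by (simp add: t_def)
        then have "\<bar>f x\<bar> * t * \<bar>partial_deriv b B (t *\<^sub>R x)\<bar> \<le> \<bar>f x\<bar> * t * L"
          by (intro mult_left_mono L) auto
        with t show ?thesis
          unfolding d\<psi> t_def[symmetric] by (simp add: abs_mult ac_simps)
      qed
      have "(\<lambda>n. f x * partial_deriv b (\<psi> n) x) \<longlonglongrightarrow> 0"
        by (rule Lim_null_comparison[OF always_eventually A]) (rule allI, rule bound)
      then show "(\<lambda>n. f x * partial_deriv b (\<psi> n) x) \<longlonglongrightarrow> 0 * f x" by simp
    qed
    show "AE x in lborel. norm (f x * partial_deriv b (\<psi> n) x) \<le> L * \<bar>f x\<bar>" for n
    proof (rule AE_I2)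
      fix x
      define t where "t = inverse (real (Suc n))"
      have t: "0 \<le> t" "t \<le> 1" using inv1[of n] by (simp_all only: t_def)
      then have "t * \<bar>partial_deriv b B (t *\<^sub>R x)\<bar> \<le> 1 * L"
        by (intro mult_mono L) auto
      from mult_left_mono[OF this abs_ge_zero[of "f x"]] t
      show "norm (f x * partial_deriv b (\<psi> n) x) \<le> L * \<bar>f x\<bar>"
        unfolding d\<psi> t_def[symmetric] by (simp add: abs_mult ac_simps)
    qed
    show "(\<lambda>x. f x * partial_deriv b (\<psi> n) x) \<in> borel_measurable lborel" for n
      unfolding d\<psi> by measurable
  qed (use f in auto)
  then have "(\<lambda>n. - (LINT x|lborel. g x * \<psi> n x)) \<longlonglongrightarrow> 0"
    unfolding eq[OF \<psi>] by simp
  from tendsto_minus[OF this] have "(\<lambda>n. LINT x|lborel. g x * \<psi> n x) \<longlonglongrightarrow> 0"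
    by simp
  \<comment> \<open>Pointwise \<open>\<psi> n\<close> flattens out to the constant
    \<open>B 0\<close>, which is positive and can be divided out.\<close>
  moreover have "(\<lambda>n. LINT x|lborel. g x * \<psi> n x) \<longlonglongrightarrow> (LINT x|lborel. g x * B 0)"
  proof (rule integral_dominated_convergence[where w = "\<lambda>x. \<bar>g x\<bar>"])
    show "AE x in lborel. (\<lambda>n. g x * \<psi> n x) \<longlonglongrightarrow> g x * B 0"
    proof (rule AE_I2)
      fix x :: 'a
      have "(\<lambda>n. inverse (real (Suc n)) *\<^sub>R x) \<longlonglongrightarrow> 0 *\<^sub>R x"
        by (rule tendsto_scaleR[OF inv tendsto_const])
      then have "(\<lambda>n. \<psi> n x) \<longlonglongrightarrow> B 0"
        unfolding \<psi>_def using continuous_on_tendsto_compose[OF cB(1), of _ 0] by simp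
      then show "(\<lambda>n. g x * \<psi> n x) \<longlonglongrightarrow> g x * B 0" by (intro tendsto_intros)
    qed
    show "AE x in lborel. norm (g x * \<psi> n x) \<le> \<bar>g x\<bar>" for n
      by (intro AE_I2) (auto simp: abs_mult \<psi>_def B_def bump_bounds intro!: mult_left_le)
    show "(\<lambda>x. g x * \<psi> n x) \<in> borel_measurable lborel" for n
      unfolding \<psi>_def by measurable
  qed (use g in auto)
  ultimately have "(LINT x|lborel. g x * B 0) = 0" by (rule LIMSEQ_unique[symmetric])
  with B0 show ?thesis by simp
qed

section \<open>Cells of the gasket\<close>

definition dir :: "nat \<Rightarrow> real \<times> real" where
  "dir i = (if i = 1 then (1, 0) else if i = 2 then (1 / 2, sqrt 3 / 2) else (0, 0))"

text \<open>\<open>bary s j (x - a)\<close> are the barycentric coordinates of \<open>x\<close>, scaled to have sum \<open>s\<close>, with respect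
  to the upright triangle with lower left vertex \<open>a\<close> and side \<open>s\<close>.\<close>

definition bary :: "real \<Rightarrow> nat \<Rightarrow> real \<times> real \<Rightarrow> real" where
  "bary s i z = (if i = 1 then fst z - snd z / sqrt 3 else if i = 2 then 2 * snd z / sqrt 3
     else s - fst z - snd z / sqrt 3)"

definition sz :: "nat \<Rightarrow> real" where
  "sz n = 1 / 2 ^ n"

definition child :: "nat \<Rightarrow> nat \<Rightarrow> real \<times> real \<Rightarrow> real \<times> real" where
  "child n i a = a + (sz n / 2) *\<^sub>R dir i"

text \<open>A cell is addressed by its level and its lower left vertex instead of a word of
  directions.\<close>

primrec base :: "nat \<Rightarrow> (real \<times> real) set" where
  "base 0 = {0}"
| "base (Suc n) = (\<Union>a\<in>base n. (\<lambda>i. child n i a) ` {..<3})"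

definition cell :: "nat \<Rightarrow> real \<times> real \<Rightarrow> (real \<times> real) set" where
  "cell n a = {x. \<forall>j<3. 0 \<le> bary (sz n) j (x - a)}"

text \<open>This is the closed inverted middle triangle. Since the coordinates sum to
  \<open>sz n\<close>, the three upper bounds already force them to be nonnegative.\<close>

definition tri :: "nat \<Rightarrow> real \<times> real \<Rightarrow> (real \<times> real) set" where
  "tri n a = {x. \<forall>j<3. bary (sz n) j (x - a) \<le> sz n / 2}"

definition otri :: "nat \<Rightarrow> real \<times> real \<Rightarrow> (real \<times> real) set" where
  "otri n a = {x. \<forall>j<3. bary (sz n) j (x - a) < sz n / 2}"

definition bdry :: "nat \<Rightarrow> real \<times> real \<Rightarrow> (real \<times> real) set" where
  "bdry n a = {x \<in> cell n a. \<exists>j<3. bary (sz n) j (x - a) = 0}"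

text \<open>The index names the opposite vertex: the point is the midpoint of the edge on which
  coordinate \<open>k\<close> vanishes. Subtracting \<open>dir k\<close> from the full sum avoids
  naming the other two indices.\<close>

definition mid :: "nat \<Rightarrow> real \<times> real \<Rightarrow> nat \<Rightarrow> real \<times> real" where
  "mid n a k = a + (sz n / 2) *\<^sub>R (dir 0 + dir 1 + dir 2 - dir k)"

text \<open>Boundaries are included throughout, the one of the large triangle at level 0 and those
  of the removed triangles later. All these sets are then closed, and continuity can be glued over
  finitely many closed pieces.\<close>

primrec stable :: "nat \<Rightarrow> (real \<times> real) set" where
  "stable 0 = - {x. \<forall>j<3. 0 < bary 1 j x}"
| "stable (Suc n) = stable n \<union> (\<Union>a\<in>base n. tri n a)"

definition ept :: "nat \<Rightarrow> real \<times> real \<Rightarrow> nat \<Rightarrow> nat \<Rightarrow> real \<Rightarrow> real \<times> real" where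
  "ept n a i j t = a + sz n *\<^sub>R ((1 - t) *\<^sub>R dir i + t *\<^sub>R dir j)"

section \<open>Barycentric coordinates and incidence of cells\<close>

lemma less_3: "i < 3 \<longleftrightarrow> i = 0 \<or> i = 1 \<or> i = (2::nat)"
  by auto

lemma all_less_3: "(\<forall>i<3. P i) \<longleftrightarrow> P 0 \<and> P 1 \<and> P (2::nat)"
  by (auto simp: less_3)

lemma third_index:
  assumes "i < (3::nat)" "j < 3" "i \<noteq> j"
  obtains k where "k < 3" "k \<noteq> i" "k \<noteq> j" "{..<3} - {i} = {j, k}" "{..<3} - {j} = {i, k}"
    "{..<3} - {k} = {i, j}"
proof -
  define k where "k = 3 - i - j"
  have k: "k < 3" "k \<noteq> i" "k \<noteq> j" and all: "l = i \<or> l = j \<or> l = k" if "l < 3" for l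
    using assms that unfolding k_def by arith+
  from k(1)[OF assms(1)] k(2)[OF assms(1)] k(3)[OF assms(1)] show thesis
  proof (rule that)
    show "{..<3} - {i} = {j, k}" "{..<3} - {j} = {i, k}" "{..<3} - {k} = {i, j}"
      using all assms k[OF assms(1)] by auto
  qed
qed

lemma sz_pos [simp]: "sz n > 0" "sz n \<ge> 0" "sz n \<noteq> 0"
  by (auto simp: sz_def)

lemma sz_Suc: "sz (Suc n) = sz n / 2"
  by (simp add: sz_def)

lemma sz_0 [simp]: "sz 0 = 1"
  by (simp add: sz_def)

lemma bary_sum: "bary s 0 z + bary s 1 z + bary s 2 z = s"
  by (simp add: bary_def field_simps)

lemma bary_dir:
  assumes "i < 3" "j < 3"
  shows "bary s i (x + c *\<^sub>R dir j) = bary s i x + c * (if i = j then 1 else 0) - c * (if i = 0 then 1 else 0)"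
  using assms by (auto simp: less_3 bary_def dir_def field_simps)

lemma bary_shift: "bary s i z + (if i = 0 \<or> i > 2 then t else 0) = bary (s + t) i z"
  by (auto simp: bary_def)

lemma bary_inj:
  assumes "\<And>j. j < 3 \<Longrightarrow> bary s j x = bary s j y"
  shows "x = y"
  using assms[of 1] assms[of 2] by (auto simp: bary_def prod_eq_iff)

text \<open>The translation along \<open>dir i\<close> and the halved scale, which enters only
  coordinate 0, cancel in every coordinate except \<open>i\<close>. Incidences between consecutive
  levels thereby become linear arithmetic.\<close>

lemma bary_child:
  assumes "i < 3" "j < 3"
  shows "bary (sz (Suc n)) j (x - child n i a) = bary (sz n) j (x - a) - (if i = j then sz n / 2 else 0)"
proof -
  have eq: "x - child n i a = (x - a) + (- (sz n / 2)) *\<^sub>R dir i"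
    by (simp add: child_def algebra_simps)
  show ?thesis
    unfolding eq using bary_dir[of j i "sz (Suc n)" "x - a" "- (sz n / 2)"] assms
      bary_shift[of "sz (Suc n)" j "x - a" "sz n / 2"]
    by (auto simp: sz_Suc split: if_splits)
qed

lemma bary_mid:
  assumes "k < 3" "j < 3"
  shows "bary (sz n) j (mid n a k - a) = (if j = k then 0 else sz n / 2)"
  using assms by (auto simp: less_3 mid_def bary_def dir_def field_simps)

lemma bary_ept:
  assumes "i < 3" "j < 3" "k < 3" "i \<noteq> j"
  shows "bary (sz n) k (ept n a i j t - a) = (if k = i then (1 - t) * sz n else if k = j then t * sz n else 0)"
  using assms by (auto simp: less_3 ept_def bary_def dir_def field_simps)

lemma cell_child_subset:
  assumes "i < 3"
  shows "cell (Suc n) (child n i a) \<subseteq> cell n a"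
proof
  fix x assume x: "x \<in> cell (Suc n) (child n i a)"
  have "0 \<le> bary (sz n) j (x - a)" if "j < 3" for j
  proof -
    have "0 \<le> bary (sz (Suc n)) j (x - child n i a)"
      using x that by (simp add: cell_def)
    then show ?thesis using bary_child[OF assms that, of n x a]
      by (cases "i = j") (auto intro: order_trans[OF less_imp_le[OF half_gt_zero[OF sz_pos(1)]]])
  qed
  then show "x \<in> cell n a" by (simp add: cell_def)
qed

lemma cell_cover: "x \<in> cell n a \<Longrightarrow> x \<in> tri n a \<or> (\<exists>i<3. x \<in> cell (Suc n) (child n i a))"
proof (rule disjCI)
  assume x: "x \<in> cell n a" and no: "\<not> (\<exists>i<3. x \<in> cell (Suc n) (child n i a))"
  have "bary (sz n) i (x - a) \<le> sz n / 2" if i: "i < 3" for i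
  proof (rule ccontr)
    assume "\<not> ?thesis"
    then have "0 \<le> bary (sz (Suc n)) j (x - child n i a)" if "j < 3" for j
      using x that bary_child[OF i that, of n x a] by (auto simp: cell_def)
    with no i show False by (auto simp: cell_def)
  qed
  then show "x \<in> tri n a" by (simp add: tri_def)
qed

lemma tri_subset_cell: "tri n a \<subseteq> cell n a"
proof
  fix x assume "x \<in> tri n a"
  then show "x \<in> cell n a"
    using bary_sum[of "sz n" "x - a"] by (auto simp: tri_def cell_def all_less_3)
qed

lemma bary_sum3:
  assumes "i < 3" "j < 3" "k < 3" "i \<noteq> j" "k \<noteq> i" "k \<noteq> j"
  shows "bary s i z + bary s j z + bary s k z = s"
proof -
  have "(\<Sum>l\<in>{i, j, k}. bary s l z) = (\<Sum>l<3. bary s l z)"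
    using assms by (intro sum.cong) auto
  also have "\<dots> = s"
    using bary_sum[of s z] by (simp add: eval_nat_numeral)
  finally show ?thesis using assms by (simp add: add.assoc)
qed

lemma cell_sum_le:
  assumes "x \<in> cell n a" "i < 3" "j < 3" "i \<noteq> j"
  shows "bary (sz n) i (x - a) + bary (sz n) j (x - a) \<le> sz n"
proof -
  obtain k where k: "k < 3" "k \<noteq> i" "k \<noteq> j" using third_index[OF assms(2-4)] by metis
  then have "0 \<le> bary (sz n) k (x - a)" using assms(1) by (simp add: cell_def)
  with bary_sum3[OF assms(2,3) k(1) assms(4) k(2,3), of "sz n" "x - a"] show ?thesis by linarith
qed

lemma bdry_subset_cell: "bdry n a \<subseteq> cell n a"
  by (simp add: bdry_def)

text \<open>For siblings, two coordinates in the parent are at least half its side, hence both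
  exactly half. For different parents, the point is a corner of its parent by induction, and a
  corner of the parent lying in a child is a corner of that child.\<close>

lemma distinct_cells_vertex:
  assumes "a \<in> base n" "a' \<in> base n" "a \<noteq> a'" "x \<in> cell n a" "x \<in> cell n a'"
  shows "\<exists>i<3. bary (sz n) i (x - a) = sz n"
  using assms
proof (induction n arbitrary: a a')
  case (Suc n)
  obtain c i c' i' where c: "c \<in> base n" "i < 3" "a = child n i c"
    "c' \<in> base n" "i' < 3" "a' = child n i' c'"
    using Suc.prems(1,2) by auto
  have x: "x \<in> cell n c" "x \<in> cell n c'"
    using Suc.prems c cell_child_subset by blast+
  have bi: "bary (sz n) i (x - c) \<ge> sz n / 2"
    using Suc.prems(4) c bary_child[of i i n x c] by (auto simp: cell_def)
  show ?case
  proof (cases "c = c'")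
    case True
    with Suc.prems c have ne: "i \<noteq> i'" by auto
    have "bary (sz n) i' (x - c) \<ge> sz n / 2"
      using Suc.prems(5) c True bary_child[of i' i' n x c] by (auto simp: cell_def)
    with bi cell_sum_le[OF x(1) \<open>i < 3\<close> \<open>i' < 3\<close> ne]
    have "bary (sz n) i' (x - c) = sz n / 2" by linarith
    then have "bary (sz (Suc n)) i' (x - a) = sz (Suc n)"
      using bary_child[of i i' n x c] c ne by (simp add: sz_Suc)
    with c show ?thesis by blast
  next
    case False
    from Suc.IH[OF c(1,4) False x] obtain k where k: "k < 3" "bary (sz n) k (x - c) = sz n" by blast
    have "k = i"
    proof (rule ccontr)
      assume "k \<noteq> i"
      from cell_sum_le[OF x(1) \<open>k < 3\<close> \<open>i < 3\<close> this] k bi show False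
        using sz_pos(1)[of n] by linarith
    qed
    then have "bary (sz (Suc n)) i (x - a) = sz (Suc n)"
      using bary_child[of i i n x c] c k by (simp add: sz_Suc)
    with c show ?thesis by blast
  qed
qed simp

lemma vertex_bdry:
  assumes "x \<in> cell n a" "i < 3" "bary (sz n) i (x - a) = sz n"
  shows "x \<in> bdry n a"
proof -
  define j where "j = (if i = 0 then 1 else 0 :: nat)"
  have j: "j < 3" "i \<noteq> j" by (auto simp: j_def)
  have "bary (sz n) j (x - a) = 0"
    using cell_sum_le[OF assms(1,2) j] assms j by (auto simp: cell_def intro: antisym)
  with assms(1) j show ?thesis by (auto simp: bdry_def)
qed

lemma tri_other_cell:
  assumes "a \<in> base n" "a' \<in> base n" "x \<in> tri n a" "x \<in> cell n a'"
  shows "a = a'"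
proof (rule ccontr)
  assume "a \<noteq> a'"
  from distinct_cells_vertex[OF assms(1,2) this _ assms(4)] assms(3) tri_subset_cell
  obtain i where "i < 3" "bary (sz n) i (x - a) = sz n" by blast
  with assms(3) show False
    using sz_pos(1)[of n] by (auto simp: tri_def)
qed

text \<open>Later constructions inside a cell can meet earlier values only along its boundary. In
  the induction the point lies on an old edge, whose vanishing coordinate is inherited by the child,
  or on the side that the child shares with the removed triangle of its parent.\<close>

lemma stable_cell_bdry:
  assumes "a \<in> base n" "x \<in> stable n" "x \<in> cell n a"
  shows "x \<in> bdry n a"
  using assms
proof (induction n arbitrary: a)
  case 0
  then show ?case by (auto simp: bdry_def cell_def less_le)
next
  case (Suc n)
  obtain c i where c: "c \<in> base n" "i < 3" "a = child n i c"
    using Suc.prems(1) by auto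
  have xc: "x \<in> cell n c"
    using Suc.prems c cell_child_subset by blast
  have bi: "bary (sz n) i (x - c) \<ge> sz n / 2"
    using Suc.prems(3) c bary_child[of i i n x c] by (auto simp: cell_def)
  consider "x \<in> stable n" | c' where "c' \<in> base n" "x \<in> tri n c'"
    using Suc.prems(2) by auto
  then have "\<exists>j<3. bary (sz (Suc n)) j (x - a) = 0"
  proof cases
    case 1
    from Suc.IH[OF c(1) 1 xc] obtain j where j: "j < 3" "bary (sz n) j (x - c) = 0"
      by (auto simp: bdry_def)
    with bi have "j \<noteq> i" using sz_pos(1)[of n] by (auto simp del: sz_pos)
    with j c bary_child[of i j n x c] show ?thesis by auto
  next
    case 2
    then have "x \<in> tri n c" using tri_other_cell[OF _ c(1) _ xc] by blast
    with bi c have "bary (sz n) i (x - c) = sz n / 2" by (auto simp: tri_def intro: antisym)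
    with bary_child[of i i n x c] c show ?thesis by auto
  qed
  with Suc.prems(3) show ?case by (auto simp: bdry_def)
qed

text \<open>The side of the child opposite its corner \<open>i\<close> is a side of the removed
  triangle; the other two sides are halves of sides of the parent. This drives the passage of
  boundary bounds from cells to children.\<close>

lemma child_bdry:
  assumes i: "i < 3" and x: "x \<in> bdry (Suc n) (child n i a)"
  shows "x \<in> bdry n a \<or> x \<in> tri n a"
proof -
  obtain j where j: "j < 3" "bary (sz (Suc n)) j (x - child n i a) = 0"
    using x by (auto simp: bdry_def)
  have xc: "x \<in> cell n a"
    using x cell_child_subset[OF i, of n a] by (auto simp: bdry_def)
  show ?thesis
  proof (cases "i = j")
    case True
    with j bary_child[of i i n x a] have bi: "bary (sz n) i (x - a) = sz n / 2" by auto
    have "bary (sz n) k (x - a) \<le> sz n / 2" if "k < 3" for k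
      using cell_sum_le[OF xc i that] bi by (cases "k = i") auto
    then show ?thesis by (simp add: tri_def)
  next
    case False
    with j i bary_child[of i j n x a] have "bary (sz n) j (x - a) = 0" by auto
    with xc j show ?thesis by (auto simp: bdry_def)
  qed
qed

lemma bdry_subset_stable: "a \<in> base n \<Longrightarrow> bdry n a \<subseteq> stable n"
proof (induction n arbitrary: a)
  case 0
  then show ?case by (force simp: bdry_def)
next
  case (Suc n)
  then obtain c i where c: "c \<in> base n" "i < 3" "a = child n i c" by auto
  show ?case
  proof
    fix x assume "x \<in> bdry (Suc n) a"
    with c child_bdry[of i x n c] Suc.IH[OF c(1)] show "x \<in> stable (Suc n)" by auto
  qed
qed

lemma dist_dir: "i < 3 \<Longrightarrow> j < 3 \<Longrightarrow> i \<noteq> j \<Longrightarrow> dist (dir i) (dir j) = 1"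
  by (auto simp: less_3 dir_def dist_prod_def dist_real_def power2_eq_square field_simps)

lemma dir_sum:
  assumes "i < 3" "j < 3" "k < 3" "i \<noteq> j" "i \<noteq> k" "j \<noteq> k"
  shows "dir 0 + dir 1 + dir 2 = dir i + dir j + dir k"
  using assms by (auto simp: less_3 algebra_simps)

lemma mid_alt:
  assumes "i < 3" "j < 3" "k < 3" "i \<noteq> j" "i \<noteq> k" "j \<noteq> k"
  shows "mid n a k = a + (sz n / 2) *\<^sub>R (dir i + dir j)"
  unfolding mid_def dir_sum[OF assms] by simp

lemma mid_eq_ept:
  assumes "i < 3" "j < 3" "k < 3" "i \<noteq> j" "i \<noteq> k" "j \<noteq> k"
  shows "mid n a k = ept n a i j (1 / 2)"
  unfolding mid_alt[OF assms] by (simp add: ept_def scaleR_add_right)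

lemma ept_sym: "ept n a i j t = ept n a j i (1 - t)"
  by (simp add: ept_def add.commute)

lemma ept_child_near: "ept (Suc n) (child n i a) i k t = ept n a i k (t / 2)"
  by (simp add: ept_def child_def sz_Suc prod_eq_iff algebra_simps add_divide_distrib)

lemma ept_child_far: "ept (Suc n) (child n i a) k i t = ept n a k i ((1 + t) / 2)"
  unfolding ept_sym[of _ _ k i] ept_child_near by (simp add: field_simps)

text \<open>This is the only side of child \<open>i\<close> that is not part of a side of the
  parent. It joins two nodes of the removed triangle, so that values on it are given by the
  interpolation.\<close>

lemma ept_child_fresh:
  assumes "i < 3" "j < 3" "k < 3" "i \<noteq> j" "i \<noteq> k" "j \<noteq> k"
  shows "ept (Suc n) (child n i a) j k t = (1 - t) *\<^sub>R mid n a k + t *\<^sub>R mid n a j"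
proof -
  have "mid n a k = a + (sz n / 2) *\<^sub>R (dir i + dir j)" "mid n a j = a + (sz n / 2) *\<^sub>R (dir i + dir k)"
    using assms by (auto intro: mid_alt)
  then show ?thesis
    by (simp add: ept_def child_def sz_Suc prod_eq_iff algebra_simps add_divide_distrib)
qed

lemma dist_mid:
  assumes "i < 3" "j < 3" "i \<noteq> j"
  shows "dist (mid n a i) (mid n a j) = sz n / 2"
proof -
  have "mid n a i - mid n a j = (sz n / 2) *\<^sub>R (dir j - dir i)"
    by (simp add: mid_def algebra_simps)
  then show ?thesis
    using dist_dir[of j i] assms by (simp add: dist_norm)
qed

lemma dist_ept:
  assumes "i < 3" "j < 3" "i \<noteq> j"
  shows "dist (ept n a i j t) (ept n a i j u) = \<bar>t - u\<bar> * sz n"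
proof -
  have "ept n a i j t - ept n a i j u = ((t - u) * sz n) *\<^sub>R (dir j - dir i)"
    by (simp add: ept_def algebra_simps)
  then show ?thesis
    using dist_dir[of j i] assms by (simp add: dist_norm abs_mult)
qed

lemma continuous_ept: "continuous_on A (ept n a i j)"
  unfolding ept_def by (intro continuous_intros)

lemma base_ancestor:
  assumes "n \<le> m" "a \<in> base m"
  obtains b where "b \<in> base n" "cell m a \<subseteq> cell n b"
proof -
  have "\<exists>b\<in>base n. cell m a \<subseteq> cell n b"
    using assms
  proof (induction m arbitrary: a rule: dec_induct)
    case (step m)
    then obtain c i where c: "c \<in> base m" "i < 3" "a = child m i c" by auto
    with step.IH[OF c(1)] cell_child_subset[OF c(2), of m c] show ?case by blast
  qed auto
  then show thesis using that by blast
qed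

lemma bdry_edge:
  assumes "x \<in> bdry n a"
  obtains i j t where "i < 3" "j < 3" "i \<noteq> j" "0 \<le> t" "t \<le> 1" "x = ept n a i j t"
proof -
  from assms obtain k where k: "k < 3" "bary (sz n) k (x - a) = 0" by (auto simp: bdry_def)
  define i where "i = (if k = 0 then 1 else 0 :: nat)"
  define j where "j = (if k = 2 then 1 else 2 :: nat)"
  have ij: "i < 3" "j < 3" "i \<noteq> j" "i \<noteq> k" "j \<noteq> k"
    by (auto simp: i_def j_def)
  define t where "t = bary (sz n) j (x - a) / sz n"
  have pos: "0 \<le> bary (sz n) l (x - a)" if "l < 3" for l
    using assms that by (auto simp: bdry_def cell_def)
  have sum: "bary (sz n) i (x - a) + bary (sz n) j (x - a) = sz n"
    using bary_sum[of "sz n" "x - a"] k by (auto simp: i_def j_def less_3)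
  have t: "0 \<le> t" "t \<le> 1"
    using pos[OF ij(2)] pos[OF ij(1)] sum by (auto simp: t_def)
  have all: "l = i \<or> l = j \<or> l = k" if "l < 3" for l
    using that k(1) by (auto simp: i_def j_def less_3)
  have ti: "(1 - t) * sz n = bary (sz n) i (x - a)" "t * sz n = bary (sz n) j (x - a)"
    using sum by (auto simp: t_def left_diff_distrib)
  have "x - a = ept n a i j t - a"
  proof (rule bary_inj[where s = "sz n"])
    fix l :: nat assume l: "l < 3"
    then show "bary (sz n) l (x - a) = bary (sz n) l (ept n a i j t - a)"
      using all[OF l] ij k ti by (auto simp: bary_ept)
  qed
  then have "x = ept n a i j t" by simp
  with ij t show thesis by (intro that)
qed

lemma ept_bdry:
  assumes "i < 3" "j < 3" "i \<noteq> j" "0 \<le> t" "t \<le> 1"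
  shows "ept n a i j t \<in> bdry n a"
proof -
  have "3 - i - j < 3 \<and> 3 - i - j \<noteq> i \<and> 3 - i - j \<noteq> j"
    using assms by (auto simp: less_3)
  then show ?thesis
    using assms by (auto simp: bdry_def cell_def bary_ept intro!: exI[of _ "3 - i - j"])
qed

text \<open>Where coordinate \<open>k\<close> vanishes, the other two sum to \<open>sz n\<close> and
  are at most half of it, so they are equal. Hence the interpolation has to agree with earlier
  values in its nodes only.\<close>

lemma tri_bdry_mid:
  assumes "x \<in> tri n a" "x \<in> bdry n a"
  obtains k where "k < 3" "x = mid n a k"
proof -
  from assms obtain k where k: "k < 3" "bary (sz n) k (x - a) = 0" by (auto simp: bdry_def)
  have le: "bary (sz n) l (x - a) \<le> sz n / 2" if "l < 3" for l
    using assms that by (auto simp: tri_def)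
  have "x - a = mid n a k - a"
  proof (rule bary_inj[where s = "sz n"])
    fix l :: nat assume l: "l < 3"
    show "bary (sz n) l (x - a) = bary (sz n) l (mid n a k - a)"
      using l k le[of 0] le[of 1] le[of 2] bary_sum[of "sz n" "x - a"]
      unfolding bary_mid[OF k(1) l] by (auto simp: less_3)
  qed
  with k show thesis by (intro that[of k]) auto
qed

lemma mid_tri: "k < 3 \<Longrightarrow> mid n a k \<in> tri n a"
  by (auto simp: tri_def bary_mid)

lemma mid_bdry: "k < 3 \<Longrightarrow> mid n a k \<in> bdry n a"
  using tri_subset_cell[of n a] mid_tri[of k n a] by (auto simp: bdry_def bary_mid intro!: exI[of _ k])

lemma stable_mono: "m \<le> n \<Longrightarrow> stable m \<subseteq> stable n"
  by (induction n) (auto simp: le_Suc_eq)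

lemma stable_cover: "x \<in> stable n \<or> (\<exists>a\<in>base n. x \<in> cell n a)"
proof (induction n)
  case 0
  then show ?case by (auto simp: cell_def less_imp_le)
next
  case (Suc n)
  then show ?case using cell_cover[of x n] by fastforce
qed

lemma finite_base: "finite (base n)"
  by (induction n) auto

lemma card_base: "real (card (base n)) \<le> 3 ^ n"
proof -
  have "card (base n) \<le> 3 ^ n"
  proof (induction n)
    case (Suc n)
    have "card (base (Suc n)) \<le> (\<Sum>a\<in>base n. card ((\<lambda>i. child n i a) ` {..<3}))"
      by (simp add: card_UN_le[OF finite_base])
    also have "\<dots> \<le> (\<Sum>a\<in>base n. 3)"
      by (intro sum_mono) (metis card_image_le card_lessThan finite_lessThan)
    finally show ?case using Suc by simp
  qed simp
  then show ?thesis
    using of_nat_le_iff[of "card (base n)" "3 ^ n", where 'a = real] by simp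
qed

lemma continuous_bary [continuous_intros]:
  "continuous_on A f \<Longrightarrow> continuous_on A (\<lambda>x. bary s i (f x))"
  unfolding bary_def by (cases "i = 1"; cases "i = 2") (auto intro!: continuous_intros)

lemma closed_cell: "closed (cell n a)"
  unfolding cell_def all_less_3 by (intro closed_Collect_conj closed_Collect_le continuous_intros)

lemma closed_tri: "closed (tri n a)"
  unfolding tri_def all_less_3 by (intro closed_Collect_conj closed_Collect_le continuous_intros)

lemma open_otri: "open (otri n a)"
  unfolding otri_def all_less_3 by (intro open_Collect_conj open_Collect_less continuous_intros)

lemma closed_stable: "closed (stable n)"
proof (induction n)
  case 0
  show ?case unfolding stable.simps all_less_3
    by (intro closed_Compl open_Collect_conj open_Collect_less continuous_intros)
qed (auto intro!: closed_Un closed_UN closed_tri finite_base)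

lemma cell_subset_cbox: "cell n a \<subseteq> cbox a (a + (sz n, sz n))"
proof
  fix x assume x: "x \<in> cell n a"
  have s3: "1 \<le> sqrt 3" "sqrt 3 \<le> 2" by (auto intro: real_le_lsqrt)
  have b: "0 \<le> fst (x - a) - snd (x - a) / sqrt 3" "0 \<le> 2 * snd (x - a) / sqrt 3"
    "0 \<le> sz n - fst (x - a) - snd (x - a) / sqrt 3"
    using x by (auto simp: cell_def all_less_3 bary_def)
  define y where "y = snd (x - a) / sqrt 3"
  have y: "snd (x - a) = y * sqrt 3" by (simp add: y_def)
  have "0 \<le> y" "y \<le> fst (x - a)" "fst (x - a) + y \<le> sz n"
    using b by (auto simp: y_def zero_le_divide_iff)
  moreover have "y * sqrt 3 \<le> 2 * y" "0 \<le> y * sqrt 3"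
    using \<open>0 \<le> y\<close> s3 mult_left_mono[of "sqrt 3" 2 y] by auto
  ultimately have "0 \<le> fst (x - a)" "fst (x - a) \<le> sz n" "0 \<le> snd (x - a)" "snd (x - a) \<le> sz n"
    unfolding y by linarith+
  then show "x \<in> cbox a (a + (sz n, sz n))"
    by (cases x; cases a) (auto simp: cbox_Pair_eq)
qed

section \<open>Identification with the gasket, and its measure zero\<close>

definition vert :: "nat \<Rightarrow> real \<times> real \<Rightarrow> nat \<Rightarrow> real \<times> real" where
  "vert n a i = a + sz n *\<^sub>R dir i"

lemma vert_child: "vert (Suc n) (child n i a) j = midpoint (vert n a i) (vert n a j)"
  by (simp add: vert_def child_def midpoint_def sz_Suc algebra_simps scaleR_add_left[symmetric])

lemma gasket_triangles_eq: "gasket_triangles n = (\<lambda>a. (vert n a 0, vert n a 1, vert n a 2)) ` base n"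
proof (induction n)
  case 0
  show ?case by (simp add: vert_def dir_def zero_prod_def)
next
  case (Suc n)
  have lt3: "{..<3::nat} = {0, 1, 2}" by auto
  show ?case
    unfolding gasket_triangles.simps Suc base.simps
    by (simp add: image_UN lt3 vert_child midpoint_sym)
qed

lemma bary_convex:
  assumes "u + v = (1::real)"
  shows "bary s i (u *\<^sub>R x + v *\<^sub>R y - a) = u * bary s i (x - a) + v * bary s i (y - a)"
proof -
  have u: "u = 1 - v" using assms by simp
  show ?thesis unfolding u by (auto simp: bary_def algebra_simps add_divide_distrib diff_divide_distrib)
qed

lemma convex_cell: "convex (cell n a)"
  by (rule convexI) (auto simp: cell_def bary_convex)

lemma convex_tri: "convex (tri n a)"
proof (rule convexI)
  fix x y and u v :: real
  assume *: "x \<in> tri n a" "y \<in> tri n a" "0 \<le> u" "0 \<le> v" "u + v = 1"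
  show "u *\<^sub>R x + v *\<^sub>R y \<in> tri n a"
    using * convex_bound_le[of _ "sz n / 2" _ u v] by (simp add: tri_def bary_convex)
qed

lemma bary_vert:
  assumes "i < 3" "j < 3"
  shows "bary (sz n) j (vert n a i - a) = (if i = j then sz n else 0)"
  using assms by (auto simp: less_3 vert_def bary_def dir_def field_simps)

lemma bary_convex_3:
  assumes "u + v + w = (1::real)"
  shows "bary s i (u *\<^sub>R x + v *\<^sub>R y + w *\<^sub>R z - a) =
    u * bary s i (x - a) + v * bary s i (y - a) + w * bary s i (z - a)"
proof -
  have u: "u = 1 - v - w" using assms by simp
  show ?thesis unfolding u by (auto simp: bary_def algebra_simps add_divide_distrib diff_divide_distrib)
qed

lemma convex_hull_vert: "convex hull {vert n a 0, vert n a 1, vert n a 2} = cell n a"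
proof (rule antisym)
  show "convex hull {vert n a 0, vert n a 1, vert n a 2} \<subseteq> cell n a"
    by (rule hull_minimal[where S = convex, OF _ convex_cell]) (auto simp: cell_def bary_vert)
  show "cell n a \<subseteq> convex hull {vert n a 0, vert n a 1, vert n a 2}"
  proof
    fix x assume x: "x \<in> cell n a"
    define b where "b j = bary (sz n) j (x - a) / sz n" for j
    have b: "0 \<le> b 0" "0 \<le> b 1" "0 \<le> b 2"
      using x by (auto simp: cell_def b_def)
    have sum: "b 0 + b 1 + b 2 = 1"
      using bary_sum[of "sz n" "x - a"] by (simp add: b_def add_divide_distrib[symmetric])
    have bb: "bary (sz n) j (x - a) = b j * sz n" for j
      by (simp add: b_def)
    have "x - a = b 0 *\<^sub>R vert n a 0 + b 1 *\<^sub>R vert n a 1 + b 2 *\<^sub>R vert n a 2 - a"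
    proof (rule bary_inj[where s = "sz n"])
      fix j :: nat assume "j < 3"
      then show "bary (sz n) j (x - a) = bary (sz n) j (b 0 *\<^sub>R vert n a 0 + b 1 *\<^sub>R vert n a 1 + b 2 *\<^sub>R vert n a 2 - a)"
        unfolding bary_convex_3[OF sum] bb by (auto simp: bary_vert less_3)
    qed
    then show "x \<in> convex hull {vert n a 0, vert n a 1, vert n a 2}"
      unfolding convex_hull_3 using b sum by auto
  qed
qed

lemma convex_hull_mid: "convex hull {mid n a 2, mid n a 0, mid n a 1} = tri n a"
proof (rule antisym)
  show "convex hull {mid n a 2, mid n a 0, mid n a 1} \<subseteq> tri n a"
    by (rule hull_minimal[where S = convex, OF _ convex_tri]) (auto simp: mid_tri)
  show "tri n a \<subseteq> convex hull {mid n a 2, mid n a 0, mid n a 1}"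
  proof
    fix x assume x: "x \<in> tri n a"
    define b where "b j = 1 - 2 * (bary (sz n) j (x - a) / sz n)" for j
    have b: "0 \<le> b 0" "0 \<le> b 1" "0 \<le> b 2"
      using x by (auto simp: tri_def b_def field_simps)
    have bs: "bary (sz n) 0 (x - a) / sz n + bary (sz n) 1 (x - a) / sz n + bary (sz n) 2 (x - a) / sz n = 1"
      using bary_sum[of "sz n" "x - a"] by (simp add: add_divide_distrib[symmetric])
    then have sum: "b 2 + b 0 + b 1 = 1"
      unfolding b_def by linarith
    have bb: "bary (sz n) j (x - a) = (1 - b j) / 2 * sz n" for j
      by (simp add: b_def)
    have "x - a = b 2 *\<^sub>R mid n a 2 + b 0 *\<^sub>R mid n a 0 + b 1 *\<^sub>R mid n a 1 - a"
    proof (rule bary_inj[where s = "sz n"])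
      fix j :: nat assume j: "j < 3"
      have e: "1 - b 0 = b (Suc 0) + b 2" "1 - b (Suc 0) = b 0 + b 2" "1 - b 2 = b 0 + b (Suc 0)"
        using sum by auto
      show "bary (sz n) j (x - a) = bary (sz n) j (b 2 *\<^sub>R mid n a 2 + b 0 *\<^sub>R mid n a 0 + b 1 *\<^sub>R mid n a 1 - a)"
        unfolding bary_convex_3[OF sum] bb using j by (auto simp: bary_mid less_3 e) (simp_all add: field_simps)
    qed
    then show "x \<in> convex hull {mid n a 2, mid n a 0, mid n a 1}"
      unfolding convex_hull_3 using b sum by auto
  qed
qed

lemma interior_tri: "interior (tri n a) = otri n a"
proof (rule antisym)
  show "otri n a \<subseteq> interior (tri n a)"
    by (rule interior_maximal[OF _ open_otri]) (auto simp: otri_def tri_def less_imp_le)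
  show "interior (tri n a) \<subseteq> otri n a"
  proof
    fix x assume "x \<in> interior (tri n a)"
    then obtain e where e: "e > 0" "ball x e \<subseteq> tri n a"
      by (auto simp: mem_interior)
    show "x \<in> otri n a"
      unfolding otri_def
    proof safe
      fix j :: nat assume j: "j < 3"
      define k where "k = (if j = 0 then 1 else 0 :: nat)"
      have k: "k < 3" "j \<noteq> k" by (auto simp: k_def)
      \<comment> \<open>Moving in the direction \<open>dir j - dir k\<close> raises coordinate
        \<open>j\<close> by \<open>e / 2\<close> without leaving the ball, so this coordinate was
        not yet at its upper bound.\<close>
      have "dist x (x + (e / 2) *\<^sub>R (dir j - dir k)) = e / 2"
        using dist_dir[OF j k] e by (simp add: dist_norm)
      then have "x + (e / 2) *\<^sub>R (dir j - dir k) \<in> tri n a"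
        using e by (intro subsetD[OF e(2)]) auto
      then have "bary (sz n) j (x + (e / 2) *\<^sub>R (dir j - dir k) - a) \<le> sz n / 2"
        using j by (simp add: tri_def)
      moreover have "x + (e / 2) *\<^sub>R (dir j - dir k) - a = ((x - a) + (e / 2) *\<^sub>R dir j) + (- (e / 2)) *\<^sub>R dir k"
        by (simp add: algebra_simps)
      ultimately show "bary (sz n) j (x - a) < sz n / 2"
        using j k e by (simp only: bary_dir) (simp split: if_splits)
    qed
  qed
qed

lemma midpoint_vert:
  "midpoint (vert n a 0) (vert n a 1) = mid n a 2"
  "midpoint (vert n a 1) (vert n a 2) = mid n a 0"
  "midpoint (vert n a 0) (vert n a 2) = mid n a 1"
  by (simp_all add: vert_def mid_def midpoint_def algebra_simps scaleR_add_left[symmetric])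

lemma gasket_stage_eq: "gasket_stage n = cell 0 0 - (\<Union>m<n. \<Union>a\<in>base m. otri m a)"
proof (induction n)
  case 0
  show ?case using convex_hull_vert[of 0 0] by (simp add: vert_def dir_def zero_prod_def)
next
  case (Suc n)
  have "gasket_stage (Suc n) = gasket_stage n - (\<Union>a\<in>base n. otri n a)"
    by (simp add: gasket_triangles_eq midpoint_vert[simplified] interior_tri convex_hull_mid[simplified])
  then show ?case unfolding Suc by (auto simp: less_Suc_eq)
qed

lemma sierpinski_gasket_eq: "sierpinski_gasket = cell 0 0 - (\<Union>n. \<Union>a\<in>base n. otri n a)"
  unfolding sierpinski_gasket_def gasket_stage_eq by blast

lemma sierpinski_gasket_cells: "sierpinski_gasket \<subseteq> (\<Union>a\<in>base n. cell n a)"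
proof (induction n)
  case 0
  show ?case by (auto simp: sierpinski_gasket_eq)
next
  case (Suc n)
  show ?case
  proof
    fix x assume x: "x \<in> sierpinski_gasket"
    with Suc obtain a where a: "a \<in> base n" "x \<in> cell n a" by blast
    with x have "x \<notin> otri n a" by (auto simp: sierpinski_gasket_eq)
    then obtain i where i: "i < 3" "sz n / 2 \<le> bary (sz n) i (x - a)"
      by (auto simp: otri_def not_less)
    have "0 \<le> bary (sz (Suc n)) j (x - child n i a)" if "j < 3" for j
      using bary_child[OF i(1) that, of n x a] a(2) i that by (auto simp: cell_def)
    then have "x \<in> cell (Suc n) (child n i a)" by (simp add: cell_def)
    with a i show "x \<in> (\<Union>a\<in>base (Suc n). cell (Suc n) a)" by auto
  qed
qed

lemma emeasure_cell_le: "emeasure lborel (cell n a) \<le> ennreal ((1 / 4) ^ n)"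
proof -
  have "emeasure lborel (cell n a) \<le> emeasure lborel (cbox a (a + (sz n, sz n)))"
    by (intro emeasure_mono cell_subset_cbox) auto
  also have "\<dots> = ennreal ((1 / 4) ^ n)"
  proof -
    have "(sz n)\<^sup>2 = (1 / 4) ^ n"
      by (simp add: sz_def power_divide power_mult[symmetric] mult.commute[of n]) (simp add: power_mult)
    then show ?thesis
      by (cases a) (auto simp: emeasure_lborel_cbox_eq Basis_prod_def inner_prod_def power2_eq_square
        prod.union_disjoint)
  qed
  finally show ?thesis .
qed

text \<open>At level \<open>n\<close> at most \<open>3 ^ n\<close> cells cover the gasket, each
  inside a square of area \<open>(1 / 4) ^ n\<close>.\<close>

lemma sierpinski_gasket_null: "sierpinski_gasket \<in> null_sets lborel"
proof -
  have K: "sierpinski_gasket \<in> sets lborel"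
    using compact_imp_closed[OF compact_sierpinski_gasket] by auto
  have cell_sets: "cell n a \<in> sets lborel" for n a
    using closed_cell by auto
  have le: "emeasure lborel sierpinski_gasket \<le> ennreal ((3 / 4) ^ n)" for n
  proof -
    have "emeasure lborel sierpinski_gasket \<le> emeasure lborel (\<Union>a\<in>base n. cell n a)"
      using cell_sets finite_base by (intro emeasure_mono sierpinski_gasket_cells sets.finite_UN) auto
    also have "\<dots> \<le> (\<Sum>a\<in>base n. emeasure lborel (cell n a))"
      using cell_sets finite_base by (intro emeasure_subadditive_finite) auto
    also have "\<dots> \<le> (\<Sum>a\<in>base n. ennreal ((1 / 4) ^ n))"
      by (intro sum_mono emeasure_cell_le)
    also have "\<dots> = ennreal (real (card (base n)) * (1 / 4) ^ n)"
      by (subst sum_ennreal) simp_all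
    also have "\<dots> \<le> ennreal (3 ^ n * (1 / 4) ^ n)"
      by (intro ennreal_leI mult_right_mono card_base) simp
    also have "3 ^ n * (1 / 4) ^ n = ((3 / 4) ^ n :: real)"
      by (simp add: power_mult_distrib[symmetric])
    finally show ?thesis .
  qed
  have "(\<lambda>n. ennreal ((3 / 4) ^ n)) \<longlonglongrightarrow> ennreal 0"
    by (intro tendsto_ennrealI LIMSEQ_power_zero) auto
  then have "emeasure lborel sierpinski_gasket \<le> ennreal 0"
    by (rule LIMSEQ_le_const) (use le in auto)
  with K show ?thesis by auto
qed

section \<open>Shepard interpolation\<close>

lemma sum_3: "(\<Sum>k<3. g k) = g 0 + g 1 + (g (2::nat) :: real)"
  by (simp add: eval_nat_numeral)

text \<open>Multiplying the inverse powers by all distances makes the weights finite at the nodes.\<close>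

definition wt :: "real \<Rightarrow> (nat \<Rightarrow> 'a::real_inner) \<Rightarrow> nat \<Rightarrow> 'a \<Rightarrow> real" where
  "wt \<beta> P k x = (\<Prod>j\<in>{..<3} - {k}. (norm (x - P j))\<^sup>2) powr \<beta>"

definition lam :: "real \<Rightarrow> (nat \<Rightarrow> 'a::real_inner) \<Rightarrow> nat \<Rightarrow> 'a \<Rightarrow> real" where
  "lam \<beta> P k x = wt \<beta> P k x / (\<Sum>i<3. wt \<beta> P i x)"

definition shep :: "real \<Rightarrow> (nat \<Rightarrow> 'a::real_inner) \<Rightarrow> (nat \<Rightarrow> real) \<Rightarrow> 'a \<Rightarrow> real" where
  "shep \<beta> P q x = (\<Sum>k<3. q k * lam \<beta> P k x)"

locale shepard =
  fixes \<beta> :: real and P :: "nat \<Rightarrow> 'a::real_inner"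
  assumes \<beta>: "0 < \<beta>" "\<beta> \<le> 1 / 10"
    and inj: "\<And>i j. i < 3 \<Longrightarrow> j < 3 \<Longrightarrow> i \<noteq> j \<Longrightarrow> P i \<noteq> P j"
begin

lemma wt_nonneg: "0 \<le> wt \<beta> P k x"
  by (simp add: wt_def)

lemma wt_at_node:
  assumes "i < 3" "j < 3" "i \<noteq> j"
  shows "wt \<beta> P i (P j) = 0" "wt \<beta> P j (P j) > 0"
proof -
  obtain k where k: "k < 3" "k \<noteq> i" "k \<noteq> j" "{..<3} - {i} = {j, k}" "{..<3} - {j} = {i, k}"
    using third_index[OF assms] by metis
  then show "wt \<beta> P i (P j) = 0" "wt \<beta> P j (P j) > 0"
    using assms inj[of j i] inj[of j k] by (auto simp: wt_def)
qed

lemma wt_pos_off_nodes: "(\<And>j. j < 3 \<Longrightarrow> x \<noteq> P j) \<Longrightarrow> wt \<beta> P k x > 0"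
  unfolding wt_def by (auto simp: prod_zero_iff)

lemma sum_wt_pos: "(\<Sum>i<3. wt \<beta> P i x) > 0"
proof -
  have "\<exists>i<3. wt \<beta> P i x > 0"
  proof (cases "\<exists>j<3. x = P j")
    case True
    then obtain j where j: "j < 3" "x = P j" by blast
    define i where "i = (if j = 0 then 1 else 0 :: nat)"
    have "i < 3" "i \<noteq> j" by (auto simp: i_def)
    with wt_at_node(2)[of i j] j show ?thesis by auto
  next
    case False
    then have "0 < wt \<beta> P 0 x" by (intro wt_pos_off_nodes) auto
    then show ?thesis by (intro exI[of _ 0]) simp
  qed
  then obtain i where "i < 3" "wt \<beta> P i x > 0" by blast
  then show ?thesis by (intro sum_pos2[of _ i]) (auto simp: wt_nonneg)
qed

lemma lam_nonneg: "0 \<le> lam \<beta> P k x"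
  using sum_wt_pos[of x] by (simp add: lam_def wt_nonneg)

lemma lam_sum: "(\<Sum>k<3. lam \<beta> P k x) = 1"
  using sum_wt_pos[of x] by (simp add: lam_def sum_divide_distrib[symmetric])

lemma lam_le_1: "k < 3 \<Longrightarrow> lam \<beta> P k x \<le> 1"
  using lam_sum[of x] member_le_sum[of k "{..<3}" "\<lambda>k. lam \<beta> P k x"] lam_nonneg by auto

lemma lam_node: "k < 3 \<Longrightarrow> j < 3 \<Longrightarrow> lam \<beta> P k (P j) = (if k = j then 1 else 0)"
proof -
  assume kj: "k < 3" "j < 3"
  have "(\<Sum>i<3. wt \<beta> P i (P j)) = (\<Sum>i<3. if i = j then wt \<beta> P j (P j) else 0)"
    by (intro sum.cong) (use wt_at_node(1)[of _ j] kj in auto)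
  also have "\<dots> = wt \<beta> P j (P j)" using kj by simp
  finally have eq: "(\<Sum>i<3. wt \<beta> P i (P j)) = wt \<beta> P j (P j)" .
  show ?thesis
    using kj wt_at_node(1)[of k j] sum_wt_pos[of "P j"] by (auto simp: lam_def eq)
qed

lemma shep_node: "j < 3 \<Longrightarrow> shep \<beta> P q (P j) = q j"
  unfolding shep_def by (auto simp: lam_node sum_3 less_3)

lemma shep_diff: "shep \<beta> P q x - c = (\<Sum>k<3. (q k - c) * lam \<beta> P k x)"
  using lam_sum[of x] by (simp add: shep_def left_diff_distrib sum_subtractf sum_distrib_left[symmetric])

lemma shep_le: "(\<And>k. k < 3 \<Longrightarrow> q k \<le> c) \<Longrightarrow> shep \<beta> P q x \<le> c"
  using shep_diff[of q x c] lam_nonneg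
  by (smt (verit) lessThan_iff mult_nonpos_nonneg sum_nonpos)

lemma shep_ge: "(\<And>k. k < 3 \<Longrightarrow> c \<le> q k) \<Longrightarrow> c \<le> shep \<beta> P q x"
  using shep_diff[of q x c] lam_nonneg
  by (smt (verit) lessThan_iff mult_nonneg_nonneg sum_nonneg)

lemma continuous_wt: "continuous_on A (wt \<beta> P k)"
  unfolding wt_def using \<beta>
  by (intro continuous_on_powr' continuous_intros) (auto intro!: prod_nonneg)

lemma continuous_shep: "continuous_on A (shep \<beta> P q)"
  unfolding shep_def lam_def
  by (intro continuous_intros continuous_wt) (use sum_wt_pos in \<open>auto simp: less_le\<close>)

lemma wt_ratio:
  assumes "i < 3" "j < 3" "(norm (x - P i))\<^sup>2 \<le> c * (norm (x - P j))\<^sup>2" "1 \<le> c"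
  shows "wt \<beta> P j x \<le> c powr \<beta> * wt \<beta> P i x"
proof (cases "i = j")
  case True
  have "1 \<le> c powr \<beta>" using assms \<beta> by (simp add: ge_one_powr_ge_zero)
  with True show ?thesis using mult_right_mono[OF _ wt_nonneg[of i x], of 1 "c powr \<beta>"] by simp
next
  case False
  obtain k where k: "k \<noteq> i" "k \<noteq> j" "{..<3} - {i} = {j, k}" "{..<3} - {j} = {i, k}"
    using third_index[OF assms(1,2) False] by metis
  let ?r = "\<lambda>i. (norm (x - P i))\<^sup>2"
  have "wt \<beta> P j x = (?r i * ?r k) powr \<beta>"
    using k by (simp add: wt_def)
  also have "\<dots> \<le> (c * ?r j * ?r k) powr \<beta>"
    using assms \<beta> by (intro powr_mono2 mult_right_mono) auto
  also have "\<dots> = c powr \<beta> * wt \<beta> P i x"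
    using k assms by (simp add: wt_def powr_mult mult.assoc)
  finally show ?thesis .
qed

text \<open>This fixes the bound 1/10 on the exponent: \<open>16 \<le> (3 / 2) ^ 10\<close>. It
  serves both the lower bound 1/4 on weights and the energy constant.\<close>

lemma powr_16: "16 powr \<beta> \<le> 3 / 2"
proof -
  have "16 powr \<beta> \<le> 16 powr (1 / 10)"
    using \<beta> by (intro powr_mono) auto
  also have "\<dots> \<le> ((3 / 2) powr 10) powr (1 / 10)"
    by (intro powr_mono2) (simp_all add: power_divide)
  also have "((3 / 2) powr 10) powr (1 / 10) = (3 / 2 :: real)"
    by (simp only: powr_powr) simp
  finally show ?thesis .
qed

text \<open>If no node is closer than a quarter of the distance to \<open>P i\<close>, each other
  weight exceeds that of \<open>i\<close> at most by the factor
  \<open>16 powr \<beta> \<le> 3 / 2\<close>, and \<open>1 + 3 / 2 + 3 / 2 = 4\<close>.\<close>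

lemma lam_ge:
  assumes "i < 3" "\<And>j. j < 3 \<Longrightarrow> norm (x - P i) \<le> 4 * norm (x - P j)"
  shows "1 / 4 \<le> lam \<beta> P i x"
proof -
  have le: "wt \<beta> P j x \<le> 3 / 2 * wt \<beta> P i x" if j: "j < 3" "j \<noteq> i" for j
  proof -
    have "(norm (x - P i))\<^sup>2 \<le> (4 * norm (x - P j))\<^sup>2"
      using assms(2)[OF j(1)] by (intro power_mono) auto
    then have "wt \<beta> P j x \<le> 16 powr \<beta> * wt \<beta> P i x"
      using j assms(1) by (intro wt_ratio) (auto simp: power_mult_distrib)
    also have "\<dots> \<le> 3 / 2 * wt \<beta> P i x"
      by (intro mult_right_mono powr_16 wt_nonneg)
    finally show ?thesis .
  qed
  have "(\<Sum>j<3. wt \<beta> P j x) \<le> 4 * wt \<beta> P i x"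
    using assms(1) le[of 0] le[of 1] le[of 2] unfolding sum_3 less_3 by auto
  then show ?thesis
    using sum_wt_pos[of x] by (simp add: lam_def field_simps)
qed

text \<open>A factor 4 in the distances is 16 in their squares and 256 in a product of two of them.
  It occurs once in the numerator and once in the denominator of the normalised weight, and
  \<open>256 * 256 = 65536\<close>.\<close>

lemma lam_slow:
  assumes "i < 3" and comp: "\<And>j. j < 3 \<Longrightarrow> norm (x - P j) \<le> 4 * norm (y - P j)"
    "\<And>j. j < 3 \<Longrightarrow> norm (y - P j) \<le> 4 * norm (x - P j)"
  shows "lam \<beta> P i x \<le> 65536 powr \<beta> * lam \<beta> P i y"
proof -
  have *: "wt \<beta> P j x \<le> 256 powr \<beta> * wt \<beta> P j y"
    if "j < 3" "\<And>j. j < 3 \<Longrightarrow> norm (x - P j) \<le> 4 * norm (y - P j)" for j x y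
  proof -
    let ?r = "\<lambda>x i. (norm (x - P i))\<^sup>2"
    have "(\<Prod>i\<in>{..<3} - {j}. ?r x i) \<le> (\<Prod>i\<in>{..<3} - {j}. 16 * ?r y i)"
    proof (intro prod_mono conjI)
      fix i assume "i \<in> {..<3} - {j}"
      then have "(norm (x - P i))\<^sup>2 \<le> (4 * norm (y - P i))\<^sup>2"
        by (intro power_mono that) auto
      then show "?r x i \<le> 16 * ?r y i" by (simp add: power_mult_distrib)
    qed auto
    also have "\<dots> = 256 * (\<Prod>i\<in>{..<3} - {j}. ?r y i)"
      using that(1) by (simp add: prod.distrib)
    finally have "wt \<beta> P j x \<le> (256 * (\<Prod>i\<in>{..<3} - {j}. ?r y i)) powr \<beta>"
      unfolding wt_def using \<beta> by (intro powr_mono2) (auto intro!: prod_nonneg)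
    also have "\<dots> = 256 powr \<beta> * wt \<beta> P j y"
      by (simp add: wt_def powr_mult prod_nonneg)
    finally show ?thesis .
  qed
  let ?W = "\<lambda>x. \<Sum>j<3. wt \<beta> P j x"
  have W: "?W y \<le> 256 powr \<beta> * ?W x"
    unfolding sum_distrib_left by (intro sum_mono *) (use comp in auto)
  have "wt \<beta> P i x * ?W y \<le> (256 powr \<beta> * wt \<beta> P i y) * (256 powr \<beta> * ?W x)"
    using sum_wt_pos[of y] assms(1)
    by (intro mult_mono * comp W) (auto simp: wt_nonneg)
  also have "256 powr \<beta> * 256 powr \<beta> = 65536 powr \<beta>"
    by (simp add: powr_mult[symmetric])
  then have "(256 powr \<beta> * wt \<beta> P i y) * (256 powr \<beta> * ?W x) = 65536 powr \<beta> * wt \<beta> P i y * ?W x"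
    by (simp add: ac_simps)
  finally show ?thesis
    using sum_wt_pos[of x] sum_wt_pos[of y] by (simp add: lam_def field_simps)
qed

text \<open>The bound tends to 0 with \<open>\<beta>\<close>, however the three values are chosen:
  at points with comparable distances to the nodes the interpolation is almost the same. This is
  what compensates for the lack of a uniform modulus of continuity.\<close>

lemma shep_slow:
  assumes q: "\<And>k. k < 3 \<Longrightarrow> 0 \<le> q k \<and> q k \<le> 1"
    and comp: "\<And>j. j < 3 \<Longrightarrow> norm (x - P j) \<le> 4 * norm (y - P j)"
    "\<And>j. j < 3 \<Longrightarrow> norm (y - P j) \<le> 4 * norm (x - P j)"
  shows "\<bar>shep \<beta> P q x - shep \<beta> P q y\<bar> \<le> 3 * (65536 powr \<beta> - 1)"
proof -
  let ?c = "65536 powr \<beta>"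
  have c: "1 \<le> ?c" using \<beta> by (simp add: ge_one_powr_ge_zero)
  have d: "\<bar>lam \<beta> P i x - lam \<beta> P i y\<bar> \<le> ?c - 1" if "i < 3" for i
  proof -
    have "lam \<beta> P i x \<le> ?c * lam \<beta> P i y" "lam \<beta> P i y \<le> ?c * lam \<beta> P i x"
      using that comp by (auto intro!: lam_slow)
    moreover have "(?c - 1) * lam \<beta> P i x \<le> ?c - 1" "(?c - 1) * lam \<beta> P i y \<le> ?c - 1"
      using c lam_le_1[OF that] by (auto intro!: mult_left_le)
    ultimately show ?thesis by (simp add: left_diff_distrib abs_le_iff)
  qed
  have "shep \<beta> P q x - shep \<beta> P q y = (\<Sum>k<3. q k * (lam \<beta> P k x - lam \<beta> P k y))"
    by (simp add: shep_def right_diff_distrib sum_subtractf)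
  also have "\<bar>\<dots>\<bar> \<le> (\<Sum>k<3::nat. ?c - 1)"
  proof (rule order_trans[OF sum_abs sum_mono])
    fix k :: nat assume "k \<in> {..<3}"
    then have "\<bar>q k\<bar> * \<bar>lam \<beta> P k x - lam \<beta> P k y\<bar> \<le> 1 * (?c - 1)"
      using q[of k] d[of k] by (intro mult_mono) auto
    then show "\<bar>q k * (lam \<beta> P k x - lam \<beta> P k y)\<bar> \<le> ?c - 1"
      by (simp add: abs_mult)
  qed
  finally show ?thesis by simp
qed

end

section \<open>Dirichlet energy of the interpolation\<close>

lemma nn_integral_abs_powr:
  fixes c \<sigma> :: real
  assumes "c > -1" "\<sigma> > 0"
  shows "(\<integral>\<^sup>+x\<in>{-\<sigma>..\<sigma>}. ennreal (\<bar>x\<bar> powr c) \<partial>lborel) \<le> ennreal (2 * \<sigma> powr (c + 1) / (c + 1))"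
proof -
  let ?I = "\<integral>\<^sup>+x\<in>{0..\<sigma>}. ennreal (\<bar>x\<bar> powr c) \<partial>lborel"
  have hi: "((\<lambda>x. x powr c) has_integral (\<sigma> powr (c + 1) / (c + 1))) {0..\<sigma>}"
    using assms by (intro has_integral_powr_from_0) auto
  have "?I = (\<integral>\<^sup>+x. ennreal (indicator {0..\<sigma>} x * x powr c) \<partial>lborel)"
    by (intro nn_integral_cong) (auto simp: indicator_def)
  also have "\<dots> = ennreal (\<sigma> powr (c + 1) / (c + 1))"
    using hi by (intro nn_integral_has_integral_lebesgue) auto
  finally have I: "?I = ennreal (\<sigma> powr (c + 1) / (c + 1))" .
  have "(\<integral>\<^sup>+x\<in>{-\<sigma>..\<sigma>}. ennreal (\<bar>x\<bar> powr c) \<partial>lborel)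
      \<le> (\<integral>\<^sup>+x. ennreal (\<bar>x\<bar> powr c) * indicator {0..\<sigma>} x
            + ennreal (\<bar>x\<bar> powr c) * indicator {-\<sigma>..0} x \<partial>lborel)"
    by (intro nn_integral_mono) (auto simp: indicator_def)
  also have "\<dots> = ?I + (\<integral>\<^sup>+x\<in>{-\<sigma>..0}. ennreal (\<bar>x\<bar> powr c) \<partial>lborel)"
    by (intro nn_integral_add) auto
  also have "(\<integral>\<^sup>+x\<in>{-\<sigma>..0}. ennreal (\<bar>x\<bar> powr c) \<partial>lborel) =
      (\<integral>\<^sup>+x. ennreal (\<bar>0 + (-1) * x\<bar> powr c) * indicator {-\<sigma>..0} (0 + (-1) * x) \<partial>lborel)"
    by (subst nn_integral_real_affine[where c = "-1" and t = 0]) auto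
  also have "\<dots> = ?I"
    by (intro nn_integral_cong) (auto simp: indicator_def)
  finally show ?thesis
    unfolding I using assms by (simp add: ennreal_plus[symmetric] del: ennreal_plus)
qed

text \<open>The square is split along its diagonals. In the sector
  \<open>\<bar>v\<bar> \<le> \<bar>u\<bar>\<close> the integrand is at most
  \<open>\<bar>u\<bar> powr (2 * \<gamma> - 2)\<close>, and integrating over the fibre of length
  \<open>2 * \<bar>u\<bar>\<close> leaves a power of one variable. The resulting
  \<open>1 / \<gamma>\<close> later cancels one of two factors of the exponent.\<close>

lemma nn_integral_norm_powr_0:
  fixes \<gamma> \<sigma> :: real
  assumes "0 < \<gamma>" "\<gamma> < 1" "\<sigma> > 0"
  shows "(\<integral>\<^sup>+x\<in>cbox (-\<sigma>, -\<sigma>) (\<sigma>, \<sigma>). ennreal ((norm (x :: real \<times> real))\<^sup>2 powr (\<gamma> - 1)) \<partial>lborel)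
    \<le> ennreal (4 * \<sigma> powr (2 * \<gamma>) / \<gamma>)"
proof -
  let ?LL = "lborel \<Otimes>\<^sub>M (lborel :: real measure)"
  define h where "h u = ennreal (\<bar>u\<bar> powr (2 * \<gamma> - 2)) * indicator {-\<sigma>..\<sigma>} u" for u :: real
  have h_meas [measurable]: "h \<in> borel_measurable borel"
    unfolding h_def by measurable
  have pw: "(u\<^sup>2 + v\<^sup>2) powr (\<gamma> - 1) \<le> \<bar>u\<bar> powr (2 * \<gamma> - 2)" if "u \<noteq> 0" for u v :: real
  proof -
    have "(u\<^sup>2 + v\<^sup>2) powr (\<gamma> - 1) \<le> (u\<^sup>2) powr (\<gamma> - 1)"
      using that assms by (intro powr_mono2') auto
    also have "(u\<^sup>2) powr (\<gamma> - 1) = (\<bar>u\<bar> powr 2) powr (\<gamma> - 1)"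
      using that by (simp add: powr_numeral)
    also have "\<dots> = \<bar>u\<bar> powr (2 * \<gamma> - 2)"
      by (simp only: powr_powr) (simp add: algebra_simps)
    finally show ?thesis .
  qed
  have one: "(\<integral>\<^sup>+u. \<integral>\<^sup>+v. h u * indicator {-\<bar>u\<bar>..\<bar>u\<bar>} v \<partial>lborel \<partial>lborel)
      \<le> ennreal (2 * \<sigma> powr (2 * \<gamma>) / \<gamma>)"
  proof -
    have "(\<integral>\<^sup>+v. h u * indicator {-\<bar>u\<bar>..\<bar>u\<bar>} v \<partial>lborel)
        = 2 * (ennreal (\<bar>u\<bar> powr (2 * \<gamma> - 1)) * indicator {-\<sigma>..\<sigma>} u)" for u
    proof -
      have "(\<integral>\<^sup>+v. h u * indicator {-\<bar>u\<bar>..\<bar>u\<bar>} v \<partial>lborel) = h u * ennreal (2 * \<bar>u\<bar>)"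
        by (subst nn_integral_cmult) auto
      also have "\<bar>u\<bar> powr (2 * \<gamma> - 2) * (2 * \<bar>u\<bar>) = 2 * \<bar>u\<bar> powr (2 * \<gamma> - 1)"
        by (cases "u = 0") (auto simp: powr_mult_base mult.commute[of _ "\<bar>u\<bar>"])
      then have "h u * ennreal (2 * \<bar>u\<bar>) = 2 * (ennreal (\<bar>u\<bar> powr (2 * \<gamma> - 1)) * indicator {-\<sigma>..\<sigma>} u)"
        by (auto simp: h_def indicator_def ennreal_mult[symmetric] ennreal_mult'[of 2 "\<bar>u\<bar> powr _", simplified, symmetric])
      finally show ?thesis .
    qed
    then have "(\<integral>\<^sup>+u. \<integral>\<^sup>+v. h u * indicator {-\<bar>u\<bar>..\<bar>u\<bar>} v \<partial>lborel \<partial>lborel)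
       = 2 * (\<integral>\<^sup>+u\<in>{-\<sigma>..\<sigma>}. ennreal (\<bar>u\<bar> powr (2 * \<gamma> - 1)) \<partial>lborel)"
      by (simp add: nn_integral_cmult)
    also have "\<dots> \<le> 2 * ennreal (2 * \<sigma> powr (2 * \<gamma> - 1 + 1) / (2 * \<gamma> - 1 + 1))"
      using assms by (intro mult_left_mono nn_integral_abs_powr) auto
    also have "\<dots> = ennreal (2 * \<sigma> powr (2 * \<gamma>) / \<gamma>)"
      using assms by (simp add: ennreal_mult'[of 2, simplified, symmetric])
    finally show ?thesis .
  qed
  have "(\<lambda>p. if \<bar>snd p\<bar> \<le> \<bar>fst p\<bar> then h (fst p) else 0) \<in> borel_measurable ?LL"
    by measurable
  also have "(\<lambda>p. if \<bar>snd p\<bar> \<le> \<bar>fst p\<bar> then h (fst p) else 0) = (\<lambda>(u, v). h u * indicator {-\<bar>u\<bar>..\<bar>u\<bar>} v)"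
    by (auto simp: indicator_def fun_eq_iff)
  finally have meas1: "(\<lambda>(u, v). h u * indicator {-\<bar>u\<bar>..\<bar>u\<bar>} v) \<in> borel_measurable ?LL" .
  have "(\<lambda>p. if \<bar>fst p\<bar> \<le> \<bar>snd p\<bar> then h (snd p) else 0) \<in> borel_measurable ?LL"
    by measurable
  also have "(\<lambda>p. if \<bar>fst p\<bar> \<le> \<bar>snd p\<bar> then h (snd p) else 0) = (\<lambda>(u, v). h v * indicator {-\<bar>v\<bar>..\<bar>v\<bar>} u)"
    by (auto simp: indicator_def fun_eq_iff)
  finally have meas2: "(\<lambda>(u, v). h v * indicator {-\<bar>v\<bar>..\<bar>v\<bar>} u) \<in> borel_measurable ?LL" .
  have "(\<integral>\<^sup>+x\<in>cbox (-\<sigma>, -\<sigma>) (\<sigma>, \<sigma>). ennreal ((norm (x :: real \<times> real))\<^sup>2 powr (\<gamma> - 1)) \<partial>lborel)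
      \<le> (\<integral>\<^sup>+x. (case x of (u, v) \<Rightarrow> h u * indicator {-\<bar>u\<bar>..\<bar>u\<bar>} v) +
           (case x of (u, v) \<Rightarrow> h v * indicator {-\<bar>v\<bar>..\<bar>v\<bar>} u) \<partial>?LL)"
    unfolding lborel_prod
  proof (intro nn_integral_mono)
    fix x :: "real \<times> real"
    obtain u v where x: "x = (u, v)" by (cases x)
    have n: "(norm x)\<^sup>2 = u\<^sup>2 + v\<^sup>2" by (simp add: x norm_Pair)
    show "ennreal ((norm x)\<^sup>2 powr (\<gamma> - 1)) * indicator (cbox (-\<sigma>, -\<sigma>) (\<sigma>, \<sigma>)) x \<le>
      (case x of (u, v) \<Rightarrow> h u * indicator {-\<bar>u\<bar>..\<bar>u\<bar>} v) +
           (case x of (u, v) \<Rightarrow> h v * indicator {-\<bar>v\<bar>..\<bar>v\<bar>} u)"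
    \<comment> \<open>The origin needs no estimate, since the base there is 0 and
      \<open>0 powr _ = 0\<close>.\<close>
    proof (cases "x \<in> cbox (-\<sigma>, -\<sigma>) (\<sigma>, \<sigma>) \<and> (u \<noteq> 0 \<or> v \<noteq> 0)")
      case True
      then have box: "u \<in> {-\<sigma>..\<sigma>}" "v \<in> {-\<sigma>..\<sigma>}" by (auto simp: x cbox_Pair_eq)
      show ?thesis
      proof (cases "\<bar>v\<bar> \<le> \<bar>u\<bar>")
        case uv: True
        with True have "u \<noteq> 0" by auto
        have "ennreal ((norm x)\<^sup>2 powr (\<gamma> - 1)) \<le> h u * indicator {-\<bar>u\<bar>..\<bar>u\<bar>} v"
          using pw[OF \<open>u \<noteq> 0\<close>, of v] box uv unfolding n by (auto simp: h_def indicator_def abs_le_iff intro!: ennreal_leI)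
        with True show ?thesis by (auto simp: x intro: add_increasing2)
      next
        case uv: False
        then have "v \<noteq> 0" by auto
        have "ennreal ((norm x)\<^sup>2 powr (\<gamma> - 1)) \<le> h v * indicator {-\<bar>v\<bar>..\<bar>v\<bar>} u"
          using pw[OF \<open>v \<noteq> 0\<close>, of u] box uv unfolding n
          by (auto simp: h_def indicator_def abs_le_iff add.commute intro!: ennreal_leI)
        with True show ?thesis by (auto simp: x intro: add_increasing)
      qed
    qed (auto simp: x zero_prod_def[symmetric] norm_Pair)
  qed
  also have "\<dots> = (\<integral>\<^sup>+x. (case x of (u, v) \<Rightarrow> h u * indicator {-\<bar>u\<bar>..\<bar>u\<bar>} v) \<partial>?LL) +
     (\<integral>\<^sup>+x. (case x of (u, v) \<Rightarrow> h v * indicator {-\<bar>v\<bar>..\<bar>v\<bar>} u) \<partial>?LL)"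
    by (intro nn_integral_add meas1 meas2)
  also have "(\<integral>\<^sup>+x. (case x of (u, v) \<Rightarrow> h u * indicator {-\<bar>u\<bar>..\<bar>u\<bar>} v) \<partial>?LL) =
     (\<integral>\<^sup>+u. \<integral>\<^sup>+v. h u * indicator {-\<bar>u\<bar>..\<bar>u\<bar>} v \<partial>lborel \<partial>lborel)"
    by (subst lborel.nn_integral_fst[OF meas1, symmetric]) simp
  also have "(\<integral>\<^sup>+x. (case x of (u, v) \<Rightarrow> h v * indicator {-\<bar>v\<bar>..\<bar>v\<bar>} u) \<partial>?LL) =
     (\<integral>\<^sup>+v. \<integral>\<^sup>+u. h v * indicator {-\<bar>v\<bar>..\<bar>v\<bar>} u \<partial>lborel \<partial>lborel)"
    by (subst lborel_pair.nn_integral_snd[OF meas2, symmetric]) simp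
  also have "(\<integral>\<^sup>+u. \<integral>\<^sup>+v. h u * indicator {-\<bar>u\<bar>..\<bar>u\<bar>} v \<partial>lborel \<partial>lborel) +
      (\<integral>\<^sup>+u. \<integral>\<^sup>+v. h u * indicator {-\<bar>u\<bar>..\<bar>u\<bar>} v \<partial>lborel \<partial>lborel) \<le>
      ennreal (2 * \<sigma> powr (2 * \<gamma>) / \<gamma>) + ennreal (2 * \<sigma> powr (2 * \<gamma>) / \<gamma>)"
    by (intro add_mono one)
  also have "\<dots> = ennreal (4 * \<sigma> powr (2 * \<gamma>) / \<gamma>)"
    using assms by (simp add: ennreal_plus[symmetric] del: ennreal_plus)
  finally show ?thesis .
qed

lemma nn_integral_norm_powr:
  fixes \<gamma> \<sigma> :: real and p :: "real \<times> real"
  assumes "0 < \<gamma>" "\<gamma> < 1" "\<sigma> > 0"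
  shows "(\<integral>\<^sup>+x\<in>cbox (p - (\<sigma>, \<sigma>)) (p + (\<sigma>, \<sigma>)). ennreal ((norm (x - p))\<^sup>2 powr (\<gamma> - 1)) \<partial>lborel)
    \<le> ennreal (4 * \<sigma> powr (2 * \<gamma>) / \<gamma>)"
proof -
  let ?f = "\<lambda>x. ennreal ((norm (x - p))\<^sup>2 powr (\<gamma> - 1)) * indicator (cbox (p - (\<sigma>, \<sigma>)) (p + (\<sigma>, \<sigma>))) x"
  have "(\<integral>\<^sup>+x. ?f x \<partial>lborel) = (\<integral>\<^sup>+x. ?f x \<partial>distr lborel borel ((+) p))"
    by (simp add: lborel_distr_plus)
  also have "\<dots> = (\<integral>\<^sup>+x. ?f (p + x) \<partial>lborel)"
    by (rule nn_integral_distr) measurable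
  also have "\<dots> = (\<integral>\<^sup>+x\<in>cbox (-\<sigma>, -\<sigma>) (\<sigma>, \<sigma>). ennreal ((norm (x :: real \<times> real))\<^sup>2 powr (\<gamma> - 1)) \<partial>lborel)"
  proof (intro nn_integral_cong)
    fix x :: "real \<times> real"
    have "p + x \<in> cbox (p - (\<sigma>, \<sigma>)) (p + (\<sigma>, \<sigma>)) \<longleftrightarrow> x \<in> cbox (-\<sigma>, -\<sigma>) (\<sigma>, \<sigma>)"
      by (cases x; cases p) (auto simp: cbox_Pair_eq)
    then show "?f (p + x) = ennreal ((norm x)\<^sup>2 powr (\<gamma> - 1)) * indicator (cbox (-\<sigma>, -\<sigma>) (\<sigma>, \<sigma>)) x"
      by (simp add: indicator_def)
  qed
  finally show ?thesis
    using nn_integral_norm_powr_0[OF assms] by simp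
qed

text \<open>Logarithmic differentiation of a quotient of weighted sums: the last factor is the
  derivative of the logarithm of the inverse power
  \<open>((norm (x - P k))\<^sup>2) powr (- \<beta>)\<close>, and subtracting the mean
  \<open>shep \<beta> P q x\<close> accounts for the denominator.\<close>

definition shep_deriv :: "real \<Rightarrow> (nat \<Rightarrow> 'a::real_inner) \<Rightarrow> (nat \<Rightarrow> real) \<Rightarrow> 'a \<Rightarrow> 'a \<Rightarrow> real" where
  "shep_deriv \<beta> P q x h = (\<Sum>k<3. lam \<beta> P k x * (q k - shep \<beta> P q x) *
     (- 2 * \<beta> * ((x - P k) \<bullet> h) / (norm (x - P k))\<^sup>2))"

context shepard
begin

text \<open>The original inverse distance weight. Off the nodes it differs from \<open>wt\<close> by
  a factor independent of \<open>k\<close>, so it gives the same normalised weights and is easier to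
  differentiate.\<close>

definition vv :: "nat \<Rightarrow> 'a \<Rightarrow> real" where
  "vv k x = (norm (x - P k))\<^sup>2 powr (- \<beta>)"

lemma wt_eq_vv:
  assumes "\<And>j. j < 3 \<Longrightarrow> x \<noteq> P j" "k < 3"
  shows "wt \<beta> P k x = (\<Prod>j<3. (norm (x - P j))\<^sup>2) powr \<beta> * vv k x"
proof -
  let ?r = "\<lambda>j. (norm (x - P j))\<^sup>2"
  have r: "?r k > 0" using assms by auto
  have "(\<Prod>j<3. ?r j) powr \<beta> = ?r k powr \<beta> * wt \<beta> P k x"
    using assms(2) unfolding wt_def
    by (subst prod.remove[of _ k]) (auto simp: powr_mult prod_nonneg)
  moreover have "?r k powr \<beta> * vv k x = 1"
    using r by (simp add: vv_def powr_add[symmetric])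
  ultimately show ?thesis by (simp add: ac_simps)
qed

lemma lam_eq_vv:
  assumes "\<And>j. j < 3 \<Longrightarrow> x \<noteq> P j" "k < 3"
  shows "lam \<beta> P k x = vv k x / (\<Sum>j<3. vv j x)"
proof -
  define R where "R = (\<Prod>j<3. (norm (x - P j))\<^sup>2) powr \<beta>"
  have "(\<Prod>j<3. (norm (x - P j))\<^sup>2) > 0" using assms(1) by (intro prod_pos) auto
  then have "R \<noteq> 0" unfolding R_def by (metis less_irrefl powr_eq_0_iff)
  moreover have wt: "wt \<beta> P i x = R * vv i x" if "i < 3" for i
    unfolding R_def by (rule wt_eq_vv[OF assms(1) that])
  moreover have "(\<Sum>i<3. wt \<beta> P i x) = R * (\<Sum>j<3. vv j x)"
    unfolding sum_distrib_left by (intro sum.cong refl wt) auto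
  ultimately show ?thesis
    unfolding lam_def using assms(2) by simp
qed

lemma shep_eq_vv:
  assumes "\<And>j. j < 3 \<Longrightarrow> x \<noteq> P j"
  shows "shep \<beta> P q x = (\<Sum>k<3. q k * vv k x) / (\<Sum>j<3. vv j x)"
  unfolding shep_def sum_divide_distrib
  by (intro sum.cong refl) (simp add: lam_eq_vv[OF assms])

lemma has_derivative_vv:
  assumes "x \<noteq> P k"
  shows "(vv k has_derivative (\<lambda>h. vv k x * (- 2 * \<beta> * ((x - P k) \<bullet> h) / (norm (x - P k))\<^sup>2))) (at x)"
proof -
  let ?r = "(norm (x - P k))\<^sup>2"
  have r: "?r > 0" using assms by auto
  have "((\<lambda>x. (x - P k) \<bullet> (x - P k)) has_derivative (\<lambda>h. 2 * ((x - P k) \<bullet> h))) (at x)"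
    by (auto intro!: derivative_eq_intros simp: inner_commute)
  then have d: "((\<lambda>x. (norm (x - P k))\<^sup>2) has_derivative (\<lambda>h. 2 * ((x - P k) \<bullet> h))) (at x)"
    by (simp add: power2_norm_eq_inner)
  have "((\<lambda>t. t powr (- \<beta>)) has_derivative (*) (- \<beta> * ?r powr (- \<beta> - 1))) (at ?r)"
    using has_real_derivative_powr[OF r, of "- \<beta>"] by (simp add: has_field_derivative_def)
  from has_derivative_compose[OF d this]
  have "(vv k has_derivative (\<lambda>h. - \<beta> * ?r powr (- \<beta> - 1) * (2 * ((x - P k) \<bullet> h)))) (at x)"
    by (simp add: vv_def[abs_def])
  moreover have "?r powr (- \<beta> - 1) = vv k x / ?r"
    using r by (simp add: vv_def powr_diff)
  ultimately show ?thesis by (simp add: ac_simps)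
qed

lemma open_off_nodes: "open {x. \<forall>j<3. x \<noteq> P j}"
proof -
  have "{x. \<forall>j<3. x \<noteq> P j} = - P ` {..<3}" by auto
  then show ?thesis by (simp add: open_Compl finite_imp_closed)
qed

lemma shep_has_derivative:
  assumes "\<And>j. j < 3 \<Longrightarrow> x \<noteq> P j"
  shows "(shep \<beta> P q has_derivative shep_deriv \<beta> P q x) (at x)"
proof -
  let ?V = "\<lambda>x. \<Sum>j<3. vv j x" and ?Q = "\<lambda>x. \<Sum>k<3. q k * vv k x"
  let ?l = "\<lambda>k h. - 2 * \<beta> * ((x - P k) \<bullet> h) / (norm (x - P k))\<^sup>2"
  have V: "?V x > 0"
    using assms by (intro sum_pos) (auto simp: vv_def lessThan_empty_iff)
  have dV: "(?V has_derivative (\<lambda>h. \<Sum>k<3. vv k x * ?l k h)) (at x)"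
    using assms by (intro has_derivative_sum has_derivative_vv) auto
  have dQ: "(?Q has_derivative (\<lambda>h. \<Sum>k<3. q k * (vv k x * ?l k h))) (at x)"
    using assms by (intro has_derivative_sum has_derivative_mult_right has_derivative_vv) auto
  have "((\<lambda>x. ?Q x / ?V x) has_derivative
     (\<lambda>h. ((\<Sum>k<3. q k * (vv k x * ?l k h)) * ?V x - ?Q x * (\<Sum>k<3. vv k x * ?l k h)) / (?V x * ?V x))) (at x)"
    using V by (intro has_derivative_divide'[OF dQ dV]) auto
  also have "(\<lambda>h. ((\<Sum>k<3. q k * (vv k x * ?l k h)) * ?V x - ?Q x * (\<Sum>k<3. vv k x * ?l k h)) / (?V x * ?V x)) = shep_deriv \<beta> P q x"
  proof
    fix h
    have "((\<Sum>k<3. q k * (vv k x * ?l k h)) * ?V x - ?Q x * (\<Sum>k<3. vv k x * ?l k h)) / (?V x * ?V x)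
      = (\<Sum>k<3. q k * (vv k x * ?l k h)) / ?V x - (?Q x / ?V x) * ((\<Sum>k<3. vv k x * ?l k h) / ?V x)"
      using V by (simp add: diff_divide_distrib)
    also have "\<dots> = (\<Sum>k<3. vv k x / ?V x * (q k - ?Q x / ?V x) * ?l k h)"
      unfolding sum_divide_distrib[of _ _ "?V x"] sum_distrib_left sum_subtractf[symmetric]
      by (intro sum.cong refl) (simp add: algebra_simps)
    also have "\<dots> = shep_deriv \<beta> P q x h"
      unfolding shep_deriv_def by (intro sum.cong refl) (simp add: lam_eq_vv[OF assms] shep_eq_vv[OF assms, of q, symmetric])
    finally show "((\<Sum>k<3. q k * (vv k x * ?l k h)) * ?V x - ?Q x * (\<Sum>k<3. vv k x * ?l k h)) / (?V x * ?V x) = shep_deriv \<beta> P q x h" .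
  qed
  finally show ?thesis
    by (rule has_derivative_transform_within_open[OF _ open_off_nodes]) (use assms in \<open>auto simp: shep_eq_vv\<close>)
qed

lemma continuous_shep_deriv: "continuous_on {x. \<forall>j<3. x \<noteq> P j} (\<lambda>x. shep_deriv \<beta> P q x h)"
  unfolding shep_deriv_def lam_def
  by (intro continuous_intros continuous_wt continuous_shep) (use sum_wt_pos in \<open>auto simp: less_le\<close>)

text \<open>Closer than \<open>\<sigma> / 2\<close> to \<open>P i\<close> the other nodes are at
  distance at least \<open>\<sigma> / 2\<close>, so each of their weights is at most the stated
  power times that of \<open>i\<close>. Farther away the right side is at least 2. The gain near a
  node is what makes the singularity of the gradient square integrable.\<close>

lemma one_minus_lam_le:
  assumes i: "i < 3" and \<sigma>: "\<sigma> > 0" and sep: "\<And>i j. i < 3 \<Longrightarrow> j < 3 \<Longrightarrow> i \<noteq> j \<Longrightarrow> \<sigma> \<le> dist (P i) (P j)"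
  shows "1 - lam \<beta> P i x \<le> 2 * (4 * (norm (x - P i))\<^sup>2 / \<sigma>\<^sup>2) powr \<beta>"
proof (cases "norm (x - P i) \<ge> \<sigma> / 2")
  case True
  then have "(\<sigma> / 2)\<^sup>2 \<le> (norm (x - P i))\<^sup>2" using \<sigma> by (intro power_mono) auto
  then have "1 \<le> 4 * (norm (x - P i))\<^sup>2 / \<sigma>\<^sup>2"
    using \<sigma> by (simp add: field_simps power2_eq_square)
  then have "1 \<le> (4 * (norm (x - P i))\<^sup>2 / \<sigma>\<^sup>2) powr \<beta>"
    using \<beta> by (intro ge_one_powr_ge_zero) auto
  with lam_nonneg[of i x] show ?thesis by linarith
next
  case False
  let ?c = "(4 * (norm (x - P i))\<^sup>2 / \<sigma>\<^sup>2) powr \<beta>"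
  have le: "wt \<beta> P j x \<le> ?c * wt \<beta> P i x" if j: "j < 3" "j \<noteq> i" for j
  proof -
    obtain k where k: "k \<noteq> i" "k \<noteq> j" "{..<3} - {i} = {j, k}" "{..<3} - {j} = {i, k}"
      using third_index[OF i j(1)] j(2) by metis
    let ?r = "\<lambda>i. (norm (x - P i))\<^sup>2"
    have "\<sigma> \<le> norm (x - P i) + norm (x - P j)"
      using sep[OF i j(1)] j(2) dist_triangle3[of "P i" "P j" x] by (auto simp: dist_norm)
    with False have "\<sigma> / 2 \<le> norm (x - P j)" by linarith
    then have "(\<sigma> / 2)\<^sup>2 \<le> ?r j" using \<sigma> by (intro power_mono) auto
    then have "1 \<le> 4 * ?r j / \<sigma>\<^sup>2" using \<sigma> by (simp add: field_simps power2_eq_square)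
    from mult_left_mono[OF this, of "?r i"] have "?r i \<le> 4 * ?r i / \<sigma>\<^sup>2 * ?r j" by (simp add: ac_simps)
    then have "(?r i * ?r k) powr \<beta> \<le> (4 * ?r i / \<sigma>\<^sup>2 * (?r j * ?r k)) powr \<beta>"
      using \<beta> mult_right_mono[of "?r i" "4 * ?r i / \<sigma>\<^sup>2 * ?r j" "?r k"]
      by (intro powr_mono2) (auto simp: ac_simps)
    also have "\<dots> = ?c * (?r j * ?r k) powr \<beta>"
      by (rule powr_mult)
    finally show ?thesis using k by (simp add: wt_def)
  qed
  define W where "W = (\<Sum>j<3. wt \<beta> P j x)"
  have "W - wt \<beta> P i x \<le> 2 * ?c * wt \<beta> P i x"
    using i le[of 0] le[of 1] le[of 2] unfolding W_def sum_3 less_3 by auto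
  also have "\<dots> \<le> 2 * ?c * W"
    unfolding W_def using i by (intro mult_left_mono member_le_sum) (auto simp: wt_nonneg)
  finally have "W - wt \<beta> P i x \<le> 2 * ?c * W" .
  moreover have "W > 0" unfolding W_def by (rule sum_wt_pos)
  ultimately show ?thesis
    by (simp add: lam_def W_def[symmetric] field_simps)
qed

text \<open>Only the other nodes pull the interpolation away from \<open>q k\<close>, so
  \<open>\<bar>q k - shep \<beta> P q x\<bar> \<le> 1 - lam \<beta> P k x\<close>. With the bound on
  the latter, each summand is at most \<open>4 * \<beta>\<close> times a power over the distance;
  squaring gives 16, and three summands cost another factor 3.\<close>

lemma shep_deriv_square_le:
  assumes off: "\<And>j. j < 3 \<Longrightarrow> x \<noteq> P j"
    and q: "\<And>k. k < 3 \<Longrightarrow> 0 \<le> q k \<and> q k \<le> 1" and h: "norm h \<le> 1"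
    and \<sigma>: "\<sigma> > 0" and sep: "\<And>i j. i < 3 \<Longrightarrow> j < 3 \<Longrightarrow> i \<noteq> j \<Longrightarrow> \<sigma> \<le> dist (P i) (P j)"
  shows "(shep_deriv \<beta> P q x h)\<^sup>2 \<le> 48 * \<beta>\<^sup>2 * (4 / \<sigma>\<^sup>2) powr (2 * \<beta>) *
    (\<Sum>k<3. ((norm (x - P k))\<^sup>2) powr (2 * \<beta> - 1))"
proof -
  define n where "n k = norm (x - P k)" for k
  have n: "n k > 0" if "k < 3" for k using off[OF that] by (simp add: n_def)
  define a where "a k = 4 * \<beta> * (4 * (n k)\<^sup>2 / \<sigma>\<^sup>2) powr \<beta> / n k" for k
  have term_le: "\<bar>lam \<beta> P k x * (q k - shep \<beta> P q x) * (- 2 * \<beta> * ((x - P k) \<bullet> h) / (norm (x - P k))\<^sup>2)\<bar> \<le> a k"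
    if k: "k < 3" for k
  proof -
    have "\<bar>shep \<beta> P q x - q k\<bar> \<le> (\<Sum>j<3. \<bar>(q j - q k) * lam \<beta> P j x\<bar>)"
      unfolding shep_diff by (rule sum_abs)
    also have "\<dots> \<le> (\<Sum>j<3. lam \<beta> P j x - (if j = k then lam \<beta> P k x else 0))"
    proof (intro sum_mono)
      fix j :: nat assume "j \<in> {..<3}"
      then have "\<bar>q j - q k\<bar> * lam \<beta> P j x \<le> 1 * lam \<beta> P j x"
        using q[of j] q[OF k] lam_nonneg by (intro mult_right_mono) auto
      then show "\<bar>(q j - q k) * lam \<beta> P j x\<bar> \<le> lam \<beta> P j x - (if j = k then lam \<beta> P k x else 0)"
        using lam_nonneg[of j x] by (auto simp: abs_mult)
    qed
    also have "\<dots> = 1 - lam \<beta> P k x"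
      using k by (simp add: sum_subtractf lam_sum)
    also have "\<dots> \<le> 2 * (4 * (n k)\<^sup>2 / \<sigma>\<^sup>2) powr \<beta>"
      unfolding n_def by (rule one_minus_lam_le[OF k \<sigma> sep])
    finally have A: "\<bar>q k - shep \<beta> P q x\<bar> \<le> 2 * (4 * (n k)\<^sup>2 / \<sigma>\<^sup>2) powr \<beta>" by simp
    have "\<bar>(x - P k) \<bullet> h\<bar> \<le> n k * 1"
      unfolding n_def using Cauchy_Schwarz_ineq2[of "x - P k" h] h
      by (meson mult_left_mono norm_ge_zero order_trans)
    then have B: "\<bar>- 2 * \<beta> * ((x - P k) \<bullet> h) / (n k)\<^sup>2\<bar> \<le> 2 * \<beta> / n k"
      using n[OF k] \<beta> by (simp add: abs_mult field_simps power2_eq_square)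
    have "\<bar>lam \<beta> P k x * (q k - shep \<beta> P q x)\<bar> \<le> 1 * (2 * (4 * (n k)\<^sup>2 / \<sigma>\<^sup>2) powr \<beta>)"
      unfolding abs_mult using A lam_le_1[OF k, of x] lam_nonneg[of k x] by (intro mult_mono) auto
    then have "\<bar>lam \<beta> P k x * (q k - shep \<beta> P q x)\<bar> * \<bar>- 2 * \<beta> * ((x - P k) \<bullet> h) / (n k)\<^sup>2\<bar>
       \<le> (2 * (4 * (n k)\<^sup>2 / \<sigma>\<^sup>2) powr \<beta>) * (2 * \<beta> / n k)"
      using B by (intro mult_mono) auto
    then show ?thesis
      by (simp add: a_def n_def[symmetric] abs_mult ac_simps)
  qed
  have "\<bar>shep_deriv \<beta> P q x h\<bar> \<le> (\<Sum>k<3. a k)"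
    unfolding shep_deriv_def by (rule order_trans[OF sum_abs sum_mono]) (use term_le in auto)
  then have "\<bar>shep_deriv \<beta> P q x h\<bar> \<le> \<bar>a 0 + a 1 + a 2\<bar>"
    unfolding sum_3 by linarith
  then have "(shep_deriv \<beta> P q x h)\<^sup>2 \<le> (a 0 + a 1 + a 2)\<^sup>2"
    by (simp only: abs_le_square_iff)
  also have "\<dots> \<le> 3 * ((a 0)\<^sup>2 + (a 1)\<^sup>2 + (a 2)\<^sup>2)"
    using sum_squares_ge_zero[of "a 0 - a 1" "a 1 - a 2"] zero_le_power2[of "a 0 - a 2"]
    by (simp add: power2_eq_square algebra_simps)
  also have "\<dots> = 3 * (\<Sum>k<3. (a k)\<^sup>2)" by (simp add: sum_3)
  also have "(\<Sum>k<3. (a k)\<^sup>2) = (\<Sum>k<3. 16 * \<beta>\<^sup>2 * (4 / \<sigma>\<^sup>2) powr (2 * \<beta>) * ((n k)\<^sup>2) powr (2 * \<beta> - 1))"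
  proof (intro sum.cong refl)
    fix k :: nat assume "k \<in> {..<3}"
    then have nk: "n k > 0" using n by auto
    have "((4 * (n k)\<^sup>2 / \<sigma>\<^sup>2) powr \<beta>)\<^sup>2 = (4 / \<sigma>\<^sup>2 * (n k)\<^sup>2) powr (2 * \<beta>)"
      by (simp add: power2_eq_square powr_add[symmetric])
    also have "\<dots> = (4 / \<sigma>\<^sup>2) powr (2 * \<beta>) * ((n k)\<^sup>2) powr (2 * \<beta>)"
      by (rule powr_mult)
    also have "((n k)\<^sup>2) powr (2 * \<beta>) = ((n k)\<^sup>2) powr (2 * \<beta> - 1) * (n k)\<^sup>2"
      using nk by (simp add: powr_diff)
    finally have "((4 * (n k)\<^sup>2 / \<sigma>\<^sup>2) powr \<beta>)\<^sup>2 = (4 / \<sigma>\<^sup>2) powr (2 * \<beta>) * (((n k)\<^sup>2) powr (2 * \<beta> - 1) * (n k)\<^sup>2)" .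
    then show "(a k)\<^sup>2 = 16 * \<beta>\<^sup>2 * (4 / \<sigma>\<^sup>2) powr (2 * \<beta>) * ((n k)\<^sup>2) powr (2 * \<beta> - 1)"
      using nk by (simp add: a_def power_mult_distrib power_divide)
  qed
  finally show ?thesis
    by (simp add: n_def sum_distrib_left mult.assoc)
qed

lemma shep_cmult: "shep \<beta> P (\<lambda>k. c * q k) x = c * shep \<beta> P q x"
  by (simp add: shep_def sum_distrib_left mult.assoc)

lemma shep_le_weighted:
  assumes "\<And>k. k < 3 \<Longrightarrow> q k \<le> B" "l < 3" "1 / 4 \<le> lam \<beta> P l x"
  shows "shep \<beta> P q x \<le> B - (B - q l) / 4"
proof -
  have "shep \<beta> P q x - B = (\<Sum>k<3. (q k - B) * lam \<beta> P k x)"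
    by (rule shep_diff)
  also have "\<dots> \<le> (\<Sum>k<3. if k = l then (q l - B) * lam \<beta> P l x else 0)"
    using assms(1) lam_nonneg by (intro sum_mono) (auto intro!: mult_nonpos_nonneg)
  also have "\<dots> = (q l - B) * lam \<beta> P l x" using assms(2) by simp
  also have "\<dots> \<le> (q l - B) * (1 / 4)"
    using assms by (intro mult_left_mono_neg) auto
  finally show ?thesis by (simp add: field_simps)
qed

end

text \<open>Of the two factors \<open>\<beta>\<close> one is consumed by the integral of the
  singular power, and all powers of \<open>\<sigma>\<close> cancel, which is the scale invariance in
  the plane. What remains is \<open>288 * \<beta> * 16 powr \<beta>\<close>, where the last factor
  is at most 3/2.\<close>

lemma shepard_energy:
  fixes P :: "nat \<Rightarrow> real \<times> real"
  assumes "shepard \<beta> P" and A: "A \<in> sets lborel" and \<sigma>: "\<sigma> > 0"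
    and off: "\<And>x j. x \<in> A \<Longrightarrow> j < 3 \<Longrightarrow> x \<noteq> P j"
    and q: "\<And>k. k < 3 \<Longrightarrow> 0 \<le> q k \<and> q k \<le> 1" and h: "norm h \<le> 1"
    and sep: "\<And>i j. i < 3 \<Longrightarrow> j < 3 \<Longrightarrow> i \<noteq> j \<Longrightarrow> \<sigma> \<le> dist (P i) (P j)"
    and box: "\<And>k. k < 3 \<Longrightarrow> A \<subseteq> cbox (P k - (\<sigma>, \<sigma>)) (P k + (\<sigma>, \<sigma>))"
  shows "(\<integral>\<^sup>+x\<in>A. ennreal ((shep_deriv \<beta> P q x h)\<^sup>2) \<partial>lborel) \<le> ennreal (432 * \<beta>)"
proof -
  interpret shepard \<beta> P by fact
  define c where "c = 48 * \<beta>\<^sup>2 * (4 / \<sigma>\<^sup>2) powr (2 * \<beta>)"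
  have c: "c \<ge> 0" by (simp add: c_def)
  let ?g = "\<lambda>k x. ennreal (((norm (x - P k))\<^sup>2) powr (2 * \<beta> - 1)) * indicator (cbox (P k - (\<sigma>, \<sigma>)) (P k + (\<sigma>, \<sigma>))) x"
  have "(\<integral>\<^sup>+x\<in>A. ennreal ((shep_deriv \<beta> P q x h)\<^sup>2) \<partial>lborel) \<le> (\<integral>\<^sup>+x. ennreal c * (\<Sum>k<3. ?g k x) \<partial>lborel)"
  proof (intro nn_integral_mono)
    fix x :: "real \<times> real"
    show "ennreal ((shep_deriv \<beta> P q x h)\<^sup>2) * indicator A x \<le> ennreal c * (\<Sum>k<3. ?g k x)"
    proof (cases "x \<in> A")
      case True
      have "(\<Sum>k<3. ?g k x) = (\<Sum>k<3. ennreal (((norm (x - P k))\<^sup>2) powr (2 * \<beta> - 1)))"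
        using box[THEN subsetD, OF _ True] by (intro sum.cong) auto
      also have "\<dots> = ennreal (\<Sum>k<3. ((norm (x - P k))\<^sup>2) powr (2 * \<beta> - 1))"
        by (intro sum_ennreal) auto
      finally show ?thesis
        using True shep_deriv_square_le[of x q h \<sigma>, OF off[OF True] q h \<sigma> sep] c
        by (simp add: ennreal_mult''[symmetric] sum_nonneg c_def ennreal_leI)
    qed simp
  qed
  also have "\<dots> = ennreal c * (\<Sum>k<3. \<integral>\<^sup>+x. ?g k x \<partial>lborel)"
  proof -
    have g: "?g k \<in> borel_measurable lborel" for k by measurable
    show ?thesis
      by (subst nn_integral_cmult[OF borel_measurable_sum[OF g]], subst nn_integral_sum[OF g]) (rule refl)
  qed
  also have "\<dots> \<le> ennreal c * (\<Sum>k<3::nat. ennreal (4 * \<sigma> powr (2 * (2 * \<beta>)) / (2 * \<beta>)))"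
    using \<beta> \<sigma> by (intro mult_left_mono sum_mono nn_integral_norm_powr) auto
  also have "\<dots> = ennreal (c * (3 * (4 * \<sigma> powr (2 * (2 * \<beta>)) / (2 * \<beta>))))"
    using \<beta> c by (subst sum_ennreal) (auto simp: ennreal_mult''[symmetric])
  also have "c * (3 * (4 * \<sigma> powr (2 * (2 * \<beta>)) / (2 * \<beta>))) = 288 * \<beta> * ((4 / \<sigma>\<^sup>2) powr (2 * \<beta>) * \<sigma> powr (2 * (2 * \<beta>)))"
    using \<beta> by (simp add: c_def field_simps power2_eq_square)
  also have "\<sigma> powr (2 * (2 * \<beta>)) = (\<sigma>\<^sup>2) powr (2 * \<beta>)"
    using \<sigma> by (simp add: powr_powr[symmetric] powr_numeral)
  also have "(4 / \<sigma>\<^sup>2) powr (2 * \<beta>) * (\<sigma>\<^sup>2) powr (2 * \<beta>) = (4 powr 2) powr \<beta>"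
  proof -
    have "4 / \<sigma>\<^sup>2 * \<sigma>\<^sup>2 = 4" using \<sigma> by simp
    then show ?thesis by (simp only: powr_mult[symmetric] powr_powr)
  qed
  also have "288 * \<beta> * (4 powr 2) powr \<beta> \<le> 288 * \<beta> * (3 / 2)"
    using powr_16 \<beta> by (intro mult_left_mono) auto
  finally show ?thesis by (simp add: ennreal_leI)
qed

section \<open>The interpolated function and its continuity\<close>

locale gasket_fun =
  fixes F :: "real \<times> real \<Rightarrow> real" and \<beta> :: "nat \<Rightarrow> real"
  assumes F_cont: "continuous_on UNIV F" and F_bounds: "\<And>x. 0 \<le> F x" "\<And>x. F x \<le> 1"
    and \<beta>_bounds: "\<And>n. 0 < \<beta> n" "\<And>n. \<beta> n \<le> 1 / 10" and \<beta>_lim: "\<beta> \<longlonglongrightarrow> 0"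
begin

sublocale shepard "\<beta> n" "mid n a" for n a
proof
  show "mid n a i \<noteq> mid n a j" if "i < 3" "j < 3" "i \<noteq> j" for i j
    using dist_mid[OF that, of n a] by auto
qed (use \<beta>_bounds in auto)

text \<open>On \<open>stable n\<close>, the outside and the triangles removed below level \<open>n\<close>, \<open>approx n\<close> has its final values.\<close>

primrec approx :: "nat \<Rightarrow> real \<times> real \<Rightarrow> real" where
  "approx 0 = F"
| "approx (Suc n) = (\<lambda>x. if \<exists>a\<in>base n. x \<in> tri n a
     then let a = (THE a. a \<in> base n \<and> x \<in> tri n a) in shep (\<beta> n) (mid n a) (\<lambda>k. approx n (mid n a k)) x
     else approx n x)"

definition stable_all :: "(real \<times> real) set" where
  "stable_all = (\<Union>n. stable n)"

definition g :: "real \<times> real \<Rightarrow> real" where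
  "g x = approx (LEAST n. x \<in> stable n) x"

text \<open>Off \<open>stable_all\<close> this is the upper limit of \<open>g\<close> along the
  cells that contain the point, of which there is at most one per level. The cell bounds established
  below confine this value, and with it the continuity.\<close>

definition f :: "real \<times> real \<Rightarrow> real" where
  "f x = (if x \<in> stable_all then g x else Inf {Sup (g ` (stable_all \<inter> cell n a)) |n a. a \<in> base n \<and> x \<in> cell n a})"

lemma approx_tri:
  assumes "a \<in> base n" "x \<in> tri n a"
  shows "approx (Suc n) x = shep (\<beta> n) (mid n a) (\<lambda>k. approx n (mid n a k)) x"
proof -
  have "(THE b. b \<in> base n \<and> x \<in> tri n b) = a"
    using assms tri_other_cell tri_subset_cell by (intro the_equality) blast+
  with assms show ?thesis by (auto simp: Let_def)
qed

text \<open>The only stable points of a newly filled triangle are its nodes, where the interpolation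
  takes the prescribed values.\<close>

lemma approx_stable_step:
  assumes "x \<in> stable n"
  shows "approx (Suc n) x = approx n x"
proof (cases "\<exists>a\<in>base n. x \<in> tri n a")
  case True
  then obtain a where a: "a \<in> base n" "x \<in> tri n a" by blast
  with assms have "x \<in> bdry n a" using stable_cell_bdry tri_subset_cell by blast
  with a obtain k where "k < 3" "x = mid n a k" using tri_bdry_mid by metis
  then show ?thesis unfolding approx_tri[OF a] by (simp add: shep_node)
qed simp

lemma approx_stable:
  assumes "x \<in> stable n" "n \<le> m"
  shows "approx m x = approx n x"
  using assms(2)
proof (induction m rule: dec_induct)
  case (step m)
  then have "x \<in> stable m" using assms stable_mono by blast
  with step show ?case using approx_stable_step by simp
qed simp

lemma f_stable:
  assumes "x \<in> stable n"
  shows "f x = approx n x"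
proof -
  have "x \<in> stable (LEAST n. x \<in> stable n)" using assms by (rule LeastI)
  then show ?thesis
    using assms approx_stable[of x "LEAST n. x \<in> stable n" n] Least_le[of "\<lambda>n. x \<in> stable n" n]
    by (auto simp: f_def stable_all_def g_def)
qed

lemma f_stable_all: "x \<in> stable_all \<Longrightarrow> f x = g x"
  by (simp add: f_def)

lemma f_outside: "x \<in> stable 0 \<Longrightarrow> f x = F x"
  using f_stable[of x 0] by simp

lemma mid_stable: "a \<in> base n \<Longrightarrow> k < 3 \<Longrightarrow> mid n a k \<in> stable n"
  using bdry_subset_stable mid_bdry by blast

lemma tri_stable: "a \<in> base n \<Longrightarrow> tri n a \<subseteq> stable (Suc n)"
  by auto

lemma f_tri:
  assumes "a \<in> base n" "x \<in> tri n a"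
  shows "f x = shep (\<beta> n) (mid n a) (\<lambda>k. f (mid n a k)) x"
proof -
  have "x \<in> stable (Suc n)" using assms tri_stable by blast
  then have "f x = shep (\<beta> n) (mid n a) (\<lambda>k. approx n (mid n a k)) x"
    using f_stable approx_tri[OF assms] by metis
  also have "\<dots> = shep (\<beta> n) (mid n a) (\<lambda>k. f (mid n a k)) x"
    unfolding shep_def using f_stable[OF mid_stable[OF assms(1)]] by (intro sum.cong) auto
  finally show ?thesis .
qed

section \<open>Maximum principle on cells\<close>

lemma approx_bounds: "0 \<le> approx n x \<and> approx n x \<le> 1"
proof (induction n arbitrary: x)
  case (Suc n)
  then show ?case
  proof (cases "\<exists>a\<in>base n. x \<in> tri n a")
    case True
    then obtain a where a: "a \<in> base n" "x \<in> tri n a" by blast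
    show ?thesis unfolding approx_tri[OF a] using Suc by (intro conjI shep_ge shep_le) auto
  qed simp
qed (simp add: F_bounds)

lemma g_bounds: "0 \<le> g x" "g x \<le> 1"
  using approx_bounds by (auto simp: g_def)

text \<open>The oscillation is measured on the boundary of a cell only. Since interpolated values
  are convex combinations of boundary values, the bounds pass to children and finally to the whole
  cell, including its gasket points.\<close>

definition Bd :: "nat \<Rightarrow> real \<times> real \<Rightarrow> real \<Rightarrow> real \<Rightarrow> bool" where
  "Bd n a lo hi \<longleftrightarrow> (\<forall>x\<in>bdry n a. lo \<le> f x \<and> f x \<le> hi)"

lemma bdry_subset_stable_all: "a \<in> base n \<Longrightarrow> bdry n a \<subseteq> stable_all"
  unfolding stable_all_def using bdry_subset_stable by blast

lemma Bd_0_1: "a \<in> base n \<Longrightarrow> Bd n a 0 1"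
  using bdry_subset_stable_all[of a n] g_bounds by (auto simp: Bd_def f_stable_all subset_iff)

lemma Bd_tri:
  assumes "a \<in> base n" "Bd n a lo hi" "x \<in> tri n a"
  shows "lo \<le> f x \<and> f x \<le> hi"
  unfolding f_tri[OF assms(1,3)] using assms(2) mid_bdry
  by (intro conjI shep_ge shep_le) (auto simp: Bd_def)

lemma Bd_child:
  assumes "a \<in> base n" "Bd n a lo hi" "i < 3"
  shows "Bd (Suc n) (child n i a) lo hi"
  using child_bdry[OF assms(3)] Bd_tri[OF assms(1,2)] assms(2) unfolding Bd_def by blast

lemma child_base: "a \<in> base n \<Longrightarrow> i < 3 \<Longrightarrow> child n i a \<in> base (Suc n)"
  by auto

lemma Bd_descend:
  assumes "\<And>a. a \<in> base n \<Longrightarrow> \<exists>lo hi. hi - lo \<le> m \<and> Bd n a lo hi" "n \<le> n'" "a \<in> base n'"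
  shows "\<exists>lo hi. hi - lo \<le> m \<and> Bd n' a lo hi"
  using assms(2,3)
proof (induction n' arbitrary: a rule: dec_induct)
  case base
  with assms(1) show ?case by blast
next
  case (step n')
  from step.prems obtain c i where "c \<in> base n'" "i < 3" "a = child n' i c" by auto
  with step.IH[of c] Bd_child show ?case by blast
qed

lemma Bd_cell_stable:
  assumes "a \<in> base n" "Bd n a lo hi" "x \<in> cell n a" "x \<in> stable (n + k)"
  shows "lo \<le> f x \<and> f x \<le> hi"
  using assms
proof (induction k arbitrary: n a)
  case 0
  then show ?case using stable_cell_bdry by (auto simp: Bd_def)
next
  case (Suc k)
  from cell_cover[OF Suc.prems(3)] show ?case
  proof
    assume "x \<in> tri n a"
    then show ?thesis using Bd_tri Suc.prems by blast
  next
    assume "\<exists>i<3. x \<in> cell (Suc n) (child n i a)"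
    then obtain i where i: "i < 3" "x \<in> cell (Suc n) (child n i a)" by blast
    from Suc.IH[OF child_base[OF Suc.prems(1) i(1)] Bd_child[OF Suc.prems(1,2) i(1)] i(2)] Suc.prems(4)
    show ?thesis by simp
  qed
qed

lemma Bd_cell_stable_all:
  assumes "a \<in> base n" "Bd n a lo hi" "x \<in> cell n a" "x \<in> stable_all"
  shows "lo \<le> f x \<and> f x \<le> hi"
proof -
  from assms(4) obtain m where "x \<in> stable m" by (auto simp: stable_all_def)
  then have "x \<in> stable (n + m)" using stable_mono[of m "n + m"] by auto
  with Bd_cell_stable assms show ?thesis by blast
qed

lemma unique_cell:
  assumes "a \<in> base n" "b \<in> base n" "x \<in> cell n a" "x \<in> cell n b" "x \<notin> stable_all"
  shows "a = b"
proof (rule ccontr)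
  assume "a \<noteq> b"
  from distinct_cells_vertex[OF assms(1,2) this assms(3,4)] vertex_bdry[OF assms(3)]
  have "x \<in> bdry n a" by blast
  with bdry_subset_stable_all[OF assms(1)] assms(5) show False by blast
qed

text \<open>For a point off \<open>stable_all\<close>, any other cell around it is nested with the
  given one, because the ancestor on the coarser level is unique. The smaller of the two contains a
  stable midpoint, and there \<open>g\<close> is at least \<open>lo\<close>, so every supremum in
  the definition of \<open>f\<close> is at least \<open>lo\<close>.\<close>

lemma Bd_cell:
  assumes a: "a \<in> base n" and Bd: "Bd n a lo hi" and x: "x \<in> cell n a"
  shows "lo \<le> f x \<and> f x \<le> hi"
proof (cases "x \<in> stable_all")
  case True
  with Bd_cell_stable_all assms show ?thesis by blast
next
  case False
  let ?A = "{Sup (g ` (stable_all \<inter> cell n a)) |n a. a \<in> base n \<and> x \<in> cell n a}"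
  have bdd: "bdd_above (g ` X)" for X
    using g_bounds by (intro bdd_aboveI[of _ 1]) auto
  have fx: "f x = Inf ?A" using False by (simp add: f_def)
  have lower: "lo \<le> y" if "y \<in> ?A" for y
  proof -
    from that obtain m b where b: "y = Sup (g ` (stable_all \<inter> cell m b))" "b \<in> base m" "x \<in> cell m b" by blast
    have "\<exists>z. z \<in> stable_all \<and> z \<in> cell n a \<and> z \<in> cell m b"
    proof (cases "n \<le> m")
      case True
      obtain a0 where a0: "a0 \<in> base n" "cell m b \<subseteq> cell n a0"
        using base_ancestor[OF True b(2)] .
      with unique_cell[OF a0(1) a _ x False] b have "a0 = a" by blast
      moreover have "mid m b 0 \<in> bdry m b" by (rule mid_bdry) simp
      ultimately show ?thesis
        using a0 bdry_subset_stable_all[OF b(2)] bdry_subset_cell[of m b] by blast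
    next
      case le: False
      obtain b0 where b0: "b0 \<in> base m" "cell n a \<subseteq> cell m b0"
        using base_ancestor[OF _ a, of m] le by auto
      with unique_cell[OF b0(1) b(2) _ b(3) False] x have "b0 = b" by blast
      moreover have "mid n a 0 \<in> bdry n a" by (rule mid_bdry) simp
      ultimately show ?thesis
        using b0 bdry_subset_stable_all[OF a] bdry_subset_cell[of n a] by blast
    qed
    then obtain z where z: "z \<in> stable_all" "z \<in> cell n a" "z \<in> cell m b" by blast
    have "lo \<le> g z" using Bd_cell_stable_all[OF a Bd z(2,1)] z(1) by (simp add: f_stable_all)
    also have "g z \<le> y" unfolding b(1) using z by (intro cSUP_upper bdd) auto
    finally show ?thesis .
  qed
  have mem: "Sup (g ` (stable_all \<inter> cell n a)) \<in> ?A" using a x by blast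
  have "mid n a 0 \<in> stable_all \<inter> cell n a"
    using mid_bdry[of 0 n a] bdry_subset_stable_all[OF a] by (auto simp: bdry_def)
  then have "Sup (g ` (stable_all \<inter> cell n a)) \<le> hi"
    using Bd_cell_stable_all[OF a Bd] by (intro cSUP_least) (auto simp: f_stable_all[symmetric])
  moreover have "Inf ?A \<le> Sup (g ` (stable_all \<inter> cell n a))"
    by (rule cInf_lower[OF mem bdd_belowI]) (rule lower)
  moreover have "lo \<le> Inf ?A"
    by (rule cInf_greatest) (use mem in blast, rule lower)
  ultimately show ?thesis using fx by linarith
qed

lemma f_bounds: "0 \<le> f x" "f x \<le> 1"
proof -
  have "0 \<le> f x \<and> f x \<le> 1"
  proof (cases "x \<in> stable 0")
    case True
    then show ?thesis using F_bounds f_outside by simp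
  next
    case False
    then have "x \<in> cell 0 0" using stable_cover[of x 0] by simp
    then show ?thesis using Bd_cell[OF _ Bd_0_1[of 0 0]] by simp
  qed
  then show "0 \<le> f x" "f x \<le> 1" by auto
qed

lemma continuous_on_tri: "a \<in> base n \<Longrightarrow> continuous_on (tri n a) f"
  by (rule continuous_on_eq[OF continuous_shep f_tri[symmetric]]) auto

lemma continuous_on_stable: "continuous_on (stable n) f"
proof (induction n)
  case 0
  show ?case
    by (rule continuous_on_eq[OF continuous_on_subset[OF F_cont] f_outside[symmetric]]) auto
next
  case (Suc n)
  have "continuous_on (\<Union>a\<in>base n. tri n a) f"
    using finite_base closed_tri continuous_on_tri by (intro continuous_on_closed_Union) auto
  with Suc show ?case
    unfolding stable.simps using finite_base closed_tri closed_stable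
    by (intro continuous_on_closed_Un) auto
qed

section \<open>Interpolated values along edges\<close>

lemma segment_dist_third:
  fixes n a
  assumes "i < 3" "j < 3" "k < 3" "i \<noteq> j" "i \<noteq> k" "j \<noteq> k" "0 \<le> t" "t \<le> 1"
  defines "x \<equiv> (1 - t) *\<^sub>R mid n a j + t *\<^sub>R mid n a k"
  shows "norm (x - mid n a j) = t * (sz n / 2)" "norm (x - mid n a k) = (1 - t) * (sz n / 2)"
    "sz n / 4 \<le> norm (x - mid n a i)" "norm (x - mid n a i) \<le> sz n / 2"
proof -
  have d: "norm (mid n a j - mid n a k) = sz n / 2" "norm (mid n a i - mid n a j) = sz n / 2"
      "norm (mid n a j - mid n a i) = sz n / 2" "norm (mid n a k - mid n a i) = sz n / 2"
    using dist_mid assms by (auto simp: dist_norm[symmetric])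
  have "x - mid n a j = (- t) *\<^sub>R (mid n a j - mid n a k)"
    by (simp add: x_def algebra_simps)
  then show 1: "norm (x - mid n a j) = t * (sz n / 2)"
    using d assms by simp
  have "x - mid n a k = (1 - t) *\<^sub>R (mid n a j - mid n a k)"
    by (simp add: x_def algebra_simps)
  then show 2: "norm (x - mid n a k) = (1 - t) * (sz n / 2)"
    using d assms by simp
  have "sz n / 2 \<le> norm (x - mid n a j) + norm (x - mid n a i)" "sz n / 2 \<le> norm (x - mid n a k) + norm (x - mid n a i)"
    using d norm_triangle_ineq4[of "x - mid n a i" "x - mid n a j"] norm_triangle_ineq4[of "x - mid n a i" "x - mid n a k"]
    by auto
  then have "2 * (sz n / 2) \<le> t * (sz n / 2) + (1 - t) * (sz n / 2) + 2 * norm (x - mid n a i)"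
    using 1 2 by linarith
  moreover have "t * (sz n / 2) + (1 - t) * (sz n / 2) = sz n / 2"
    by (simp only: distrib_right[symmetric]) simp
  ultimately show "sz n / 4 \<le> norm (x - mid n a i)"
    by linarith
  have "x - mid n a i = (1 - t) *\<^sub>R (mid n a j - mid n a i) + t *\<^sub>R (mid n a k - mid n a i)"
    by (simp add: x_def algebra_simps)
  then have "norm (x - mid n a i) \<le> norm ((1 - t) *\<^sub>R (mid n a j - mid n a i)) + norm (t *\<^sub>R (mid n a k - mid n a i))"
    using norm_triangle_ineq by metis
  also have "norm ((1 - t) *\<^sub>R (mid n a j - mid n a i)) = (1 - t) * (sz n / 2)"
    using d(3) assms by simp
  also have "norm (t *\<^sub>R (mid n a k - mid n a i)) = t * (sz n / 2)"
    using d(4) assms by simp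
  also have "(1 - t) * (sz n / 2) + t * (sz n / 2) = sz n / 2"
    by (simp only: distrib_right[symmetric]) simp
  finally show "norm (x - mid n a i) \<le> sz n / 2" .
qed

lemma lam_segment:
  assumes "i < 3" "j < 3" "k < 3" "i \<noteq> j" "i \<noteq> k" "j \<noteq> k" "0 \<le> t" "t \<le> 1 / 2"
  shows "1 / 4 \<le> lam (\<beta> n) (mid n a) j ((1 - t) *\<^sub>R mid n a j + t *\<^sub>R mid n a k)"
proof (rule lam_ge[OF assms(2)])
  fix l :: nat assume "l < 3"
  then have "l = i \<or> l = j \<or> l = k" using assms(1-6) by (auto simp: less_3)
  have t: "0 \<le> t" "t \<le> 1" using assms by auto
  note d = segment_dist_third[OF assms(1-6) t, of n a]
  have "t * (sz n / 2) \<le> (1 - t) * (sz n / 2)" "t * (sz n / 2) \<le> 1 / 2 * (sz n / 2)"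
    using assms by (intro mult_right_mono; simp)+
  moreover have "0 \<le> t * (sz n / 2)" using t by simp
  ultimately have "norm ((1 - t) *\<^sub>R mid n a j + t *\<^sub>R mid n a k - mid n a j) \<le>
      4 * norm ((1 - t) *\<^sub>R mid n a j + t *\<^sub>R mid n a k - mid n a i)"
    "norm ((1 - t) *\<^sub>R mid n a j + t *\<^sub>R mid n a k - mid n a j) \<le>
      4 * norm ((1 - t) *\<^sub>R mid n a j + t *\<^sub>R mid n a k - mid n a k)"
    "norm ((1 - t) *\<^sub>R mid n a j + t *\<^sub>R mid n a k - mid n a j) \<le>
      4 * norm ((1 - t) *\<^sub>R mid n a j + t *\<^sub>R mid n a k - mid n a j)"
    using d by linarith+
  then show "norm ((1 - t) *\<^sub>R mid n a j + t *\<^sub>R mid n a k - mid n a j) \<le>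
      4 * norm ((1 - t) *\<^sub>R mid n a j + t *\<^sub>R mid n a k - mid n a l)"
    using \<open>l = i \<or> l = j \<or> l = k\<close> by blast
qed

lemma ept_in_tri:
  assumes "i < 3" "j < 3" "k < 3" "i \<noteq> j" "i \<noteq> k" "j \<noteq> k" "0 \<le> t" "t \<le> 1"
  shows "(1 - t) *\<^sub>R mid n a k + t *\<^sub>R mid n a j \<in> tri n a"
  using convexD[OF convex_tri mid_tri[of k n a] mid_tri[of j n a], of "1 - t" t] assms by auto

lemma ept_stable: "a \<in> base n \<Longrightarrow> i < 3 \<Longrightarrow> j < 3 \<Longrightarrow> i \<noteq> j \<Longrightarrow> 0 \<le> t \<Longrightarrow> t \<le> 1 \<Longrightarrow> ept n a i j t \<in> stable n"
  using ept_bdry bdry_subset_stable by blast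

text \<open>Values are compared on the middle half of every short subsegment from \<open>t\<close>
  to \<open>u\<close>. Quantifying over subsegments makes the property hereditary, since an old edge
  of a child is half an edge of the parent. Staying away from the ends keeps the distances to a node
  at an end comparable.\<close>

definition slow_edge :: "real \<Rightarrow> real \<Rightarrow> nat \<Rightarrow> real \<times> real \<Rightarrow> nat \<Rightarrow> nat \<Rightarrow> bool" where
  "slow_edge \<delta> \<epsilon> n a i j \<longleftrightarrow> (\<forall>t u \<theta> \<kappa>. t \<in> {0..1} \<longrightarrow> u \<in> {0..1} \<longrightarrow> \<bar>t - u\<bar> * sz n < \<delta> \<longrightarrow>
     \<theta> \<in> {1/4..3/4} \<longrightarrow> \<kappa> \<in> {1/4..3/4} \<longrightarrow>
     \<bar>f (ept n a i j ((1 - \<theta>) * t + \<theta> * u)) - f (ept n a i j ((1 - \<kappa>) * t + \<kappa> * u))\<bar> \<le> \<epsilon>)"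

lemma slow_edge_sym: "slow_edge \<delta> \<epsilon> n a i j \<Longrightarrow> slow_edge \<delta> \<epsilon> n a j i"
  unfolding slow_edge_def
proof (intro allI impI)
  fix t u \<theta> \<kappa> :: real
  assume *: "\<forall>t u \<theta> \<kappa>. t \<in> {0..1} \<longrightarrow> u \<in> {0..1} \<longrightarrow> \<bar>t - u\<bar> * sz n < \<delta> \<longrightarrow>
     \<theta> \<in> {1/4..3/4} \<longrightarrow> \<kappa> \<in> {1/4..3/4} \<longrightarrow>
     \<bar>f (ept n a i j ((1 - \<theta>) * t + \<theta> * u)) - f (ept n a i j ((1 - \<kappa>) * t + \<kappa> * u))\<bar> \<le> \<epsilon>"
    and t: "t \<in> {0..1}" "u \<in> {0..1}" "\<bar>t - u\<bar> * sz n < \<delta>" "\<theta> \<in> {1/4..3/4}" "\<kappa> \<in> {1/4..3/4}"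
  have eq: "ept n a j i ((1 - \<theta>) * t + \<theta> * u) = ept n a i j ((1 - \<theta>) * (1 - t) + \<theta> * (1 - u))" for \<theta>
    unfolding ept_sym[of n a j i] by (rule arg_cong[where f = "ept n a i j"]) (simp add: algebra_simps)
  show "\<bar>f (ept n a j i ((1 - \<theta>) * t + \<theta> * u)) - f (ept n a j i ((1 - \<kappa>) * t + \<kappa> * u))\<bar> \<le> \<epsilon>"
    unfolding eq by (rule *[rule_format]) (use t in \<open>auto simp: abs_minus_commute\<close>)
qed

lemma slow_edge_near:
  assumes "slow_edge \<delta> \<epsilon> n a i k"
  shows "slow_edge \<delta> \<epsilon> (Suc n) (child n i a) i k"
  unfolding slow_edge_def
proof (intro allI impI)
  fix t u \<theta> \<kappa> :: real
  assume t: "t \<in> {0..1}" "u \<in> {0..1}" "\<bar>t - u\<bar> * sz (Suc n) < \<delta>" "\<theta> \<in> {1/4..3/4}" "\<kappa> \<in> {1/4..3/4}"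
  have eq: "ept (Suc n) (child n i a) i k ((1 - \<theta>) * t + \<theta> * u) = ept n a i k ((1 - \<theta>) * (t / 2) + \<theta> * (u / 2))" for \<theta>
    unfolding ept_child_near by (simp add: add_divide_distrib)
  have "\<bar>t / 2 - u / 2\<bar> * sz n = \<bar>t - u\<bar> * sz (Suc n)"
    by (simp add: sz_Suc diff_divide_distrib[symmetric])
  then show "\<bar>f (ept (Suc n) (child n i a) i k ((1 - \<theta>) * t + \<theta> * u)) -
      f (ept (Suc n) (child n i a) i k ((1 - \<kappa>) * t + \<kappa> * u))\<bar> \<le> \<epsilon>"
    unfolding eq using t by (intro assms[unfolded slow_edge_def, rule_format]) auto
qed

text \<open>For parameters in the middle half of a subsegment, the distances to the two nodes ending
  the edge agree up to a factor 4, and the distance to the third node lies between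
  \<open>sz n / 4\<close> and \<open>sz n / 2\<close>. So slow variation of the interpolation
  applies.\<close>

lemma slow_edge_fresh:
  assumes a: "a \<in> base n" and ijk: "i < 3" "j < 3" "k < 3" "i \<noteq> j" "i \<noteq> k" "j \<noteq> k"
    and \<epsilon>: "3 * (65536 powr \<beta> n - 1) \<le> \<epsilon>"
  shows "slow_edge \<delta> \<epsilon> (Suc n) (child n i a) j k"
  unfolding slow_edge_def
proof (intro allI impI)
  fix t u \<theta> \<kappa> :: real
  assume t: "t \<in> {0..1}" "u \<in> {0..1}" "\<theta> \<in> {1/4..3/4}" "\<kappa> \<in> {1/4..3/4}"
  define p where "p \<theta> = (1 - \<theta>) * t + \<theta> * u" for \<theta>
  have p01: "0 \<le> p \<theta>" "p \<theta> \<le> 1" if "\<theta> \<in> {1/4..3/4}" for \<theta>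
    using that t convex_bound_le[of t 1 u "1 - \<theta>" \<theta>] by (auto simp: p_def)
  have p3: "p \<theta> \<le> 4 * p \<kappa>" "1 - p \<theta> \<le> 4 * (1 - p \<kappa>)"
    if "\<theta> \<in> {1/4..3/4}" "\<kappa> \<in> {1/4..3/4}" for \<theta> \<kappa>
  proof -
    have *: "1 - \<theta> \<le> 4 * (1 - \<kappa>)" "\<theta> \<le> 4 * \<kappa>" using that by auto
    have "(1 - \<theta>) * t + \<theta> * u \<le> 4 * (1 - \<kappa>) * t + 4 * \<kappa> * u"
      using * t by (intro add_mono mult_right_mono) auto
    then show "p \<theta> \<le> 4 * p \<kappa>" by (simp add: p_def algebra_simps)
    have "(1 - \<theta>) * (1 - t) + \<theta> * (1 - u) \<le> 4 * (1 - \<kappa>) * (1 - t) + 4 * \<kappa> * (1 - u)"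
      using * t by (intro add_mono mult_right_mono) auto
    then show "1 - p \<theta> \<le> 4 * (1 - p \<kappa>)" by (simp add: p_def algebra_simps)
  qed
  define x where "x \<theta> = (1 - p \<theta>) *\<^sub>R mid n a k + p \<theta> *\<^sub>R mid n a j" for \<theta>
  have ept: "ept (Suc n) (child n i a) j k (p \<theta>) = x \<theta>" for \<theta>
    unfolding ept_child_fresh[OF ijk] x_def ..
  have ikj: "i < 3" "k < 3" "j < 3" "i \<noteq> k" "i \<noteq> j" "k \<noteq> j" using ijk by auto
  have comp: "norm (x \<theta> - mid n a l) \<le> 4 * norm (x \<kappa> - mid n a l)"
    if "l < 3" "\<theta> \<in> {1/4..3/4}" "\<kappa> \<in> {1/4..3/4}" for l \<theta> \<kappa>
  proof -
    have l: "l = i \<or> l = j \<or> l = k" using that(1) ijk by (auto simp: less_3)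
    note d1 = segment_dist_third[OF ikj p01[OF that(2)], of n a, folded x_def]
    note d2 = segment_dist_third[OF ikj p01[OF that(3)], of n a, folded x_def]
    have "p \<theta> * (sz n / 2) \<le> 4 * p \<kappa> * (sz n / 2)" "(1 - p \<theta>) * (sz n / 2) \<le> 4 * (1 - p \<kappa>) * (sz n / 2)"
      using p3[OF that(2,3)] by (intro mult_right_mono; simp)+
    then have "norm (x \<theta> - mid n a k) \<le> 4 * norm (x \<kappa> - mid n a k)"
      "norm (x \<theta> - mid n a j) \<le> 4 * norm (x \<kappa> - mid n a j)"
      "norm (x \<theta> - mid n a i) \<le> 4 * norm (x \<kappa> - mid n a i)"
      using d1 d2 sz_pos(2)[of n] by linarith+
    with l show ?thesis by blast
  qed
  have xt: "x \<theta> \<in> tri n a" if "\<theta> \<in> {1/4..3/4}" for \<theta>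
    unfolding x_def using p01[OF that] by (intro ept_in_tri[OF ijk])
  have "\<bar>f (x \<theta>) - f (x \<kappa>)\<bar> \<le> 3 * (65536 powr \<beta> n - 1)"
    unfolding f_tri[OF a xt[OF t(3)]] f_tri[OF a xt[OF t(4)]]
    using comp t f_bounds by (intro shep_slow) auto
  with \<epsilon> show "\<bar>f (ept (Suc n) (child n i a) j k ((1 - \<theta>) * t + \<theta> * u)) -
      f (ept (Suc n) (child n i a) j k ((1 - \<kappa>) * t + \<kappa> * u))\<bar> \<le> \<epsilon>"
    unfolding p_def[symmetric] ept by linarith
qed

lemma slow_edge_child:
  assumes "a \<in> base n" "i < 3" "\<And>j k. j < 3 \<Longrightarrow> k < 3 \<Longrightarrow> j \<noteq> k \<Longrightarrow> slow_edge \<delta> \<epsilon> n a j k"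
    and "3 * (65536 powr \<beta> n - 1) \<le> \<epsilon>" and "j < 3" "k < 3" "j \<noteq> k"
  shows "slow_edge \<delta> \<epsilon> (Suc n) (child n i a) j k"
proof -
  consider "i = j" | "i = k" | "i \<noteq> j" "i \<noteq> k" by blast
  then show ?thesis
  proof cases
    case 1
    with assms show ?thesis by (auto intro: slow_edge_near)
  next
    case 2
    with assms show ?thesis by (auto intro: slow_edge_sym slow_edge_near)
  next
    case 3
    with assms show ?thesis by (intro slow_edge_fresh) auto
  qed
qed

text \<open>Edges of deep cells lie either on one of the finitely many edges of some level \<open>I\<close>, where
  uniform continuity applies, or on an edge of an interpolated triangle with small exponent.\<close>

lemma edge_middle_small:
  assumes "\<epsilon> > 0"
  obtains N where "\<And>n a i j \<theta> \<kappa>. N \<le> n \<Longrightarrow> a \<in> base n \<Longrightarrow> i < 3 \<Longrightarrow> j < 3 \<Longrightarrow> i \<noteq> j \<Longrightarrow>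
    \<theta> \<in> {1/4..3/4} \<Longrightarrow> \<kappa> \<in> {1/4..3/4} \<Longrightarrow> \<bar>f (ept n a i j \<theta>) - f (ept n a i j \<kappa>)\<bar> \<le> \<epsilon>"
proof -
  have "(\<lambda>n. 3 * (65536 powr \<beta> n - 1)) \<longlonglongrightarrow> 3 * (65536 powr 0 - 1)"
    by (intro tendsto_intros \<beta>_lim) auto
  then have "\<forall>\<^sub>F n in sequentially. 3 * (65536 powr \<beta> n - 1) < \<epsilon>"
    using assms by (intro order_tendstoD) auto
  then obtain I where I: "\<And>n. n \<ge> I \<Longrightarrow> 3 * (65536 powr \<beta> n - 1) \<le> \<epsilon>"
    by (auto simp: eventually_sequentially intro: less_imp_le)
  let ?K = "stable I \<inter> cell 0 0"
  have "bounded (cell 0 0)" using bounded_subset[OF bounded_cbox cell_subset_cbox] .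
  then have "compact ?K"
    by (intro closed_Int_compact closed_stable) (simp add: compact_eq_bounded_closed closed_cell)
  then have "uniformly_continuous_on ?K f"
    using continuous_on_stable by (intro compact_uniformly_continuous continuous_on_subset[OF continuous_on_stable]) auto
  then obtain \<delta> where \<delta>: "\<delta> > 0" "\<And>x y. x \<in> ?K \<Longrightarrow> y \<in> ?K \<Longrightarrow> dist y x < \<delta> \<Longrightarrow> dist (f y) (f x) < \<epsilon>"
    using assms unfolding uniformly_continuous_on_def by metis
  have slow: "slow_edge \<delta> \<epsilon> n a i j" if "I \<le> n" "a \<in> base n" "i < 3" "j < 3" "i \<noteq> j" for n a i j
    using that
  proof (induction n arbitrary: a i j rule: dec_induct)
    case base
    obtain b where b: "b \<in> base 0" "cell I a \<subseteq> cell 0 b"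
      using base_ancestor[OF _ base(1), of 0] by auto
    have mem: "ept I a i j t \<in> ?K" if "0 \<le> t" "t \<le> 1" for t
    proof -
      have "b = 0" using b(1) by simp
      then show ?thesis
        using ept_bdry[OF base(2-4) that, of I a] bdry_subset_stable[OF base(1)] bdry_subset_cell[of I a] b(2)
        by blast
    qed
    show ?case
      unfolding slow_edge_def
    proof (intro allI impI)
      fix t u \<theta> \<kappa> :: real
      assume t: "t \<in> {0..1}" "u \<in> {0..1}" "\<bar>t - u\<bar> * sz I < \<delta>" "\<theta> \<in> {1/4..3/4}" "\<kappa> \<in> {1/4..3/4}"
      have p01: "0 \<le> (1 - \<theta>) * t + \<theta> * u" "(1 - \<theta>) * t + \<theta> * u \<le> 1" if "\<theta> \<in> {1/4..3/4}" for \<theta>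
        using that t convex_bound_le[of t 1 u "1 - \<theta>" \<theta>] by auto
      have "((1 - \<theta>) * t + \<theta> * u) - ((1 - \<kappa>) * t + \<kappa> * u) = (\<kappa> - \<theta>) * (t - u)"
        by (simp add: algebra_simps)
      then have "\<bar>((1 - \<theta>) * t + \<theta> * u) - ((1 - \<kappa>) * t + \<kappa> * u)\<bar> \<le> 1 * \<bar>t - u\<bar>"
        using t by (simp only: abs_mult) (intro mult_right_mono, auto)
      then have "\<bar>((1 - \<theta>) * t + \<theta> * u) - ((1 - \<kappa>) * t + \<kappa> * u)\<bar> * sz I \<le> \<bar>t - u\<bar> * sz I"
        by (intro mult_right_mono) auto
      with t(3) have "dist (ept I a i j ((1 - \<theta>) * t + \<theta> * u)) (ept I a i j ((1 - \<kappa>) * t + \<kappa> * u)) < \<delta>"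
        unfolding dist_ept[OF base(2-4)] by linarith
      from \<delta>(2)[OF mem mem this] p01 t(4,5)
      show "\<bar>f (ept I a i j ((1 - \<theta>) * t + \<theta> * u)) - f (ept I a i j ((1 - \<kappa>) * t + \<kappa> * u))\<bar> \<le> \<epsilon>"
        by (auto simp: dist_real_def)
    qed
  next
    case (step n)
    from step.prems(1) obtain c l where c: "c \<in> base n" "l < 3" "a = child n l c" by auto
    show ?case
      unfolding c(3) using step.IH[OF c(1)] c I[OF step.hyps(1)] step.prems by (intro slow_edge_child) auto
  qed
  have "sz \<longlonglongrightarrow> 0"
    unfolding sz_def[abs_def] using LIMSEQ_power_zero[of "1 / 2 :: real"] by (simp add: power_one_over)
  then have "\<forall>\<^sub>F n in sequentially. sz n < \<delta>"
    using \<delta>(1) by (rule order_tendstoD)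
  then obtain N where N: "\<And>n. n \<ge> N \<Longrightarrow> sz n < \<delta>" by (auto simp: eventually_sequentially)
  show thesis
  proof (rule that[of "max I N"])
    fix n i j :: nat and a and \<theta> \<kappa> :: real
    assume *: "max I N \<le> n" "a \<in> base n" "i < 3" "j < 3" "i \<noteq> j" "\<theta> \<in> {1/4..3/4}" "\<kappa> \<in> {1/4..3/4}"
    with slow[of n a i j] have "slow_edge \<delta> \<epsilon> n a i j" by auto
    \<comment> \<open>At this level a whole edge is shorter than \<open>\<delta>\<close> and is
      itself an admissible subsegment.\<close>
    from this[unfolded slow_edge_def, rule_format, of 0 1 \<theta> \<kappa>] * N[of n]
    show "\<bar>f (ept n a i j \<theta>) - f (ept n a i j \<kappa>)\<bar> \<le> \<epsilon>" by auto
  qed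
qed

lemma f_tri_weighted:
  assumes "a \<in> base n" "x \<in> tri n a" "\<And>k. k < 3 \<Longrightarrow> c * f (mid n a k) \<le> B"
    "l < 3" "1 / 4 \<le> lam (\<beta> n) (mid n a) l x"
  shows "c * f x \<le> B - (B - c * f (mid n a l)) / 4"
  unfolding f_tri[OF assms(1,2)] shep_cmult[symmetric]
  using assms(3-5) by (intro shep_le_weighted) auto

text \<open>The middle of an edge of a cell is the vertex shared by all three edges of the grandchild
  obtained by changing direction once. On each of them the values carry weight at least
  \<open>1/16\<close> of the value at that vertex, up to \<open>\<epsilon>\<close>.\<close>

lemma switch_one_sided:
  assumes a: "a \<in> base n" and ijk: "i < 3" "j < 3" "k < 3" "i \<noteq> j" "i \<noteq> k" "j \<noteq> k"
    and c: "\<bar>c\<bar> = 1" and B: "\<And>x. x \<in> bdry n a \<Longrightarrow> c * f x \<le> B"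
    and mid: "\<And>\<theta> \<kappa>. \<theta> \<in> {1/4..3/4} \<Longrightarrow> \<kappa> \<in> {1/4..3/4} \<Longrightarrow> \<bar>f (ept n a j i \<theta>) - f (ept n a j i \<kappa>)\<bar> \<le> \<epsilon>"
    and x: "x \<in> bdry (Suc (Suc n)) (child (Suc n) j (child n i a))"
  shows "c * f x \<le> B - (B - c * f (mid n a k)) / 16 + \<epsilon>"
proof -
  define a1 where "a1 = child n i a"
  define a2 where "a2 = child (Suc n) j a1"
  have a1: "a1 \<in> base (Suc n)" using a ijk by (auto simp: a1_def)
  define q where "q = c * f (mid n a k)"
  have qB: "q \<le> B" unfolding q_def using B mid_bdry ijk by blast
  have ce: "\<bar>c * u - c * v\<bar> = \<bar>u - v\<bar>" for u v
    using c by (simp add: abs_mult right_diff_distrib[symmetric])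
  have \<epsilon>: "0 \<le> \<epsilon>" using mid[of "1/2" "1/2"] by simp
  have MB: "c * f (mid n a l) \<le> B" if "l < 3" for l
    using B mid_bdry[OF that] by blast
  \<comment> \<open>This edge occupies the parameters from 1/2 to 3/4 of an edge of the original
    cell, where values stay within \<open>\<epsilon>\<close> of the value at the midpoint.\<close>
  have e1: "c * f (ept (Suc (Suc n)) a2 j i t) \<le> q + \<epsilon>" if "0 \<le> t" "t \<le> 1" for t
  proof -
    have "ept (Suc (Suc n)) a2 j i t = ept n a j i ((1 + t / 2) / 2)"
      unfolding a2_def a1_def ept_child_near ept_child_far ..
    moreover have "mid n a k = ept n a j i (1 / 2)"
      using ijk by (intro mid_eq_ept) auto
    moreover have "(1 + t / 2) / 2 \<in> {1/4..3/4}" using that by auto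
    ultimately have "\<bar>c * f (ept (Suc (Suc n)) a2 j i t) - q\<bar> \<le> \<epsilon>"
      unfolding q_def ce using mid[of "(1 + t / 2) / 2" "1 / 2"] by auto
    then show ?thesis by (simp add: abs_le_iff)
  qed
  \<comment> \<open>This edge is the half nearer to \<open>mid n a k\<close> of a side of the
    removed triangle of \<open>a\<close>, so that node has weight at least 1/4.\<close>
  have e2: "c * f (ept (Suc (Suc n)) a2 j k t) \<le> B - (B - q) / 4" if "0 \<le> t" "t \<le> 1" for t
  proof -
    have e: "ept (Suc (Suc n)) a2 j k t = (1 - t / 2) *\<^sub>R mid n a k + (t / 2) *\<^sub>R mid n a j"
      unfolding a2_def a1_def ept_child_near ept_child_fresh[OF ijk] ..
    show ?thesis unfolding e q_def
      using that ijk MB by (intro f_tri_weighted[OF a] ept_in_tri[of i j k] lam_segment[of i k j]) auto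
  qed
  \<comment> \<open>This side is fresh at the second level, and its two ends are the far ends of the
    other two sides, already improved by \<open>(B - q) / 4\<close> up to \<open>\<epsilon>\<close>.
    The nearer of these ends again has weight at least 1/4, whence 1/16.\<close>
  have e3: "c * f (ept (Suc (Suc n)) a2 i k t) \<le> B - (B - q) / 16 + \<epsilon>" if "0 \<le> t" "t \<le> 1" for t
  proof -
    let ?mid = "mid (Suc n) a1"
    have jik: "j < 3" "i < 3" "k < 3" "j \<noteq> i" "j \<noteq> k" "i \<noteq> k" using ijk by auto
    have e: "ept (Suc (Suc n)) a2 i k t = (1 - t) *\<^sub>R ?mid k + t *\<^sub>R ?mid i"
      unfolding a2_def ept_child_fresh[OF jik] ..
    have "ept (Suc (Suc n)) a2 j i 1 = ?mid k"
      unfolding a2_def ept_child_near using jik by (intro mid_eq_ept[symmetric]) auto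
    with e1[of 1] have "c * f (?mid k) \<le> q + \<epsilon>" by simp
    with qB have Mk: "c * f (?mid k) \<le> B - (B - q) / 4 + \<epsilon>" by (simp add: field_simps)
    have "ept (Suc (Suc n)) a2 j k 1 = ?mid i"
      unfolding a2_def ept_child_near using jik by (intro mid_eq_ept[symmetric]) auto
    then have Mi: "c * f (?mid i) \<le> B - (B - q) / 4 + \<epsilon>"
      using e2[of 1] \<epsilon> by auto
    have B1: "c * f (?mid l) \<le> B" if "l < 3" for l
    proof -
      have "?mid l \<in> bdry n a \<or> ?mid l \<in> tri n a"
        using child_bdry[OF ijk(1)] mid_bdry[OF that] by (auto simp: a1_def)
      then show ?thesis
      proof
        assume t: "?mid l \<in> tri n a"
        show ?thesis unfolding f_tri[OF a t] shep_cmult[symmetric] using MB by (intro shep_le)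
      qed (rule B)
    qed
    have t: "ept (Suc (Suc n)) a2 i k t \<in> tri (Suc n) a1"
      unfolding e using that by (intro ept_in_tri[OF jik])
    have "\<exists>l\<in>{i, k}. 1 / 4 \<le> lam (\<beta> (Suc n)) ?mid l (ept (Suc (Suc n)) a2 i k t)"
    proof (cases "t \<le> 1 / 2")
      case True
      then have "1 / 4 \<le> lam (\<beta> (Suc n)) ?mid k (ept (Suc (Suc n)) a2 i k t)"
        unfolding e using that jik by (intro lam_segment[of j k i]) auto
      then show ?thesis by blast
    next
      case False
      then have "1 / 4 \<le> lam (\<beta> (Suc n)) ?mid i ((1 - (1 - t)) *\<^sub>R ?mid i + (1 - t) *\<^sub>R ?mid k)"
        using that jik by (intro lam_segment[of j i k]) auto
      then show ?thesis unfolding e by (auto simp: add.commute)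
    qed
    then obtain l where l: "l \<in> {i, k}" "1 / 4 \<le> lam (\<beta> (Suc n)) ?mid l (ept (Suc (Suc n)) a2 i k t)" by blast
    have "c * f (ept (Suc (Suc n)) a2 i k t) \<le> B - (B - c * f (?mid l)) / 4"
      using l ijk by (intro f_tri_weighted[OF a1 t B1]) auto
    also have "c * f (?mid l) \<le> B - (B - q) / 4 + \<epsilon>" using l Mk Mi by auto
    then have "B - (B - c * f (?mid l)) / 4 \<le> B - (B - q) / 16 + \<epsilon>" using \<epsilon> by (simp add: field_simps)
    finally show ?thesis .
  qed
  have all: "c * f (ept (Suc (Suc n)) a2 i' j' t) \<le> B - (B - q) / 16 + \<epsilon>"
    if "0 \<le> t" "t \<le> 1" "(i', j') \<in> {(j, i), (j, k), (i, k)}" for i' j' t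
    using that e1[OF that(1,2)] e2[OF that(1,2)] e3[OF that(1,2)] qB \<epsilon> by (auto simp: field_simps)
  from x[folded a1_def, folded a2_def] obtain i' j' t where t: "i' < 3" "j' < 3" "i' \<noteq> j'" "0 \<le> t" "t \<le> 1"
    "x = ept (Suc (Suc n)) a2 i' j' t" by (rule bdry_edge)
  have "(i', j') \<in> {(j, i), (j, k), (i, k)} \<or> (j', i') \<in> {(j, i), (j, k), (i, k)}"
    using t(1-3) ijk by (auto simp: less_3)
  then show ?thesis
  proof
    assume "(i', j') \<in> {(j, i), (j, k), (i, k)}"
    from all[OF t(4,5) this] show ?thesis by (simp add: t(6) q_def)
  next
    assume "(j', i') \<in> {(j, i), (j, k), (i, k)}"
    from all[OF _ _ this, of "1 - t"] t(4,5) show ?thesis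
      by (simp add: t(6) q_def ept_sym[of _ _ i' j'])
  qed
qed

text \<open>The one-sided estimate is used with \<open>c = 1\<close> and \<open>c = -1\<close>. The
  upper bound drops by \<open>(hi - q) / 16\<close> and the lower one rises by
  \<open>(q - lo) / 16\<close>; the sum of the gains does not depend on the value \<open>q\<close>
  at the midpoint.\<close>

lemma switch:
  assumes a: "a \<in> base n" and ij: "i < 3" "j < 3" "i \<noteq> j" and Bd: "Bd n a lo hi"
    and mid: "\<And>\<theta> \<kappa>. \<theta> \<in> {1/4..3/4} \<Longrightarrow> \<kappa> \<in> {1/4..3/4} \<Longrightarrow> \<bar>f (ept n a j i \<theta>) - f (ept n a j i \<kappa>)\<bar> \<le> \<epsilon>"
  shows "\<exists>lo' hi'. hi' - lo' \<le> 15 / 16 * (hi - lo) + 2 * \<epsilon> \<and>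
    Bd (Suc (Suc n)) (child (Suc n) j (child n i a)) lo' hi'"
proof -
  obtain k where k: "k < 3" "k \<noteq> i" "k \<noteq> j" using third_index[OF ij] by metis
  let ?q = "f (mid n a k)"
  have up: "f x \<le> hi - (hi - ?q) / 16 + \<epsilon>"
    if "x \<in> bdry (Suc (Suc n)) (child (Suc n) j (child n i a))" for x
    using switch_one_sided[of a n i j k 1 hi \<epsilon> x] a ij k Bd mid that by (auto simp: Bd_def)
  have down: "- f x \<le> - lo - (- lo + ?q) / 16 + \<epsilon>"
    if "x \<in> bdry (Suc (Suc n)) (child (Suc n) j (child n i a))" for x
    using switch_one_sided[of a n i j k "-1" "- lo" \<epsilon> x] a ij k Bd mid that by (auto simp: Bd_def)
  have "Bd (Suc (Suc n)) (child (Suc n) j (child n i a)) (lo + (- lo + ?q) / 16 - \<epsilon>) (hi - (hi - ?q) / 16 + \<epsilon>)"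
    unfolding Bd_def using up down by fastforce
  moreover have "(hi - (hi - ?q) / 16 + \<epsilon>) - (lo + (- lo + ?q) / 16 - \<epsilon>) \<le> 15 / 16 * (hi - lo) + 2 * \<epsilon>"
    by (simp add: field_simps)
  ultimately show ?thesis by blast
qed

section \<open>Cells shrinking to a fixed corner\<close>

primrec corner :: "nat \<Rightarrow> real \<times> real \<Rightarrow> nat \<Rightarrow> nat \<Rightarrow> real \<times> real" where
  "corner n a i 0 = a"
| "corner n a i (Suc k) = child (n + k) i (corner n a i k)"

lemma corner_base: "a \<in> base n \<Longrightarrow> i < 3 \<Longrightarrow> corner n a i k \<in> base (n + k)"
  by (induction k) (auto simp: child_base simp del: base.simps)

lemma ept_corner: "ept (n + k) (corner n a i k) i j t = ept n a i j (t / 2 ^ k)"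
proof (induction k arbitrary: t)
  case (Suc k)
  show ?case
    unfolding corner.simps add_Suc_right ept_child_near Suc by (simp add: field_simps)
qed simp

text \<open>The two edges meeting at the corner lie on fixed edges of level \<open>n\<close>, where
  continuity brings the values close to the corner value. The third edge is governed by the midpoint
  opposite the corner, whose deviation \<open>e k\<close> essentially halves at each level.\<close>

lemma corner_small:
  assumes a: "a \<in> base n" and i: "i < 3" and \<epsilon>: "\<epsilon> > 0"
  obtains k lo hi where "hi - lo \<le> 6 * \<epsilon>" "Bd (n + k) (corner n a i k) lo hi"
proof -
  \<comment> \<open>At parameter 0 the second index is immaterial; \<open>(i + 1) mod 3\<close> is
    just some index.\<close>
  define C where "C = ept n a i ((i + 1) mod 3) 0"
  have C: "ept n a i j 0 = C" for j
    by (simp add: C_def ept_def)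
  have "\<exists>d>0. \<forall>t. 0 \<le> t \<and> t < d \<and> t \<le> 1 \<longrightarrow> \<bar>f (ept n a i j t) - f C\<bar> < \<epsilon>" if j: "j < 3" "i \<noteq> j" for j
  proof -
    have "continuous_on {0..1} (\<lambda>t. f (ept n a i j t))"
      by (rule continuous_on_compose2[OF continuous_on_stable[of n] continuous_ept])
         (use ept_stable[OF a i j] in auto)
    then have "\<exists>d>0. \<forall>t\<in>{0..1}. dist t 0 < d \<longrightarrow> dist (f (ept n a i j t)) (f (ept n a i j 0)) < \<epsilon>"
      using \<epsilon> unfolding continuous_on_iff by force
    then obtain d where "d > 0" "\<forall>t\<in>{0..1}. dist t 0 < d \<longrightarrow> dist (f (ept n a i j t)) (f (ept n a i j 0)) < \<epsilon>"
      by blast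
    then show ?thesis by (intro exI[of _ d]) (auto simp: dist_real_def C)
  qed
  then obtain d where d: "\<And>j. j < 3 \<Longrightarrow> i \<noteq> j \<Longrightarrow> d j > 0"
    "\<And>j t. j < 3 \<Longrightarrow> i \<noteq> j \<Longrightarrow> 0 \<le> t \<Longrightarrow> t < d j \<Longrightarrow> t \<le> 1 \<Longrightarrow> \<bar>f (ept n a i j t) - f C\<bar> < \<epsilon>"
    by metis
  define j where "j = (if i = 0 then 1 else 0 :: nat)"
  define l where "l = (if i = 2 then 1 else 2 :: nat)"
  have jl: "j < 3" "l < 3" "i \<noteq> j" "i \<noteq> l" "j \<noteq> l" by (auto simp: j_def l_def)
  have jl': "m = i \<or> m = j \<or> m = l" if "m < 3" for m
    using that i by (auto simp: j_def l_def less_3)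
  have "(\<lambda>k. (1 / 2 :: real) ^ k) \<longlonglongrightarrow> 0" by (rule LIMSEQ_power_zero) simp
  then have "\<forall>\<^sub>F k in sequentially. (1 / 2 :: real) ^ k < min (d j) (d l)"
    using d jl by (intro order_tendstoD) auto
  then obtain k0 where k0: "\<And>k. k \<ge> k0 \<Longrightarrow> (1 / 2 :: real) ^ k < min (d j) (d l)"
    by (auto simp: eventually_sequentially)
  have near: "\<bar>f (ept (n + k) (corner n a i k) i m t) - f C\<bar> \<le> \<epsilon>"
    if "k \<ge> k0" "0 \<le> t" "t \<le> 1" "m = j \<or> m = l" for k m t
  proof -
    have "t / 2 ^ k \<le> (1 / 2) ^ k" using that by (simp add: power_one_over divide_right_mono)
    moreover have "t / 2 ^ k \<le> 1" using that by (simp add: divide_le_eq order_trans[OF _ one_le_power])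
    ultimately show ?thesis
      unfolding ept_corner using that k0[OF that(1)] jl
      by (intro less_imp_le[OF d(2)]) auto
  qed
  define e where "e k = \<bar>f (mid (n + k) (corner n a i k) i) - f C\<bar>" for k
  have M_near: "\<bar>f (mid (n + k) (corner n a i k) m) - f C\<bar> \<le> \<epsilon>" if "k \<ge> k0" "m = j \<or> m = l" for k m
  proof -
    have "mid (n + k) (corner n a i k) l = ept (n + k) (corner n a i k) i j (1 / 2)"
      "mid (n + k) (corner n a i k) j = ept (n + k) (corner n a i k) i l (1 / 2)"
      using jl i by (auto intro: mid_eq_ept)
    then show ?thesis using near[OF that(1), of "1 / 2"] that(2) by auto
  qed
  have opp: "\<bar>f (ept (n + Suc k) (corner n a i (Suc k)) j l t) - f C\<bar> \<le> max \<epsilon> (e k)"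
    if "k \<ge> k0" "0 \<le> t" "t \<le> 1" for k t
  proof -
    let ?mid = "mid (n + k) (corner n a i k)"
    note ijl = i jl
    have e: "ept (n + Suc k) (corner n a i (Suc k)) j l t = (1 - t) *\<^sub>R ?mid l + t *\<^sub>R ?mid j"
      unfolding corner.simps add_Suc_right ept_child_fresh[OF ijl] ..
    have t: "(1 - t) *\<^sub>R ?mid l + t *\<^sub>R ?mid j \<in> tri (n + k) (corner n a i k)"
      using that by (intro ept_in_tri[OF ijl]) auto
    have q: "f C - max \<epsilon> (e k) \<le> f (?mid m) \<and> f (?mid m) \<le> f C + max \<epsilon> (e k)" if m: "m < 3" for m
      using jl'[OF m] M_near[OF \<open>k \<ge> k0\<close>, of j] M_near[OF \<open>k \<ge> k0\<close>, of l]
      by (auto simp: e_def)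
    have "f C - max \<epsilon> (e k) \<le> f ((1 - t) *\<^sub>R ?mid l + t *\<^sub>R ?mid j)"
      "f ((1 - t) *\<^sub>R ?mid l + t *\<^sub>R ?mid j) \<le> f C + max \<epsilon> (e k)"
      unfolding f_tri[OF corner_base[OF a i] t] using q by (auto intro!: shep_ge shep_le)
    then show ?thesis unfolding e by linarith
  qed
  \<comment> \<open>The next opposite midpoint is the middle of the segment between the nodes
    \<open>j\<close> and \<open>l\<close>. Both have weight at least 1/4, which leaves at most 1/2
    for the node \<open>i\<close>, the only one whose deviation is not yet at most
    \<open>\<epsilon>\<close>.\<close>
  have step: "e (Suc k) \<le> \<epsilon> + e k / 2" if k: "k \<ge> k0" for k
  proof -
    let ?mid = "mid (n + k) (corner n a i k)"
    let ?x = "(1 - 1 / 2 :: real) *\<^sub>R ?mid l + (1 / 2 :: real) *\<^sub>R ?mid j"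
    have ijl: "i < 3" "j < 3" "l < 3" "i \<noteq> j" "i \<noteq> l" "j \<noteq> l" using i jl by auto
    have "mid (n + Suc k) (corner n a i (Suc k)) i = ept (n + Suc k) (corner n a i (Suc k)) j l (1 / 2)"
      using ijl by (intro mid_eq_ept) auto
    also have "\<dots> = ?x"
      unfolding corner.simps add_Suc_right ept_child_fresh[OF ijl] ..
    finally have Mx: "mid (n + Suc k) (corner n a i (Suc k)) i = ?x" .
    have t: "?x \<in> tri (n + k) (corner n a i k)"
      by (intro ept_in_tri[OF ijl]) auto
    let ?w = "\<lambda>m. lam (\<beta> (n + k)) ?mid m ?x"
    have wl: "1 / 4 \<le> ?w l" using ijl by (intro lam_segment[of i l j]) auto
    have "1 / 4 \<le> lam (\<beta> (n + k)) ?mid j ((1 - 1 / 2 :: real) *\<^sub>R ?mid j + (1 / 2 :: real) *\<^sub>R ?mid l)"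
      using ijl by (intro lam_segment[of i j l]) auto
    then have wj: "1 / 4 \<le> ?w j" by (simp add: add.commute)
    have "{..<3} = {i, j, l}" using ijl jl' by auto
    then have sum3: "(\<Sum>m<3. h m) = h i + h j + h l" for h :: "nat \<Rightarrow> real"
      using ijl by (simp add: add.assoc)
    have wsum: "?w i + ?w j + ?w l = 1"
      using lam_sum[of "n + k" "corner n a i k" ?x] unfolding sum3 .
    define w where "w m = ?w m" for m
    have w: "1 / 4 \<le> w l" "1 / 4 \<le> w j" "w i + w j + w l = 1" "0 \<le> w i"
      using wl wj wsum lam_nonneg[of "n + k" "corner n a i k" i ?x] by (simp_all only: w_def)
    have fx: "f ?x = shep (\<beta> (n + k)) ?mid (\<lambda>k. f (?mid k)) ?x"
      by (rule f_tri[OF corner_base[OF a i] t])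
    define r where "r m = f (?mid m) - f C" for m
    have r: "\<bar>r j\<bar> \<le> \<epsilon>" "\<bar>r l\<bar> \<le> \<epsilon>" "\<bar>r i\<bar> = e k"
      using M_near[OF k, of j] M_near[OF k, of l] by (simp_all only: r_def e_def simp_thms)
    have aw: "\<bar>w i\<bar> = w i" "\<bar>w j\<bar> = w j" "\<bar>w l\<bar> = w l" using w(1,2,4) by linarith+
    have "f ?x - f C = (\<Sum>m<3. r m * w m)"
      unfolding fx w_def r_def by (rule shep_diff)
    also have "\<dots> = r i * w i + r j * w j + r l * w l"
      by (rule sum3)
    finally have "\<bar>f ?x - f C\<bar> = \<bar>r i * w i + r j * w j + r l * w l\<bar>" by (rule arg_cong)
    also have "\<dots> \<le> \<bar>r i * w i\<bar> + \<bar>r j * w j\<bar> + \<bar>r l * w l\<bar>"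
      by (rule order_trans[OF abs_triangle_ineq add_right_mono[OF abs_triangle_ineq]])
    also have "\<dots> = e k * w i + \<bar>r j\<bar> * w j + \<bar>r l\<bar> * w l"
      unfolding abs_mult aw r(3) ..
    also have "\<dots> \<le> e k * (1 / 2) + \<epsilon> * w j + \<epsilon> * w l"
    proof (intro add_mono mult_left_mono mult_right_mono r)
      show "0 \<le> e k" by (simp only: e_def abs_ge_zero)
      show "w i \<le> 1 / 2" "0 \<le> w j" "0 \<le> w l" using w by linarith+
    qed
    also have "\<dots> = \<epsilon> * (w j + w l) + e k / 2" by (simp add: algebra_simps)
    also have "\<epsilon> * (w j + w l) \<le> \<epsilon> * 1"
      using \<epsilon> w by (intro mult_left_mono) auto
    finally show ?thesis unfolding e_def[of "Suc k"] Mx by simp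
  qed
  have e_le: "e (k0 + m) \<le> 2 * \<epsilon> + (1 / 2) ^ m" for m
  proof (induction m)
    case 0
    have "e k0 \<le> 1" unfolding e_def using f_bounds by (smt (verit))
    with \<epsilon> show ?case by simp
  next
    case (Suc m)
    with step[of "k0 + m"] show ?case by simp
  qed
  obtain m where m: "(1 / 2 :: real) ^ m < \<epsilon>"
    using real_arch_pow_inv[OF \<epsilon>, of "1 / 2"] by auto
  define k where "k = k0 + m"
  have ek: "max \<epsilon> (e k) \<le> 3 * \<epsilon>" using e_le[of m] m \<epsilon> by (auto simp: k_def)
  have "Bd (n + Suc k) (corner n a i (Suc k)) (f C - 3 * \<epsilon>) (f C + 3 * \<epsilon>)"
    unfolding Bd_def
  proof
    fix x assume "x \<in> bdry (n + Suc k) (corner n a i (Suc k))"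
    then obtain i' j' t where t: "i' < 3" "j' < 3" "i' \<noteq> j'" "0 \<le> t" "t \<le> 1"
      "x = ept (n + Suc k) (corner n a i (Suc k)) i' j' t" by (rule bdry_edge)
    have "\<bar>f (ept (n + Suc k) (corner n a i (Suc k)) i' j' t) - f C\<bar> \<le> 3 * \<epsilon>"
      if t: "0 \<le> t" "t \<le> 1" "(i', j') \<in> {(i, j), (i, l), (j, l)}" for i' j' t
      using t(3) near[of "Suc k" t j] near[of "Suc k" t l] opp[of k t] t ek \<epsilon>
      by (auto simp: k_def simp del: corner.simps add_Suc_right)
    note * = this
    have "(i', j') \<in> {(i, j), (i, l), (j, l)} \<or> (j', i') \<in> {(i, j), (i, l), (j, l)}"
      using t(1-3) jl'[of i'] jl'[of j'] by auto
    then have "\<bar>f x - f C\<bar> \<le> 3 * \<epsilon>"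
    proof
      assume "(i', j') \<in> {(i, j), (i, l), (j, l)}"
      from *[OF t(4,5) this] show ?thesis by (simp only: t(6))
    next
      assume "(j', i') \<in> {(i, j), (i, l), (j, l)}"
      from *[OF _ _ this, of "1 - t"] t(4,5) show ?thesis
        by (simp only: t(6) ept_sym[of _ _ i' j'])
    qed
    then show "f C - 3 * \<epsilon> \<le> f x \<and> f x \<le> f C + 3 * \<epsilon>" by linarith
  qed
  moreover have "f C + 3 * \<epsilon> - (f C - 3 * \<epsilon>) \<le> 6 * \<epsilon>" by simp
  ultimately show thesis using that by blast
qed

section \<open>Decay of the oscillation\<close>

definition Osc :: "real \<Rightarrow> bool" where
  "Osc m \<longleftrightarrow> (\<exists>n. \<forall>a\<in>base n. \<exists>lo hi. hi - lo \<le> m \<and> Bd n a lo hi)"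

text \<open>Below a level where the middles of edges are almost constant, a cell is either reached
  in one fixed direction or through a first change of direction. The change contracts by 15/16 up to
  \<open>2 * \<epsilon>\<close>; the fixed direction gives \<open>6 * \<epsilon>\<close> once it is
  deep enough. Both properties persist in descendants.\<close>

lemma Osc_step:
  assumes "Osc m" and \<epsilon>: "\<epsilon> > 0"
  shows "Osc (max (15 / 16 * m + 2 * \<epsilon>) (6 * \<epsilon>))"
proof -
  let ?m = "max (15 / 16 * m + 2 * \<epsilon>) (6 * \<epsilon>)"
  define good where "good n a \<longleftrightarrow> (\<exists>lo hi. hi - lo \<le> ?m \<and> Bd n a lo hi)" for n a
  obtain n0 where n0: "\<And>a. a \<in> base n0 \<Longrightarrow> \<exists>lo hi. hi - lo \<le> m \<and> Bd n0 a lo hi"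
    using assms(1) by (auto simp: Osc_def)
  obtain N where N: "\<And>n a i j \<theta> \<kappa>. N \<le> n \<Longrightarrow> a \<in> base n \<Longrightarrow> i < 3 \<Longrightarrow> j < 3 \<Longrightarrow> i \<noteq> j \<Longrightarrow>
    \<theta> \<in> {1/4..3/4} \<Longrightarrow> \<kappa> \<in> {1/4..3/4} \<Longrightarrow> \<bar>f (ept n a i j \<theta>) - f (ept n a i j \<kappa>)\<bar> \<le> \<epsilon>"
    using edge_middle_small[OF \<epsilon>] by blast
  define n where "n = max n0 N"
  have desc: "\<exists>lo hi. hi - lo \<le> m \<and> Bd n' a lo hi" if "a \<in> base n'" "n \<le> n'" for a n'
    using Bd_descend[OF n0, of n' a] that by (auto simp: n_def)
  have good_child: "good (Suc n') (child n' i b)" if "good n' b" "b \<in> base n'" "i < 3" for n' i b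
    using that Bd_child unfolding good_def by blast
  have dich: "good (n + Suc k) b \<or> (\<exists>a\<in>base n. \<exists>i<3. b = corner n a i (Suc k))"
    if "b \<in> base (n + Suc k)" for k b
    using that
  proof (induction k arbitrary: b)
    case 0
    then obtain a i where "a \<in> base n" "i < 3" "b = child n i a" by auto
    then show ?case by (intro disjI2 bexI[of _ a] exI[of _ i]) auto
  next
    case (Suc k)
    from Suc.prems obtain b' j where b': "b' \<in> base (n + Suc k)" "j < 3" "b = child (n + Suc k) j b'"
      unfolding add_Suc_right[of n "Suc k"] base.simps(2)[of "n + Suc k"] by blast
    from Suc.IH[OF b'(1)] show ?case
    proof
      assume "good (n + Suc k) b'"
      from good_child[OF this b'(1,2)] show ?thesis using b'(3) by simp
    next
      assume "\<exists>a\<in>base n. \<exists>i<3. b' = corner n a i (Suc k)"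
      then obtain a i where ai: "a \<in> base n" "i < 3" "b' = corner n a i (Suc k)" by blast
      show ?thesis
      proof (cases "i = j")
        case True
        then have "b = corner n a i (Suc (Suc k))" using ai b' by simp
        with ai show ?thesis by blast
      next
        case False
        \<comment> \<open>One step before the last in direction \<open>i\<close>: the final two
          steps are then \<open>i\<close> followed by \<open>j\<close>, the change of direction that
          contracts.\<close>
        let ?c = "corner n a i k"
        have c: "?c \<in> base (n + k)" by (rule corner_base[OF ai(1,2)])
        obtain lo hi where lh: "hi - lo \<le> m" "Bd (n + k) ?c lo hi"
          using desc[OF c] by auto
        have mid: "\<bar>f (ept (n + k) ?c j i \<theta>) - f (ept (n + k) ?c j i \<kappa>)\<bar> \<le> \<epsilon>"
          if "\<theta> \<in> {1/4..3/4}" "\<kappa> \<in> {1/4..3/4}" for \<theta> \<kappa>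
          using False ai b' that by (intro N[OF _ c]) (auto simp: n_def)
        obtain lo' hi' where lh': "hi' - lo' \<le> 15 / 16 * (hi - lo) + 2 * \<epsilon>"
          "Bd (Suc (Suc (n + k))) (child (Suc (n + k)) j (child (n + k) i ?c)) lo' hi'"
          using switch[OF c ai(2) b'(2) False lh(2) mid] by blast
        have "Bd (n + Suc (Suc k)) b lo' hi'" using lh'(2) by (simp add: b'(3) ai(3))
        moreover have "15 / 16 * (hi - lo) \<le> 15 / 16 * m" using lh(1) by (intro mult_left_mono) auto
        then have "hi' - lo' \<le> 15 / 16 * m + 2 * \<epsilon>"
          by (rule order_trans[OF lh'(1) add_right_mono])
        then have "hi' - lo' \<le> ?m" by simp
        ultimately show ?thesis unfolding good_def by blast
      qed
    qed
  qed
  have "\<exists>k. good (n + k) (corner n a i k)" if "a \<in> base n" "i < 3" for a i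
    using corner_small[OF that \<epsilon>] unfolding good_def by (metis max.coboundedI2)
  then obtain kk where kk: "\<And>a i. a \<in> base n \<Longrightarrow> i < 3 \<Longrightarrow> good (n + kk a i) (corner n a i (kk a i))"
    by metis
  \<comment> \<open>There are finitely many starting cells and directions, so one depth serves for
    all corners.\<close>
  define K where "K = Max ((\<lambda>(a, i). kk a i) ` (base n \<times> {..<3}))"
  have K: "kk a i \<le> K" if "a \<in> base n" "i < 3" for a i
    unfolding K_def using that finite_base by (intro Max_ge) auto
  have corner_good: "good (n + k) (corner n a i k)" if "a \<in> base n" "i < 3" "kk a i \<le> k" for a i k
    using that(3)
  proof (induction k rule: dec_induct)
    case base
    with kk that show ?case by blast
  next
    case (step k)
    from good_child[OF step.IH corner_base[OF that(1,2)] that(2)] show ?case by simp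
  qed
  have "good (n + Suc K) b" if "b \<in> base (n + Suc K)" for b
    using dich[OF that] corner_good[OF _ _ le_SucI[OF K]] by blast
  then show ?thesis unfolding Osc_def good_def by blast
qed

lemma Osc_small:
  assumes "\<epsilon> > 0"
  shows "Osc \<epsilon>"
proof -
  have "Osc ((31 / 32) ^ k)" for k
  proof (induction k)
    case 0
    have "Bd 0 0 0 1" by (rule Bd_0_1) simp
    then have "\<exists>lo hi. hi - lo \<le> 1 \<and> Bd 0 0 lo hi"
      by - (rule exI[of _ 0], rule exI[of _ 1], simp)
    then show ?case unfolding Osc_def by (intro exI[of _ 0]) simp
  next
    case (Suc k)
    \<comment> \<open>With \<open>\<epsilon>\<close> equal to 1/64 of the current bound,
      \<open>15 / 16 + 2 / 64 = 31 / 32\<close>, while \<open>6 / 64\<close> is smaller.\<close>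
    have "max (15 / 16 * (31 / 32) ^ k + 2 * ((31 / 32) ^ k / 64)) (6 * ((31 / 32) ^ k / 64)) = (31 / 32 :: real) ^ Suc k"
      by (simp add: max_def)
    with Osc_step[OF Suc, of "(31 / 32) ^ k / 64"] show ?case by simp
  qed
  moreover obtain k where "(31 / 32 :: real) ^ k < \<epsilon>"
    using real_arch_pow_inv[OF assms, of "31 / 32"] by auto
  ultimately show ?thesis unfolding Osc_def by (meson less_imp_le order_trans)
qed

text \<open>The plane is covered by \<open>stable n\<close> and finitely many cells, all closed, so
  near a point only the pieces containing it matter. On the former \<open>f\<close> is continuous,
  on the latter its oscillation is small.\<close>

theorem continuous_f: "continuous_on UNIV f"
proof -
  have "\<forall>\<^sub>F y in at x. dist (f y) (f x) < e" if e: "e > 0" for x e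
  proof -
    obtain n where n: "\<And>a. a \<in> base n \<Longrightarrow> \<exists>lo hi. hi - lo \<le> e / 2 \<and> Bd n a lo hi"
      using Osc_small[of "e / 2"] e by (auto simp: Osc_def)
    have stable: "\<forall>\<^sub>F y in at x. y \<in> stable n \<longrightarrow> dist (f y) (f x) < e"
    proof (cases "x \<in> stable n")
      case True
      with continuous_on_stable[of n] have "(f \<longlongrightarrow> f x) (at x within stable n)"
        by (simp add: continuous_on_def)
      then have "\<forall>\<^sub>F y in at x within stable n. dist (f y) (f x) < e"
        using e by (rule tendstoD)
      then show ?thesis by (simp add: eventually_at_filter eventually_mono)
    next
      case False
      then have "\<forall>\<^sub>F y in at x. y \<in> - stable n"
        by (intro eventually_at_in_open' open_Compl closed_stable) auto
      then show ?thesis by eventually_elim auto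
    qed
    have C: "\<forall>\<^sub>F y in at x. y \<in> cell n a \<longrightarrow> dist (f y) (f x) < e" if a: "a \<in> base n" for a
    proof (cases "x \<in> cell n a")
      case True
      obtain lo hi where lh: "hi - lo \<le> e / 2" "Bd n a lo hi" using n[OF a] by blast
      have "dist (f y) (f x) < e" if "y \<in> cell n a" for y
        using Bd_cell[OF a lh(2) that] Bd_cell[OF a lh(2) True] lh(1) e by (auto simp: dist_real_def)
      then show ?thesis by simp
    next
      case False
      then have "\<forall>\<^sub>F y in at x. y \<in> - cell n a"
        by (intro eventually_at_in_open' open_Compl closed_cell) auto
      then show ?thesis by eventually_elim auto
    qed
    have "\<forall>\<^sub>F y in at x. \<forall>a\<in>base n. y \<in> cell n a \<longrightarrow> dist (f y) (f x) < e"
      using C by (intro eventually_ball_finite[OF finite_base] ballI)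
    with stable show ?thesis
    proof eventually_elim
      case (elim y)
      with stable_cover[of y n] show ?case by blast
    qed
  qed
  then show ?thesis
    by (auto simp: continuous_on_def intro!: tendstoI)
qed

end

section \<open>Energy and non-removability\<close>

locale gasket_sobolev =
  fixes F :: "real \<times> real \<Rightarrow> real" and \<kappa> :: real
  assumes F_test: "F \<in> test_functions UNIV" and F_01: "\<And>x. 0 \<le> F x" "\<And>x. F x \<le> 1"
    and \<kappa>: "0 < \<kappa>" "\<kappa> \<le> 1 / 10"
begin

lemma F_C_k: "C_k k F"
  using F_test by (simp add: test_functions_def)

sublocale gasket_fun F "\<lambda>n. \<kappa> / 4 ^ n"
proof
  show "continuous_on UNIV F" using F_C_k[of 0] by simp
  show "\<kappa> / 4 ^ n \<le> 1 / 10" for n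
    using \<kappa> by (intro order_trans[OF divide_left_mono[of 1 "4 ^ n"]]) auto
  have "(\<lambda>n. \<kappa> * (1 / 4) ^ n) \<longlonglongrightarrow> \<kappa> * 0"
    by (intro tendsto_intros LIMSEQ_power_zero) auto
  then show "(\<lambda>n. \<kappa> / 4 ^ n) \<longlonglongrightarrow> 0" by (simp add: power_one_over)
qed (use F_01 \<kappa> in auto)

definition U :: "(real \<times> real) set" where
  "U = UNIV - sierpinski_gasket"

definition holes :: "(real \<times> real) set" where
  "holes = (\<Union>n. \<Union>a\<in>base n. otri n a)"

lemma U_eq: "U = - cell 0 0 \<union> holes"
  by (auto simp: U_def holes_def sierpinski_gasket_eq)

lemma otri_subset_tri: "otri n a \<subseteq> tri n a"
  by (auto simp: otri_def tri_def less_imp_le)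

lemma holes_subset_cell: "holes \<subseteq> cell 0 0"
proof -
  have "otri n a \<subseteq> cell 0 0" if a: "a \<in> base n" for n a
  proof -
    obtain b where "b \<in> base 0" "cell n a \<subseteq> cell 0 b" using base_ancestor[OF _ a, of 0] by auto
    then show ?thesis using otri_subset_tri[of n a] tri_subset_cell[of n a] by auto
  qed
  then show ?thesis by (auto simp: holes_def)
qed

lemma open_holes: "open holes"
  unfolding holes_def by (intro open_UN open_otri ballI)

lemma open_U: "open U"
  unfolding U_eq by (intro open_Un open_holes open_Compl closed_cell)

lemma outside_stable_0: "x \<notin> cell 0 0 \<Longrightarrow> x \<in> stable 0"
  by (auto simp: cell_def less_imp_le)

lemma otri_not_mid: "x \<in> otri n a \<Longrightarrow> k < 3 \<Longrightarrow> x \<noteq> mid n a k"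
proof
  assume x: "x \<in> otri n a" and k: "k < 3" "x = mid n a k"
  define j where "j = (if k = 0 then 1 else 0 :: nat)"
  have "j < 3" "j \<noteq> k" by (auto simp: j_def)
  with x k bary_mid[of k j n a] show False by (auto simp: otri_def)
qed

lemma F_has_derivative: "(F has_derivative frechet_derivative F (at x)) (at x)"
  using F_C_k[of "Suc 0"] by (metis C_k.simps(2) frechet_derivative_works)

lemma f_has_derivative_outside:
  assumes "x \<notin> cell 0 0"
  shows "(f has_derivative frechet_derivative F (at x)) (at x)"
  by (rule has_derivative_transform_within_open[OF F_has_derivative, where s = "- cell 0 0"])
     (use assms closed_cell[of 0 0] outside_stable_0 in \<open>auto simp: f_outside open_Compl simp del: stable.simps\<close>)

lemma f_has_derivative_otri:
  assumes "a \<in> base n" "x \<in> otri n a"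
  shows "(f has_derivative shep_deriv (\<kappa> / 4 ^ n) (mid n a) (\<lambda>k. f (mid n a k)) x) (at x)"
proof (rule has_derivative_transform_within_open[where s = "otri n a"])
  show "(shep (\<kappa> / 4 ^ n) (mid n a) (\<lambda>k. f (mid n a k)) has_derivative
      shep_deriv (\<kappa> / 4 ^ n) (mid n a) (\<lambda>k. f (mid n a k)) x) (at x)"
    by (rule shep_has_derivative) (rule otri_not_mid[OF assms(2)])
  show "shep (\<kappa> / 4 ^ n) (mid n a) (\<lambda>k. f (mid n a k)) y = f y" if "y \<in> otri n a" for y
    using f_tri[OF assms(1) subsetD[OF otri_subset_tri that]] ..
qed (use assms open_otri in auto)

lemma f_has_derivative: "x \<in> U \<Longrightarrow> (f has_derivative frechet_derivative f (at x)) (at x)"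
proof -
  assume "x \<in> U"
  then consider "x \<notin> cell 0 0" | n a where "a \<in> base n" "x \<in> otri n a"
    unfolding U_eq holes_def by blast
  then have "f differentiable (at x)"
    by cases (use f_has_derivative_outside f_has_derivative_otri differentiable_def in blast)+
  then show ?thesis by (simp add: frechet_derivative_works)
qed

lemma partial_outside: "x \<notin> cell 0 0 \<Longrightarrow> partial_deriv b f x = partial_deriv b F x"
  using partial_deriv_eqI[OF f_has_derivative_outside] by (simp add: partial_deriv_def[of b F])

lemma partial_otri: "a \<in> base n \<Longrightarrow> x \<in> otri n a \<Longrightarrow>
    partial_deriv b f x = shep_deriv (\<kappa> / 4 ^ n) (mid n a) (\<lambda>k. f (mid n a k)) x b"
  by (rule partial_deriv_eqI[OF f_has_derivative_otri])

lemma continuous_partial_F: "b \<in> Basis \<Longrightarrow> continuous_on A (partial_deriv b F)"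
  using F_C_k[of 1] by (auto intro: continuous_on_subset)

lemma continuous_partial:
  assumes "b \<in> Basis"
  shows "continuous_on U (partial_deriv b f)"
  unfolding U_eq holes_def
proof (intro continuous_on_open_Un continuous_on_open_UN open_Compl closed_cell open_UN open_otri ballI)
  show "continuous_on (- cell 0 0) (partial_deriv b f)"
    by (rule continuous_on_eq[OF continuous_partial_F[OF assms]]) (simp add: partial_outside)
  show "continuous_on (otri n a) (partial_deriv b f)" if "a \<in> base n" for n a
  proof (rule continuous_on_eq)
    show "continuous_on (otri n a) (\<lambda>x. shep_deriv (\<kappa> / 4 ^ n) (mid n a) (\<lambda>k. f (mid n a k)) x b)"
      by (rule continuous_on_subset[OF continuous_shep_deriv]) (use otri_not_mid in blast)
  qed (simp add: partial_otri[OF that])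
qed

lemma energy_otri:
  assumes a: "a \<in> base n" and b: "b \<in> Basis"
  shows "(\<integral>\<^sup>+x\<in>otri n a. ennreal ((partial_deriv b f x)\<^sup>2) \<partial>lborel) \<le> ennreal (432 * (\<kappa> / 4 ^ n))"
proof -
  have "(\<integral>\<^sup>+x\<in>otri n a. ennreal ((partial_deriv b f x)\<^sup>2) \<partial>lborel) =
    (\<integral>\<^sup>+x\<in>otri n a. ennreal ((shep_deriv (\<kappa> / 4 ^ n) (mid n a) (\<lambda>k. f (mid n a k)) x b)\<^sup>2) \<partial>lborel)"
    by (intro nn_integral_cong) (auto simp: indicator_def partial_otri[OF a])
  also have "\<dots> \<le> ennreal (432 * (\<kappa> / 4 ^ n))"
  proof (rule shepard_energy[where \<sigma> = "sz n / 2"])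
    show "shepard (\<kappa> / 4 ^ n) (mid n a)" by unfold_locales
    show "otri n a \<in> sets lborel" using open_otri by auto
    show "norm b \<le> 1" using b by simp
    show "sz n / 2 \<le> dist (mid n a i) (mid n a j)" if "i < 3" "j < 3" "i \<noteq> j" for i j
      using dist_mid[OF that] by simp
    \<comment> \<open>An equilateral triangle lies in the disc about each of its vertices with
      radius its side, which is here \<open>sz n / 2\<close>.\<close>
    show "otri n a \<subseteq> cbox (mid n a k - (sz n / 2, sz n / 2)) (mid n a k + (sz n / 2, sz n / 2))" if k: "k < 3" for k
    proof
      fix x assume "x \<in> otri n a"
      then have "x \<in> convex hull {mid n a 2, mid n a 0, mid n a 1}" using otri_subset_tri convex_hull_mid by blast
      moreover have "mid n a l \<in> cball (mid n a k) (sz n / 2)" if "l < 3" for l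
        using dist_mid[OF k that, of n a] by (cases "k = l") auto
      then have "convex hull {mid n a 2, mid n a 0, mid n a 1} \<subseteq> cball (mid n a k) (sz n / 2)"
        by (intro hull_minimal convex_cball) auto
      ultimately have "x \<in> cball (mid n a k) (sz n / 2)" by blast
      then have "norm (x - mid n a k) \<le> sz n / 2"
        by (simp add: dist_norm norm_minus_commute)
      then have "norm (fst (x - mid n a k)) \<le> sz n / 2" "norm (snd (x - mid n a k)) \<le> sz n / 2"
        using norm_fst_le[of "fst (x - mid n a k)" "snd (x - mid n a k)"]
          norm_snd_le[of "snd (x - mid n a k)" "fst (x - mid n a k)"]
        by (simp_all only: prod.collapse order_trans)
      then have "\<bar>fst x - fst (mid n a k)\<bar> \<le> sz n / 2" "\<bar>snd x - snd (mid n a k)\<bar> \<le> sz n / 2" by auto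
      then have "fst (mid n a k) - sz n / 2 \<le> fst x" "fst x \<le> fst (mid n a k) + sz n / 2"
        "snd (mid n a k) - sz n / 2 \<le> snd x" "snd x \<le> snd (mid n a k) + sz n / 2" by linarith+
      then show "x \<in> cbox (mid n a k - (sz n / 2, sz n / 2)) (mid n a k + (sz n / 2, sz n / 2))"
        by (cases x; cases "mid n a k") (simp add: cbox_Pair_eq)
    qed
  qed (use otri_not_mid f_bounds in auto)
  finally show ?thesis .
qed

text \<open>Level \<open>n\<close> contributes at most \<open>3 ^ n\<close> times
  \<open>432 * (\<kappa> / 4 ^ n)\<close>, and the geometric series of ratio 3/4 sums to 4. The
  bound is proportional to \<open>\<kappa>\<close>, which is still free.\<close>

lemma energy_holes:
  assumes b: "b \<in> Basis"
  shows "(\<integral>\<^sup>+x\<in>holes. ennreal ((partial_deriv b f x)\<^sup>2) \<partial>lborel) \<le> ennreal (1728 * \<kappa>)"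
proof -
  let ?G = "\<lambda>x. ennreal ((partial_deriv b f x)\<^sup>2)"
  have m: "(\<lambda>x. ?G x * indicator (otri n a) x) \<in> borel_measurable lborel" if a: "a \<in> base n" for n a
  proof -
    have "otri n a \<subseteq> U" using a by (auto simp: U_eq holes_def)
    then have "(\<lambda>x. indicator (otri n a) x *\<^sub>R partial_deriv b f x) \<in> borel_measurable borel"
      using open_otri by (intro borel_measurable_continuous_on_indicator continuous_on_subset[OF continuous_partial[OF b]]) auto
    then have "(\<lambda>x. ennreal ((indicator (otri n a) x *\<^sub>R partial_deriv b f x)\<^sup>2)) \<in> borel_measurable borel"
      by measurable
    also have "(\<lambda>x. ennreal ((indicator (otri n a) x *\<^sub>R partial_deriv b f x)\<^sup>2)) = (\<lambda>x. ?G x * indicator (otri n a) x)"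
      by (auto simp: fun_eq_iff indicator_def)
    finally show ?thesis by simp
  qed
  have "(\<integral>\<^sup>+x\<in>holes. ?G x \<partial>lborel) \<le> (\<integral>\<^sup>+x. (\<Sum>n. \<Sum>a\<in>base n. ?G x * indicator (otri n a) x) \<partial>lborel)"
  proof (intro nn_integral_mono)
    fix x
    show "?G x * indicator holes x \<le> (\<Sum>n. \<Sum>a\<in>base n. ?G x * indicator (otri n a) x)"
    proof (cases "x \<in> holes")
      case True
      then obtain n a where na: "a \<in> base n" "x \<in> otri n a" by (auto simp: holes_def)
      have "?G x * indicator holes x = ?G x * indicator (otri n a) x" using True na by simp
      also have "\<dots> \<le> (\<Sum>a\<in>base n. ?G x * indicator (otri n a) x)"
        using na finite_base by (intro member_le_sum) auto
      also have "\<dots> = (\<Sum>n\<in>{n}. \<Sum>a\<in>base n. ?G x * indicator (otri n a) x)" by simp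
      also have "\<dots> \<le> (\<Sum>n. \<Sum>a\<in>base n. ?G x * indicator (otri n a) x)"
        by (rule sum_le_suminf) auto
      finally show ?thesis .
    qed simp
  qed
  also have "\<dots> = (\<Sum>n. \<integral>\<^sup>+x. (\<Sum>a\<in>base n. ?G x * indicator (otri n a) x) \<partial>lborel)"
    using m by (intro nn_integral_suminf borel_measurable_sum) auto
  also have "\<dots> = (\<Sum>n. \<Sum>a\<in>base n. \<integral>\<^sup>+x. ?G x * indicator (otri n a) x \<partial>lborel)"
    using m by (intro arg_cong[where f = suminf] ext nn_integral_sum) auto
  also have "\<dots> \<le> (\<Sum>n. ennreal (432 * \<kappa> * (3 / 4) ^ n))"
  proof (intro suminf_le summableI)
    fix n
    have "(\<Sum>a\<in>base n. \<integral>\<^sup>+x. ?G x * indicator (otri n a) x \<partial>lborel) \<le> (\<Sum>a\<in>base n. ennreal (432 * (\<kappa> / 4 ^ n)))"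
      by (intro sum_mono energy_otri b)
    also have "\<dots> = ennreal (real (card (base n)) * (432 * (\<kappa> / 4 ^ n)))"
      using \<kappa> by (subst sum_ennreal) auto
    also have "\<dots> \<le> ennreal (3 ^ n * (432 * (\<kappa> / 4 ^ n)))"
      using \<kappa> by (intro ennreal_leI mult_right_mono card_base) auto
    also have "3 ^ n * (432 * (\<kappa> / 4 ^ n)) = 432 * \<kappa> * (3 / 4) ^ n"
      by (simp add: power_divide)
    finally show "(\<Sum>a\<in>base n. \<integral>\<^sup>+x. ?G x * indicator (otri n a) x \<partial>lborel) \<le> ennreal (432 * \<kappa> * (3 / 4) ^ n)" .
  qed
  also have "\<dots> = ennreal (\<Sum>n. 432 * \<kappa> * (3 / 4) ^ n)"
    using \<kappa> by (intro suminf_ennreal2 summable_mult summable_geometric) auto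
  also have "(\<Sum>n. 432 * \<kappa> * (3 / 4) ^ n) = 1728 * \<kappa>"
    by (subst suminf_mult) (auto simp: suminf_geometric summable_geometric)
  finally show ?thesis .
qed

definition suppF :: "(real \<times> real) set" where
  "suppF = closure {x. F x \<noteq> 0}"

definition supp :: "(real \<times> real) set" where
  "supp = cell 0 0 \<union> suppF"

lemma compact_cell: "compact (cell n a)"
  using closed_cell bounded_subset[OF bounded_cbox cell_subset_cbox] by (simp add: compact_eq_bounded_closed)

lemma compact_suppF: "compact suppF"
  using F_test by (simp add: test_functions_def suppF_def)

lemma compact_supp: "compact supp"
  unfolding supp_def by (intro compact_Un compact_cell compact_suppF)

lemma F_0: "x \<notin> suppF \<Longrightarrow> F x = 0"
  unfolding suppF_def using closure_subset[of "{x. F x \<noteq> 0}"] by (metis (mono_tags, lifting) mem_Collect_eq subsetD)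

lemma partial_F_0:
  assumes "x \<notin> suppF"
  shows "partial_deriv b F x = 0"
  using partial_deriv_eqI[OF has_derivative_off_support[OF F_0 compact_imp_closed[OF compact_suppF] assms]]
  by simp

lemma f_0: "x \<notin> supp \<Longrightarrow> f x = 0"
  unfolding supp_def using f_outside[OF outside_stable_0] F_0 by simp

text \<open>Setting the value 0 on the gasket gives a Borel function on the whole plane, namely an
  indicator times a function continuous on the open set \<open>U\<close>.\<close>

definition grad :: "real \<times> real \<Rightarrow> real \<times> real \<Rightarrow> real" where
  "grad b x = (if x \<in> U then partial_deriv b f x else 0)"

lemma grad_meas:
  assumes "b \<in> Basis"
  shows "grad b \<in> borel_measurable borel"
proof -
  have "(\<lambda>x. indicator U x *\<^sub>R partial_deriv b f x) \<in> borel_measurable borel"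
    using open_U continuous_partial[OF assms] by (intro borel_measurable_continuous_on_indicator) auto
  also have "(\<lambda>x. indicator U x *\<^sub>R partial_deriv b f x) = grad b"
    by (auto simp: grad_def indicator_def fun_eq_iff)
  finally show ?thesis .
qed

lemma grad_0: "x \<notin> supp \<Longrightarrow> grad b x = 0"
  by (simp add: supp_def grad_def partial_outside partial_F_0)

lemma integrable_partial_F_square:
  assumes "b \<in> Basis"
  shows "integrable lborel (\<lambda>x. (partial_deriv b F x)\<^sup>2)"
  by (intro integrable_compact_support[where C = suppF] continuous_intros continuous_partial_F assms compact_suppF)
    (simp add: partial_F_0)

lemma integrable_grad_square:
  assumes b: "b \<in> Basis"
  shows "integrable lborel (\<lambda>x. (grad b x)\<^sup>2)"
proof (rule integrableI_bounded)
  show "(\<lambda>x. (grad b x)\<^sup>2) \<in> borel_measurable lborel" using grad_meas[OF b] by measurable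
  have "(\<integral>\<^sup>+x. ennreal (norm ((grad b x)\<^sup>2)) \<partial>lborel) \<le>
    (\<integral>\<^sup>+x. ennreal ((partial_deriv b F x)\<^sup>2) + ennreal ((grad b x)\<^sup>2) * indicator holes x \<partial>lborel)"
    by (intro nn_integral_mono) (auto simp: grad_def U_eq indicator_def partial_outside)
  also have "\<dots> = (\<integral>\<^sup>+x. ennreal ((partial_deriv b F x)\<^sup>2) \<partial>lborel) + (\<integral>\<^sup>+x\<in>holes. ennreal ((grad b x)\<^sup>2) \<partial>lborel)"
  proof -
    have [measurable]: "grad b \<in> borel_measurable borel" "partial_deriv b F \<in> borel_measurable borel" "holes \<in> sets borel"
      using grad_meas[OF b] borel_measurable_continuous_onI[OF continuous_partial_F[OF b]] open_holes by auto
    show ?thesis by (intro nn_integral_add) measurable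
  qed
  also have "(\<integral>\<^sup>+x\<in>holes. ennreal ((grad b x)\<^sup>2) \<partial>lborel) = (\<integral>\<^sup>+x\<in>holes. ennreal ((partial_deriv b f x)\<^sup>2) \<partial>lborel)"
    by (intro nn_integral_cong) (auto simp: grad_def U_eq indicator_def)
  also have "(\<integral>\<^sup>+x. ennreal ((partial_deriv b F x)\<^sup>2) \<partial>lborel) + \<dots> < \<infinity>"
    using integrable_partial_F_square[OF b] energy_holes[OF b]
    by (auto simp: integrable_iff_bounded ennreal_add_less_top top.not_eq_extremum intro: le_less_trans)
  finally show "(\<integral>\<^sup>+x. ennreal (norm ((grad b x)\<^sup>2)) \<partial>lborel) < \<infinity>" .
qed

lemma integrable_indicator_supp: "integrable lborel (indicator supp :: _ \<Rightarrow> real)"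
  using compact_supp emeasure_bounded_finite[OF compact_imp_bounded[OF compact_supp]]
  by (intro integrable_real_indicator) (auto simp: compact_imp_closed borel_closed)

text \<open>The condition \<open>p \<le> 2\<close> enters here: on the compact set
  \<open>supp\<close> the power is at most 1 plus the square, and off \<open>supp\<close> it
  vanishes.\<close>

lemma integrable_grad_powr:
  assumes b: "b \<in> Basis" and p: "1 \<le> p" "p \<le> 2"
  shows "integrable lborel (\<lambda>x. \<bar>grad b x\<bar> powr p)"
proof (rule Bochner_Integration.integrable_bound)
  show "integrable lborel (\<lambda>x. indicator supp x + (grad b x)\<^sup>2)"
    by (intro Bochner_Integration.integrable_add integrable_grad_square b integrable_indicator_supp)
  show "(\<lambda>x. \<bar>grad b x\<bar> powr p) \<in> borel_measurable lborel"
    using grad_meas[OF b] by measurable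
  show "AE x in lborel. norm (\<bar>grad b x\<bar> powr p) \<le> norm (indicator supp x + (grad b x)\<^sup>2 :: real)"
  proof (rule AE_I2)
    fix x
    have "\<bar>grad b x\<bar> powr p \<le> 1 + (grad b x)\<^sup>2"
    proof (cases "\<bar>grad b x\<bar> \<le> 1")
      case True
      then have "\<bar>grad b x\<bar> powr p \<le> 1 powr p" using p by (intro powr_mono2) auto
      then show ?thesis by (simp add: add_increasing2)
    next
      case False
      then have "\<bar>grad b x\<bar> powr p \<le> \<bar>grad b x\<bar> powr 2" using p by (intro powr_mono) auto
      also have "\<dots> = (grad b x)\<^sup>2" using False by simp
      finally show ?thesis by simp
    qed
    then show "norm (\<bar>grad b x\<bar> powr p) \<le> norm (indicator supp x + (grad b x)\<^sup>2 :: real)"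
      using grad_0[of x b] by (cases "x \<in> supp") auto
  qed
qed

lemma integrable_grad: "b \<in> Basis \<Longrightarrow> integrable lborel (grad b)"
proof -
  assume b: "b \<in> Basis"
  have "integrable lborel (\<lambda>x. \<bar>grad b x\<bar>)"
    using integrable_grad_powr[OF b, of 1] by simp
  then show ?thesis
    using grad_meas[OF b] by (subst (asm) integrable_abs_iff) auto
qed

lemma f_meas: "f \<in> borel_measurable borel"
  using continuous_f by (rule borel_measurable_continuous_onI)

lemma integrable_f: "integrable lborel f"
  by (rule integrable_compact_support[OF continuous_f f_0 compact_supp])

lemma U_sets: "U \<in> sets borel"
  using open_U by auto

lemma restrict_meas: "h \<in> borel_measurable borel \<Longrightarrow> V \<in> sets borel \<Longrightarrow> h \<in> borel_measurable (lebesgue_on V)"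
  by (intro measurable_restrict_space1 measurable_completion) simp

theorem f_in_W1p:
  assumes p: "1 \<le> p" "p \<le> 2"
  shows "f \<in> W1p p (UNIV - sierpinski_gasket)"
proof -
  have "f \<in> Lp p U"
  proof -
    have "integrable lborel (\<lambda>x. \<bar>f x\<bar> powr p)"
    proof (rule Bochner_Integration.integrable_bound[OF integrable_indicator_supp])
      show "(\<lambda>x. \<bar>f x\<bar> powr p) \<in> borel_measurable lborel" using f_meas by measurable
      show "AE x in lborel. norm (\<bar>f x\<bar> powr p) \<le> norm (indicator supp x :: real)"
      proof (rule AE_I2)
        fix x
        have "\<bar>f x\<bar> powr p \<le> 1 powr p" using f_bounds[of x] p by (intro powr_mono2) auto
        then show "norm (\<bar>f x\<bar> powr p) \<le> norm (indicator supp x :: real)"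
          using f_0[of x] by (cases "x \<in> supp") auto
      qed
    qed
    then show ?thesis
      unfolding Lp_def using integrable_lborel_restrict[OF _ U_sets] restrict_meas[OF f_meas U_sets] by simp
  qed
  moreover have "\<exists>g\<in>Lp p U. weak_partial_deriv U b f g" if b: "b \<in> Basis" for b
  proof
    show "grad b \<in> Lp p U"
      unfolding Lp_def using integrable_lborel_restrict[OF integrable_grad_powr[OF b p] U_sets]
        restrict_meas[OF grad_meas[OF b] U_sets] by simp
    have loc: "locally_integrable U h" if "integrable lborel h" for h
      unfolding locally_integrable_def using that compact_imp_closed
      by (auto intro!: integrable_lborel_restrict borel_closed)
    show "weak_partial_deriv U b f (grad b)"
      unfolding weak_partial_deriv_def
    proof (intro conjI ballI loc integrable_f integrable_grad b)
      fix \<phi> assume \<phi>: "\<phi> \<in> test_functions U"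
      have ck: "C_k k \<phi>" for k using \<phi> by (simp add: test_functions_def)
      have m: "\<phi> \<in> borel_measurable borel" "partial_deriv b \<phi> \<in> borel_measurable borel"
        using ck[of 0] ck[of 1] b by (auto intro: borel_measurable_continuous_onI)
      have "(LINT x|lebesgue_on U. f x * partial_deriv b \<phi> x) = (LINT x|lborel. f x * partial_deriv b \<phi> x)"
        unfolding U_def using m f_meas by (intro integral_lebesgue_on_co_null sierpinski_gasket_null) measurable
      also have "\<dots> = - (LINT x|lborel. (if x \<in> U then frechet_derivative f (at x) b else 0) * \<phi> x)"
        using continuous_partial[OF b]
        by (intro integral_by_parts_test(3)[OF open_U continuous_f f_has_derivative _ b \<phi>]) (auto simp: partial_deriv_def)
      also have "\<dots> = - (LINT x|lborel. grad b x * \<phi> x)"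
        unfolding grad_def partial_deriv_def ..
      also have "(LINT x|lborel. grad b x * \<phi> x) = (LINT x|lebesgue_on U. grad b x * \<phi> x)"
        unfolding U_def using m grad_meas[OF b]
        by (intro integral_lebesgue_on_co_null[symmetric] sierpinski_gasket_null) measurable
      finally show "(LINT x|lebesgue_on U. f x * partial_deriv b \<phi> x) = - (LINT x|lebesgue_on U. grad b x * \<phi> x)" .
    qed
  qed
  ultimately show ?thesis by (auto simp: W1p_def U_def)
qed

lemma integral_grad_eq_0:
  assumes "f \<in> W1p p UNIV" and b: "b \<in> Basis"
  shows "(LINT x|lborel. grad b x) = 0"
proof -
  obtain h where w: "weak_partial_deriv UNIV b f h"
    using assms by (auto simp: W1p_def)
  have g: "grad b = (\<lambda>x. if x \<in> UNIV - sierpinski_gasket then frechet_derivative f (at x) b else 0)"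
    by (auto simp: grad_def U_def partial_deriv_def)
  show ?thesis
  proof (rule integral_weak_deriv_eq_0[OF b integrable_f integrable_grad[OF b]])
    fix \<psi> :: "real \<times> real \<Rightarrow> real" assume \<psi>: "\<psi> \<in> test_functions UNIV"
    show "(LINT x|lborel. f x * partial_deriv b \<psi> x) = - (LINT x|lborel. grad b x * \<psi> x)"
      unfolding g
    proof (rule weak_partial_deriv_co_null[OF w b sierpinski_gasket_null _ continuous_f _ _ _ \<psi>])
      show "open (UNIV - sierpinski_gasket)" using open_U by (simp add: U_def)
      show "(f has_derivative frechet_derivative f (at x)) (at x)" if "x \<in> UNIV - sierpinski_gasket" for x
        using f_has_derivative that by (simp add: U_def)
      show "continuous_on (UNIV - sierpinski_gasket) (\<lambda>x. frechet_derivative f (at x) b)"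
        using continuous_partial[OF b] by (simp add: U_def partial_deriv_def[abs_def])
    qed (use integrable_grad[OF b] in \<open>simp add: g\<close>)
  qed
qed

text \<open>The derivative of \<open>F\<close> has total integral 0, hence integral at most
  \<open>- d\<close> outside the large triangle. If \<open>f\<close> were in the space,
  \<open>grad b\<close> would have to supply at least \<open>d\<close> inside; but there its
  \<open>L^1\<close> norm is at most \<open>d / 2\<close> by the energy bound.\<close>

lemma f_notin_W1p:
  assumes b: "b \<in> Basis" and d: "0 < d" "d \<le> (LINT x|lborel. indicator (cell 0 0) x * partial_deriv b F x)"
    and \<kappa>d: "1728 * \<kappa> \<le> d\<^sup>2 / 16"
  shows "f \<notin> W1p p UNIV"
proof
  assume "f \<in> W1p p UNIV"
  from integral_grad_eq_0[OF this b] have g0: "(LINT x|lborel. grad b x) = 0" .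
  let ?I = "indicator (cell 0 0) :: real \<times> real \<Rightarrow> real"
  have cs: "cell 0 0 \<in> sets borel" using closed_cell by auto
  have F_int: "integrable lborel (partial_deriv b F)"
    by (intro integrable_compact_support[where C = suppF] continuous_partial_F b partial_F_0 compact_suppF)
  have F0: "(LINT x|lborel. partial_deriv b F x) = 0"
    unfolding partial_deriv_def
  proof (rule integral_partial_deriv_eq_0[OF F_has_derivative _ F_0])
    show "continuous_on UNIV (\<lambda>x. frechet_derivative F (at x) b)"
      using continuous_partial_F[OF b] by (simp add: partial_deriv_def[abs_def])
  qed (auto simp: compact_suppF)
  have IF: "integrable lborel (\<lambda>x. ?I x * partial_deriv b F x)"
    using integrable_mult_indicator[of "cell 0 0" lborel "partial_deriv b F"] F_int cs by simp
  have Ig: "integrable lborel (\<lambda>x. ?I x * grad b x)"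
    using integrable_mult_indicator[of "cell 0 0" lborel "grad b"] integrable_grad[OF b] cs by simp
  have AE: "AE x in lborel. grad b x = partial_deriv b F x - ?I x * partial_deriv b F x + ?I x * grad b x"
    using AE_not_in[OF sierpinski_gasket_null]
  proof eventually_elim
    case (elim x)
    then have "x \<in> U" by (simp add: U_def)
    then show ?case by (auto simp: indicator_def grad_def partial_outside)
  qed
  have "0 = (LINT x|lborel. partial_deriv b F x - ?I x * partial_deriv b F x + ?I x * grad b x)"
    unfolding g0[symmetric]
    using AE IF Ig F_int integrable_grad[OF b] by (intro integral_cong_AE) (auto intro: borel_measurable_integrable)
  also have "\<dots> = (LINT x|lborel. ?I x * grad b x) - (LINT x|lborel. ?I x * partial_deriv b F x)"
    using IF Ig F_int F0 by simp
  finally have dg: "d \<le> (LINT x|lborel. ?I x * grad b x)" using d by simp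
  have TTs: "holes \<in> sets borel" using open_holes by auto
  have cell_le: "emeasure lborel (cell 0 0) \<le> 1" using emeasure_cell_le[of 0 0] by simp
  have "ennreal d \<le> ennreal (LINT x|lborel. ?I x * grad b x)" using dg by (intro ennreal_leI)
  also have "\<dots> \<le> ennreal (norm (LINT x|lborel. ?I x * grad b x))" by (intro ennreal_leI) auto
  also have "\<dots> \<le> (\<integral>\<^sup>+x. ennreal (norm (?I x * grad b x)) \<partial>lborel)"
    using integral_norm_bound_ennreal[OF Ig] .
  also have "\<dots> = (\<integral>\<^sup>+x. ennreal (norm (indicator holes x * partial_deriv b f x)) \<partial>lborel)"
    using holes_subset_cell by (intro nn_integral_cong) (auto simp: indicator_def grad_def U_eq)
  also have "\<dots> \<le> (\<integral>\<^sup>+x. ennreal (d / 4) * indicator (cell 0 0) x +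
      ennreal (4 / d) * (ennreal ((grad b x)\<^sup>2) * indicator holes x) \<partial>lborel)"
  proof (intro nn_integral_mono)
    fix x
    show "ennreal (norm (indicator holes x * partial_deriv b f x)) \<le> ennreal (d / 4) * indicator (cell 0 0) x +
      ennreal (4 / d) * (ennreal ((grad b x)\<^sup>2) * indicator holes x)"
    proof (cases "x \<in> holes")
      case True
      then have x: "x \<in> cell 0 0" "x \<in> U" using holes_subset_cell by (auto simp: U_eq)
      let ?t = "\<bar>partial_deriv b f x\<bar>"
      \<comment> \<open>Young's inequality \<open>?t \<le> d / 4 + 4 / d * ?t\<^sup>2\<close>,
        weighted such that area at most 1 and energy at most \<open>d\<^sup>2 / 16\<close>
        contribute \<open>d / 4\<close> each.\<close>
      have "0 \<le> (?t - d / 4)\<^sup>2 + ?t * (d / 4)" using d by simp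
      then have le: "?t * d / 4 \<le> ?t\<^sup>2 + (d / 4)\<^sup>2"
        by (simp add: power2_diff mult.commute)
      have "?t = ?t * d / 4 * (4 / d)" using d by simp
      also have "\<dots> \<le> (?t\<^sup>2 + (d / 4)\<^sup>2) * (4 / d)"
        using le d by (intro mult_right_mono) auto
      also have "\<dots> = d / 4 + 4 / d * ?t\<^sup>2"
        using d by (simp add: field_simps power2_eq_square del: power2_abs)
      finally have "?t \<le> d / 4 + 4 / d * ?t\<^sup>2" .
      then have "ennreal ?t \<le> ennreal (d / 4 + 4 / d * ?t\<^sup>2)" by (rule ennreal_leI)
      also have "\<dots> = ennreal (d / 4) + ennreal (4 / d) * ennreal (?t\<^sup>2)"
        using d by (simp add: ennreal_mult''[symmetric] ennreal_plus[symmetric] del: ennreal_plus)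
      finally show ?thesis using True x by (simp add: grad_def)
    qed simp
  qed
  also have "\<dots> = ennreal (d / 4) * emeasure lborel (cell 0 0) +
      ennreal (4 / d) * (\<integral>\<^sup>+x\<in>holes. ennreal ((grad b x)\<^sup>2) \<partial>lborel)"
    using grad_meas[OF b] TTs cs by (subst nn_integral_add) (auto simp: nn_integral_cmult)
  also have "(\<integral>\<^sup>+x\<in>holes. ennreal ((grad b x)\<^sup>2) \<partial>lborel) = (\<integral>\<^sup>+x\<in>holes. ennreal ((partial_deriv b f x)\<^sup>2) \<partial>lborel)"
    by (intro nn_integral_cong) (auto simp: grad_def U_eq indicator_def)
  also have "ennreal (d / 4) * emeasure lborel (cell 0 0) + ennreal (4 / d) * \<dots> \<le>
      ennreal (d / 4) * 1 + ennreal (4 / d) * ennreal (1728 * \<kappa>)"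
    by (intro add_mono mult_left_mono cell_le energy_holes b) auto
  also have "\<dots> \<le> ennreal (d / 4) * 1 + ennreal (4 / d) * ennreal (d\<^sup>2 / 16)"
    by (intro add_mono mult_left_mono ennreal_leI \<kappa>d) auto
  also have "\<dots> = ennreal (d / 4 + 4 / d * (d\<^sup>2 / 16))"
    using d by (simp add: ennreal_mult''[symmetric] ennreal_plus[symmetric] del: ennreal_plus)
  also have "d / 4 + 4 / d * (d\<^sup>2 / 16) = d / 2"
    using d by (simp add: field_simps power2_eq_square)
  finally show False using d by (simp add: ennreal_le_iff)
qed

end

text \<open>The box is deliberately asymmetric: vertically it reaches from -1 to 4, so the unit
  square lies below its centre and the function increases upwards there. The logarithmic derivative
  is \<open>1 / (v + 1)\<^sup>2 - 1 / (4 - v)\<^sup>2\<close>.\<close>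

lemma bump_partial_pos:
  defines "F \<equiv> bump 1 (-1, -1) (2 :: real, 4 :: real)"
  assumes x: "x \<in> cbox (0, 0) (1, 1)"
  shows "partial_deriv (0, 1) F x > 0"
proof -
  let ?a = "(1, 0) :: real \<times> real" and ?b = "(0, 1) :: real \<times> real"
  have F: "F = (\<lambda>x. (flat 0 (x \<bullet> ?a + 1) * flat 0 (x \<bullet> (- ?a) + 2)) * (flat 0 (x \<bullet> ?b + 1) * flat 0 (x \<bullet> (- ?b) + 4)))"
    by (auto simp: F_def bump_def Basis_prod_def fun_eq_iff inner_prod_def ac_simps)
  obtain u v where uv: "x = (u, v)" "0 \<le> u" "u \<le> 1" "0 \<le> v" "v \<le> 1"
    using x by (cases x) (auto simp: cbox_Pair_eq)
  let ?c = "flat 0 (u + 1) * flat 0 (2 - u)"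
  have "(F has_derivative (\<lambda>h.
      (flat 0 (x \<bullet> ?a + 1) * flat 0 (x \<bullet> (- ?a) + 2)) *
        (flat 0 (x \<bullet> ?b + 1) * ((flat (0 + 2) (x \<bullet> (- ?b) + 4) - real 0 * flat (0 + 1) (x \<bullet> (- ?b) + 4)) * (h \<bullet> (- ?b))) +
         ((flat (0 + 2) (x \<bullet> ?b + 1) - real 0 * flat (0 + 1) (x \<bullet> ?b + 1)) * (h \<bullet> ?b)) * flat 0 (x \<bullet> (- ?b) + 4)) +
      (flat 0 (x \<bullet> ?a + 1) * ((flat (0 + 2) (x \<bullet> (- ?a) + 2) - real 0 * flat (0 + 1) (x \<bullet> (- ?a) + 2)) * (h \<bullet> (- ?a))) +
         ((flat (0 + 2) (x \<bullet> ?a + 1) - real 0 * flat (0 + 1) (x \<bullet> ?a + 1)) * (h \<bullet> ?a)) * flat 0 (x \<bullet> (- ?a) + 2)) *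
        (flat 0 (x \<bullet> ?b + 1) * flat 0 (x \<bullet> (- ?b) + 4)))) (at x)"
    unfolding F by (intro has_derivative_mult has_derivative_flat_affine)
  from partial_deriv_eqI[OF this, of ?b]
  have "partial_deriv ?b F x = ?c * (flat 2 (v + 1) * flat 0 (4 - v) - flat 0 (v + 1) * flat 2 (4 - v))"
    by (simp add: uv inner_prod_def eval_nat_numeral algebra_simps)
  also have "flat 2 (v + 1) = flat 0 (v + 1) / (v + 1)\<^sup>2" using uv by (simp add: flat_def)
  also have "flat 2 (4 - v) = flat 0 (4 - v) / (4 - v)\<^sup>2" using uv by (simp add: flat_def)
  also have "?c * (flat 0 (v + 1) / (v + 1)\<^sup>2 * flat 0 (4 - v) - flat 0 (v + 1) * (flat 0 (4 - v) / (4 - v)\<^sup>2)) =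
     ?c * (flat 0 (v + 1) * flat 0 (4 - v)) * (1 / (v + 1)\<^sup>2 - 1 / (4 - v)\<^sup>2)"
    by (simp add: algebra_simps)
  also have "\<dots> > 0"
  proof -
    have "(v + 1)\<^sup>2 < (4 - v)\<^sup>2" using uv by (intro power_strict_mono) auto
    then have "1 / (4 - v)\<^sup>2 < 1 / (v + 1)\<^sup>2" using uv by (intro divide_strict_left_mono) auto
    then show ?thesis using uv by (intro mult_pos_pos flat_bounds) auto
  qed
  finally show ?thesis .
qed

lemma bump_integral_pos:
  defines "F \<equiv> bump 1 (-1, -1) (2 :: real, 4 :: real)"
  shows "0 < (LINT x|lborel. indicator (cell 0 0) x * partial_deriv (0, 1) F x)"
proof -
  let ?p = "partial_deriv (0, 1) F"
  \<comment> \<open>Any nondegenerate rectangle inside the triangle would do; it supplies positive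
    area, and compactness of the cell supplies a positive minimum of the derivative.\<close>
  let ?B = "cbox (2/5, 1/10) (3/5, 1/5) :: (real \<times> real) set"
  have box: "cell 0 0 \<subseteq> cbox (0, 0) (1, 1)" using cell_subset_cbox[of 0 0] by (simp add: zero_prod_def)
  have B: "?B \<subseteq> cell 0 0"
  proof
    fix x assume "x \<in> ?B"
    then obtain u v where x: "x = (u, v)" "2/5 \<le> u" "u \<le> 3/5" "1/10 \<le> v" "v \<le> 1/5"
      by (cases x) (auto simp: cbox_Pair_eq)
    have "v / sqrt 3 \<le> v / 1" using x by (intro divide_left_mono) auto
    with x show "x \<in> cell 0 0" by (auto simp: cell_def all_less_3 bary_def)
  qed
  have pos: "?p x > 0" if "x \<in> cell 0 0" for x
    unfolding F_def using bump_partial_pos that box by blast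
  have pc: "continuous_on A ?p" for A
    using C_k_bump[of 1 1 "(-1, -1)" "(2, 4) :: real \<times> real"]
    by (auto simp: F_def Basis_prod_def intro: continuous_on_subset)
  have cc: "compact (cell 0 0)" using closed_cell bounded_subset[OF bounded_cbox box] by (simp add: compact_eq_bounded_closed)
  have int: "integrable lborel (\<lambda>x. indicator (cell 0 0) x *\<^sub>R ?p x)"
    by (intro borel_integrable_compact cc pc)
  have ne: "cell 0 0 \<noteq> {}" using B subsetD[OF B, of "(2/5, 1/10)"] by (auto simp: cbox_Pair_eq)
  obtain m where m: "m \<in> cell 0 0" "\<And>x. x \<in> cell 0 0 \<Longrightarrow> ?p m \<le> ?p x"
    using continuous_attains_inf[OF cc ne pc] by blast
  have "0 < ?p m * measure lborel ?B"
    using pos[OF m(1)] by (intro mult_pos_pos) (auto simp: measure_lborel_cbox_eq Basis_prod_def inner_prod_def)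
  also have "\<dots> = (LINT x|lborel. ?p m * indicator ?B x)"
    by simp
  also have "\<dots> \<le> (LINT x|lborel. indicator (cell 0 0) x *\<^sub>R ?p x)"
  proof (rule integral_mono)
    show "integrable lborel (\<lambda>x. ?p m * indicator ?B x)"
      by (intro integrable_mult_right integrable_real_indicator) (auto simp: emeasure_lborel_cbox_eq)
    show "?p m * indicator ?B x \<le> indicator (cell 0 0) x *\<^sub>R ?p x" for x
      using B m(2)[of x] pos[of x] by (auto simp: indicator_def less_imp_le)
  qed (rule int)
  finally show ?thesis by simp
qed

theorem theorem1p6:
  fixes p :: real
  assumes "1 \<le> p" and "p \<le> 2"
  shows "\<not> W1p_removable p sierpinski_gasket \<and>
    (\<exists>f :: real \<times> real \<Rightarrow> real. continuous_on UNIV f \<and>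
       f \<in> W1p p (UNIV - sierpinski_gasket) \<and> f \<notin> W1p p UNIV)"
proof -
  define F :: "real \<times> real \<Rightarrow> real" where "F = bump 1 (-1, -1) (2, 4)"
  define d where "d = (LINT x|lborel. indicator (cell 0 0) x * partial_deriv (0, 1) F x)"
  have d: "0 < d" unfolding d_def F_def by (rule bump_integral_pos)
  \<comment> \<open>The number 27648 is \<open>16 * 1728\<close>, chosen so that the energy bound
    \<open>1728 * \<kappa>\<close> is at most \<open>d\<^sup>2 / 16\<close>.\<close>
  define \<kappa> where "\<kappa> = min (1 / 10) (d\<^sup>2 / 27648)"
  interpret gasket_sobolev F \<kappa>
  proof
    show "F \<in> test_functions UNIV" unfolding F_def by (rule bump_test) auto
  qed (use d in \<open>auto simp: F_def bump_bounds \<kappa>_def\<close>)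
  have "1728 * \<kappa> \<le> d\<^sup>2 / 16" by (simp add: \<kappa>_def min_def)
  then have "f \<notin> W1p p UNIV"
    by (intro f_notin_W1p[of "(0, 1)" d] d) (auto simp: d_def Basis_prod_def)
  then have "continuous_on UNIV f \<and> f \<in> W1p p (UNIV - sierpinski_gasket) \<and> f \<notin> W1p p UNIV"
    using continuous_f f_in_W1p[OF assms] by blast
  then show ?thesis by (auto simp: W1p_removable_def)
qed

end
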